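(* Let $\sigma\in\{0,1\}$ and $s>\frac32$. The filamentation equation $\partial_t u=\partial_x\mathcal{C}_\sigma[u]$ is locally well-posed in $H^s$. More precisely, for every $u_0\in H^s(\mathbb{T})$ with $\mathbb{P}_+u_0=u_0$, there exist $T>0$ and a unique solution $u\in\mathcal{C}([0,T],H^s(\mathbb{T}))$, with $\mathbb{P}_+u(t)=u(t)$ for all $t$, of the Cauchy problem $$\begin{cases}\partial_t u=\partial_x\mathcal{C}_\sigma[u],\\ u(t=0)=u_0.\end{cases}$$
   Context: $\mathbb{T}=\mathbb{R}/(2\pi\mathbb{Z})$; functions are complex valued. $\mathbb{P}_+$ is the Fourier projector onto positive frequencies: $\mathbb{P}_+e^{ikx}=\mathbf{1}_{[1,\infty)}(k)e^{ikx}$ for $k\in\mathbb{Z}$. Solutions are complex functions $u(t,x)$ on $\mathbb{T}$ with positive spectrum, $\mathbb{P}_+u=u$, i.e. $u=\sum_{k\ge1}a_ke^{ikx}$. The cubic term is $$\mathcal{C}_\sigma[u](x)=\mathbb{P}_+\left[\frac1{4\pi}\int_0^{2\pi}\frac{|u(x)-u(y)|^2(u(x)-u(y))}{1-\cos(x-y)}\,dy-\sigma|u(x)|^2u(x)\right].$$ For $s>\frac32$ one has $H^s(\mathbb{T})\subset C^1(\mathbb{T})$, so the integral converges. $H^s(\mathbb{T})$ is the usual $L^2$-based Sobolev space, and the equation is understood in the sense of distributions. *)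

theory Defs
  imports "HOL-Analysis.Analysis"
begin

text \<open>
  Functions on the torus are \<open>2\<pi>\<close>-periodic Borel functions on the real line.  As usual for
  \<open>L\<^sup>2\<close>-based spaces, such functions are identified when they agree almost everywhere; this
  identification is kept explicit through the relation below.
\<close>

definition ae_eq :: "(real \<Rightarrow> complex) \<Rightarrow> (real \<Rightarrow> complex) \<Rightarrow> bool" where
  "ae_eq f g \<longleftrightarrow> (AE x in lborel. f x = g x)"

definition L2_torus :: "(real \<Rightarrow> complex) set" where
  "L2_torus = {f. (\<forall>x. f (x + 2 * pi) = f x) \<and> f \<in> borel_measurable borel \<and>
     set_integrable lborel {0..2 * pi} (\<lambda>x. (cmod (f x))\<^sup>2)}"

definition fourier_coeff :: "(real \<Rightarrow> complex) \<Rightarrow> int \<Rightarrow> complex" where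
  "fourier_coeff f k =
     1 / (2 * of_real pi) * (LBINT x:{0..2 * pi}. f x * exp (- \<i> * of_int k * of_real x))"

text \<open>The space \<open>H\<^sup>s\<close> is only meant for \<open>s \<ge> 0\<close>, where it is contained in \<open>L\<^sup>2\<close>.\<close>

definition sobolev_torus :: "real \<Rightarrow> (real \<Rightarrow> complex) set" where
  "sobolev_torus s = {f \<in> L2_torus.
     (\<lambda>k::int. (1 + (real_of_int k)\<^sup>2) powr s * (cmod (fourier_coeff f k))\<^sup>2) summable_on UNIV}"

definition sobolev_norm :: "real \<Rightarrow> (real \<Rightarrow> complex) \<Rightarrow> real" where
  "sobolev_norm s f = sqrt (\<Sum>\<^sub>\<infinity>k::int.
     (1 + (real_of_int k)\<^sup>2) powr s * (cmod (fourier_coeff f k))\<^sup>2)"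

text \<open>
  The Fourier projector onto the frequencies \<open>k \<ge> 1\<close> as an operator on \<open>L\<^sup>2\<close>.  The function chosen
  exists by the Riesz-Fischer theorem and is unique up to equality almost everywhere.
\<close>

definition proj_pos :: "(real \<Rightarrow> complex) \<Rightarrow> real \<Rightarrow> complex" where
  "proj_pos f = (SOME g. g \<in> L2_torus \<and>
     (\<forall>k::int. fourier_coeff g k = (if 1 \<le> k then fourier_coeff f k else 0)))"

definition cubic_term :: "real \<Rightarrow> (real \<Rightarrow> complex) \<Rightarrow> real \<Rightarrow> complex" where
  "cubic_term \<sigma> u = proj_pos (\<lambda>x.
     1 / (4 * of_real pi) *
       (LBINT y:{0..2 * pi}.
          of_real ((cmod (u x - u y))\<^sup>2) * (u x - u y) / of_real (1 - cos (x - y)))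
     - of_real \<sigma> * of_real ((cmod (u x))\<^sup>2) * u x)"

definition partial_t :: "(real \<Rightarrow> real \<Rightarrow> complex) \<Rightarrow> real \<Rightarrow> real \<Rightarrow> complex" where
  "partial_t \<phi> t x = vector_derivative (\<lambda>\<tau>. \<phi> \<tau> x) (at t)"

definition partial_x :: "(real \<Rightarrow> real \<Rightarrow> complex) \<Rightarrow> real \<Rightarrow> real \<Rightarrow> complex" where
  "partial_x \<phi> t x = vector_derivative (\<lambda>y. \<phi> t y) (at x)"

text \<open>
  Being of class \<open>C\<^sup>\<infinity>\<close> in both variables.  The definition is coinductive, so that iterated partial
  derivatives of every order exist and are jointly continuous.
\<close>

coinductive smooth :: "(real \<Rightarrow> real \<Rightarrow> complex) \<Rightarrow> bool" where
  "continuous_on UNIV (\<lambda>(t, x). \<phi> t x) \<Longrightarrow>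
   (\<And>t x. (\<lambda>\<tau>. \<phi> \<tau> x) differentiable (at t)) \<Longrightarrow>
   (\<And>t x. (\<lambda>y. \<phi> t y) differentiable (at x)) \<Longrightarrow>
   smooth (partial_t \<phi>) \<Longrightarrow> smooth (partial_x \<phi>) \<Longrightarrow> smooth \<phi>"

text \<open>Test functions on \<open>(0,T) \<times> \<T>\<close>, extended by zero to all times.\<close>

definition test_function :: "real \<Rightarrow> (real \<Rightarrow> real \<Rightarrow> complex) \<Rightarrow> bool" where
  "test_function T \<phi> \<longleftrightarrow> smooth \<phi> \<and> (\<forall>t x. \<phi> t (x + 2 * pi) = \<phi> t x) \<and>
     (\<exists>a b. 0 < a \<and> b < T \<and> (\<forall>t x. \<phi> t x \<noteq> 0 \<longrightarrow> t \<in> {a..b}))"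

definition continuous_in_sobolev :: "real \<Rightarrow> real \<Rightarrow> (real \<Rightarrow> real \<Rightarrow> complex) \<Rightarrow> bool" where
  "continuous_in_sobolev s T u \<longleftrightarrow> (\<forall>t\<in>{0..T}. u t \<in> sobolev_torus s \<and>
     ((\<lambda>\<tau>. sobolev_norm s (\<lambda>x. u \<tau> x - u t x)) \<longlongrightarrow> 0) (at t within {0..T}))"

text \<open>
  The equation \<open>\<partial>\<^sub>t u = \<partial>\<^sub>x C\<^sub>\<sigma>[u]\<close> in the sense of distributions on \<open>(0,T) \<times> \<T>\<close>: both derivatives
  are moved to the test function and the two minus signs cancel.  The integrals are iterated because
  \<open>u t\<close> and \<open>cubic_term \<sigma> (u t)\<close> are only determined almost everywhere for each time \<open>t\<close>, so
  joint measurability would depend on the choice of representatives.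
\<close>

definition solves_filamentation_eq :: "real \<Rightarrow> real \<Rightarrow> (real \<Rightarrow> real \<Rightarrow> complex) \<Rightarrow> bool" where
  "solves_filamentation_eq \<sigma> T u \<longleftrightarrow> (\<forall>\<phi>. test_function T \<phi> \<longrightarrow>
     (LBINT t:{0..T}. LBINT x:{0..2 * pi}. u t x * partial_t \<phi> t x) =
     (LBINT t:{0..T}. LBINT x:{0..2 * pi}. cubic_term \<sigma> (u t) x * partial_x \<phi> t x))"

definition filamentation_solution ::
    "real \<Rightarrow> real \<Rightarrow> (real \<Rightarrow> complex) \<Rightarrow> real \<Rightarrow> (real \<Rightarrow> real \<Rightarrow> complex) \<Rightarrow> bool" where
  "filamentation_solution \<sigma> s u0 T u \<longleftrightarrow>
     continuous_in_sobolev s T u \<and>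
     (\<forall>t\<in>{0..T}. ae_eq (proj_pos (u t)) (u t)) \<and>
     solves_filamentation_eq \<sigma> T u \<and>
     ae_eq (u 0) u0"

end

theory Submission
  imports Defs
begin

text \<open>
  Write \<open>u = \<Sum>\<^sub>k\<^sub>\<ge>\<^sub>1 a\<^sub>k e\<^sup>i\<^sup>k\<^sup>x\<close>.  Since \<open>2 (1 - cos z) = |1 - e\<^sup>i\<^sup>z|\<^sup>2\<close>, the quotients \<open>(1 - e\<^sup>i\<^sup>k\<^sup>z) / (1 - e\<^sup>i\<^sup>z)\<close> that
  appear in the singular integral are geometric sums, and counting the pairs of exponents that
  cancel gives the \<open>k\<close>-th coefficient of the cubic term: it is the sum of
  \<open>(min p q r k - \<sigma>) a\<^sub>p (cnj a\<^sub>q) a\<^sub>r\<close> over all frequencies \<open>p, q, r \<ge> 1\<close> with \<open>p + r = q + k\<close>.  The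
  equation therefore says that \<open>a\<^sub>k' = i k\<close> times this sum.

  The coupling \<open>min p q r k - \<sigma>\<close> is invariant under the symmetries of the resonance \<open>p + r = q + k\<close>
  and, as \<open>0 \<le> \<sigma> \<le> 1\<close>, lies between \<open>0\<close> and the smallest of the four frequencies.  By symmetry,
  the time derivative of \<open>\<Sum> W\<^sub>k |a\<^sub>k|\<^sup>2\<close> involves only the combination
  \<open>k W\<^sub>k + q W\<^sub>q - p W\<^sub>p - r W\<^sub>r\<close>.  It vanishes for \<open>W = 1\<close>.  For a weight with moderate growth it is
  bounded by the third largest frequency times the geometric mean of the weights at the two largest
  ones; the coupling contributes the smallest frequency.  So all derivatives fall on the two smallest
  frequencies, and the energy grows at most at the rate \<open>C (\<Sum> k |a\<^sub>k|)\<^sup>2\<close>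
  (\<open>energy_flux_bound\<close>).  The Wiener norm \<open>\<Sum> k |a\<^sub>k|\<close> is controlled by the \<open>H\<^sup>s\<close> norm exactly when
  \<open>s > 3/2\<close>.  The same mechanism, applied to the difference of two solutions, gives stability in the
  square norm without loss of derivatives (\<open>difference_flux_bound\<close>, \<open>l2_stability\<close>).

  Existence is obtained from the truncations to frequencies at most \<open>N\<close>.  These are ordinary
  differential equations, global because \<open>\<Sum> |a\<^sub>k|\<^sup>2\<close> is conserved (\<open>galerkin_solution\<close>).  The weight
  \<open>(1 + k\<^sup>2)\<^sup>s\<close> bounds them in \<open>H\<^sup>s\<close> on a common time interval, the weights
  \<open>(1 + k\<^sup>2)\<^sup>s min(1, k/n)\<close> make their \<open>H\<^sup>s\<close> tails uniformly small, and stability makes them converge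
  (\<open>galerkin_family\<close>, \<open>coefficient_wellposedness\<close>).  The uniform tails give continuity in time with
  values in \<open>H\<^sup>s\<close>.  Stability also compares the truncations with an arbitrary bounded solution of the
  infinite system, which proves uniqueness.

  It remains to translate.  Uniqueness of Fourier coefficients (\<open>fourier_coeffs_unique\<close>) identifies a
  function in \<open>H\<^sup>s\<close> with its absolutely convergent Fourier series; dominated convergence transfers the
  formula for the cubic term from trigonometric polynomials to such series
  (\<open>fourier_coeff_cubic_density\<close>).  Testing the weak equation with \<open>\<psi>(t) e\<^sup>-\<^sup>i\<^sup>k\<^sup>x\<close> and the lemma of
  du Bois-Reymond give the coefficient system (\<open>weak_solution_imp_ode\<close>); conversely the coefficient
  system is summed against the Fourier coefficients of a test function (\<open>ode_imp_weak_solution\<close>).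
\<close>

section \<open>Resonant quadruples\<close>

text \<open>
  Four frequencies that interact resonantly.  Any three of them determine the fourth, which is
  what makes the sums below convolutions.
\<close>

definition quart :: "nat \<Rightarrow> (nat \<times> nat \<times> nat \<times> nat) set" where
  "quart N = {(p, q, r, k). p \<in> {1..N} \<and> q \<in> {1..N} \<and> r \<in> {1..N} \<and> k \<in> {1..N} \<and> p + r = q + k}"

definition triads :: "nat \<Rightarrow> nat \<Rightarrow> (nat \<times> nat \<times> nat) set" where
  "triads N k = {(p, q, r). p \<in> {1..N} \<and> q \<in> {1..N} \<and> r \<in> {1..N} \<and> p + r = q + k}"

definition coupling :: "real \<Rightarrow> nat \<Rightarrow> nat \<Rightarrow> nat \<Rightarrow> nat \<Rightarrow> real" where
  "coupling \<sigma> p q r k = real (min (min p q) (min r k)) - \<sigma>"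

definition trilinear ::
    "real \<Rightarrow> nat \<Rightarrow> (nat \<Rightarrow> complex) \<Rightarrow> (nat \<Rightarrow> complex) \<Rightarrow> (nat \<Rightarrow> complex) \<Rightarrow> nat \<Rightarrow> complex" where
  "trilinear \<sigma> N a b c k =
     (\<Sum>(p, q, r)\<in>triads N k. of_real (coupling \<sigma> p q r k) * (a p * cnj (b q) * c r))"

text \<open>
  Truncated coefficient of the cubic term; only the arguments in \<open>{1..N}\<close> enter.
\<close>

abbreviation cubic :: "real \<Rightarrow> nat \<Rightarrow> (nat \<Rightarrow> complex) \<Rightarrow> nat \<Rightarrow> complex" where
  "cubic \<sigma> N a \<equiv> trilinear \<sigma> N a a a"

abbreviation wiener_norm :: "nat \<Rightarrow> (nat \<Rightarrow> complex) \<Rightarrow> real" where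
  "wiener_norm N a \<equiv> \<Sum>k\<in>{1..N}. real k * cmod (a k)"

lemma finite_quart [simp]: "finite (quart N)"
  by (rule finite_subset[of _ "{1..N} \<times> {1..N} \<times> {1..N} \<times> {1..N}"]) (auto simp: quart_def)

lemma finite_triads [simp]: "finite (triads N k)"
  by (rule finite_subset[of _ "{1..N} \<times> {1..N} \<times> {1..N}"]) (auto simp: triads_def)

lemma sum_quart_eq_sum_triads:
  "(\<Sum>k\<in>{1..N}. \<Sum>(p, q, r)\<in>triads N k. F p q r k) = (\<Sum>(p, q, r, k)\<in>quart N. F p q r k)"
proof -
  have "(\<Sum>k\<in>{1..N}. \<Sum>(p, q, r)\<in>triads N k. F p q r k)
      = (\<Sum>(k, p, q, r)\<in>Sigma {1..N} (triads N). F p q r k)"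
    by (subst sum.Sigma) (auto simp: case_prod_unfold)
  also have "\<dots> = (\<Sum>(p, q, r, k)\<in>quart N. F p q r k)"
    by (rule sum.reindex_bij_witness[of _ "\<lambda>(p, q, r, k). (k, p, q, r)" "\<lambda>(k, p, q, r). (p, q, r, k)"])
       (auto simp: quart_def triads_def)
  finally show ?thesis .
qed

lemma quart_swap_in:
  "(\<Sum>(p, q, r, k)\<in>quart N. F p q r k) = (\<Sum>(p, q, r, k)\<in>quart N. F r q p k)"
  by (rule sum.reindex_bij_witness[of _ "\<lambda>(p, q, r, k). (r, q, p, k)" "\<lambda>(p, q, r, k). (r, q, p, k)"])
     (auto simp: quart_def)

lemma quart_swap_out:
  "(\<Sum>(p, q, r, k)\<in>quart N. F p q r k) = (\<Sum>(p, q, r, k)\<in>quart N. F p k r q)"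
  by (rule sum.reindex_bij_witness[of _ "\<lambda>(p, q, r, k). (p, k, r, q)" "\<lambda>(p, q, r, k). (p, k, r, q)"])
     (auto simp: quart_def)

lemma quart_swap_sides:
  "(\<Sum>(p, q, r, k)\<in>quart N. F p q r k) = (\<Sum>(p, q, r, k)\<in>quart N. F q p k r)"
  by (rule sum.reindex_bij_witness[of _ "\<lambda>(p, q, r, k). (q, p, k, r)" "\<lambda>(p, q, r, k). (q, p, k, r)"])
     (auto simp: quart_def)

text \<open>
  The first three entries determine the quadruple, so the sum runs over a subset of a product.
\<close>

lemma quart_sum_le_product:
  fixes x y z :: "nat \<Rightarrow> real"
  assumes "\<And>k. 0 \<le> x k" "\<And>k. 0 \<le> y k" "\<And>k. 0 \<le> z k"
  shows "(\<Sum>(p, q, r, k)\<in>quart N. x p * y q * z r) \<le> sum x {1..N} * sum y {1..N} * sum z {1..N}"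
proof -
  define pr :: "nat \<times> nat \<times> nat \<times> nat \<Rightarrow> nat \<times> nat \<times> nat" where "pr = (\<lambda>(p, q, r, k). (p, q, r))"
  have inj: "inj_on pr (quart N)"
    by (auto simp: inj_on_def pr_def quart_def)
  have "(\<Sum>(p, q, r, k)\<in>quart N. x p * y q * z r) = (\<Sum>(p, q, r)\<in>pr ` quart N. x p * y q * z r)"
    by (subst sum.reindex[OF inj]) (auto simp: pr_def case_prod_unfold)
  also have "\<dots> \<le> (\<Sum>(p, q, r)\<in>{1..N} \<times> {1..N} \<times> {1..N}. x p * y q * z r)"
    by (rule sum_mono2) (auto simp: pr_def quart_def assms)
  also have "\<dots> = sum x {1..N} * sum y {1..N} * sum z {1..N}"
    by (simp add: sum.cartesian_product[symmetric] sum_distrib_left[symmetric]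
        sum_distrib_right[symmetric])
  finally show ?thesis .
qed

text \<open>
  Young's inequality for convolutions, with the square norm taken at two frequencies on opposite
  sides of the resonance.  By the arithmetic-geometric mean inequality one of the two may be dropped,
  after which three free frequencies remain.
\<close>

lemma quart_sum_le_across:
  fixes x y z d :: "nat \<Rightarrow> real"
  assumes "\<And>k. 0 \<le> x k" "\<And>k. 0 \<le> y k" "\<And>k. 0 \<le> z k" "\<And>k. 0 \<le> d k"
  shows "(\<Sum>(p, q, r, k)\<in>quart N. x p * y q * z r * d k)
    \<le> ((\<Sum>k\<in>{1..N}. (x k)\<^sup>2) + (\<Sum>k\<in>{1..N}. (d k)\<^sup>2)) / 2 * (sum y {1..N} * sum z {1..N})"
proof -
  have "(\<Sum>(p, q, r, k)\<in>quart N. x p * y q * z r * d k)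
      \<le> (\<Sum>(p, q, r, k)\<in>quart N. (x p)\<^sup>2 * y q * z r / 2 + (d k)\<^sup>2 * y q * z r / 2)"
  proof (rule sum_mono, clarify)
    fix p q r k
    have "0 \<le> (x p - d k)\<^sup>2 * (y q * z r)" by (simp add: assms)
    then show "x p * y q * z r * d k \<le> (x p)\<^sup>2 * y q * z r / 2 + (d k)\<^sup>2 * y q * z r / 2"
      by (simp add: power2_eq_square algebra_simps)
  qed
  also have "\<dots> = (\<Sum>(p, q, r, k)\<in>quart N. (x p)\<^sup>2 * y q * z r) / 2
      + (\<Sum>(p, q, r, k)\<in>quart N. (d k)\<^sup>2 * y q * z r) / 2"
    by (simp add: case_prod_unfold sum.distrib sum_divide_distrib)
  also have "(\<Sum>(p, q, r, k)\<in>quart N. (d k)\<^sup>2 * y q * z r) = (\<Sum>(p, q, r, k)\<in>quart N. y p * z q * (d r)\<^sup>2)"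
    by (subst quart_swap_sides, subst quart_swap_out) (simp add: mult_ac case_prod_unfold)
  also have "(\<Sum>(p, q, r, k)\<in>quart N. (x p)\<^sup>2 * y q * z r) / 2
      + (\<Sum>(p, q, r, k)\<in>quart N. y p * z q * (d r)\<^sup>2) / 2 \<le>
      ((\<Sum>k\<in>{1..N}. (x k)\<^sup>2) * sum y {1..N} * sum z {1..N}) / 2 +
      (sum y {1..N} * sum z {1..N} * (\<Sum>k\<in>{1..N}. (d k)\<^sup>2)) / 2"
    by (intro add_mono divide_right_mono quart_sum_le_product assms) auto
  finally show ?thesis by (simp add: algebra_simps)
qed

text \<open>
  As before, but the square norm is taken at the frequencies \<open>q\<close> and \<open>k\<close>, which the symmetry of the
  resonance exchanges.
\<close>

lemma quart_sum_le_same_side: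
  fixes x y z d :: "nat \<Rightarrow> real"
  assumes "\<And>k. 0 \<le> x k" "\<And>k. 0 \<le> y k" "\<And>k. 0 \<le> z k" "\<And>k. 0 \<le> d k"
  shows "(\<Sum>(p, q, r, k)\<in>quart N. x p * y q * z r * d k)
    \<le> ((\<Sum>k\<in>{1..N}. (y k)\<^sup>2) + (\<Sum>k\<in>{1..N}. (d k)\<^sup>2)) / 2 * (sum x {1..N} * sum z {1..N})"
proof -
  have "(\<Sum>(p, q, r, k)\<in>quart N. x p * y q * z r * d k)
      \<le> (\<Sum>(p, q, r, k)\<in>quart N. x p * (y q)\<^sup>2 * z r / 2 + x p * (d k)\<^sup>2 * z r / 2)"
  proof (rule sum_mono, clarify)
    fix p q r k
    have "0 \<le> (y q - d k)\<^sup>2 * (x p * z r)" by (simp add: assms)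
    then show "x p * y q * z r * d k \<le> x p * (y q)\<^sup>2 * z r / 2 + x p * (d k)\<^sup>2 * z r / 2"
      by (simp add: power2_eq_square algebra_simps)
  qed
  also have "\<dots> = (\<Sum>(p, q, r, k)\<in>quart N. x p * (y q)\<^sup>2 * z r) / 2
      + (\<Sum>(p, q, r, k)\<in>quart N. x p * (d k)\<^sup>2 * z r) / 2"
    by (simp add: case_prod_unfold sum.distrib sum_divide_distrib)
  also have "(\<Sum>(p, q, r, k)\<in>quart N. x p * (d k)\<^sup>2 * z r) = (\<Sum>(p, q, r, k)\<in>quart N. x p * (d q)\<^sup>2 * z r)"
    by (subst quart_swap_out) simp
  also have "(\<Sum>(p, q, r, k)\<in>quart N. x p * (y q)\<^sup>2 * z r) / 2
      + (\<Sum>(p, q, r, k)\<in>quart N. x p * (d q)\<^sup>2 * z r) / 2 \<le>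
      (sum x {1..N} * (\<Sum>k\<in>{1..N}. (y k)\<^sup>2) * sum z {1..N}) / 2 +
      (sum x {1..N} * (\<Sum>k\<in>{1..N}. (d k)\<^sup>2) * sum z {1..N}) / 2"
    by (intro add_mono divide_right_mono quart_sum_le_product assms) auto
  finally show ?thesis by (simp add: algebra_simps)
qed

lemma norm_sum_quart_le:
  assumes "\<And>p q r k. (p, q, r, k) \<in> quart N \<Longrightarrow> norm (F p q r k) \<le> G p q r k"
  shows "norm (\<Sum>(p, q, r, k)\<in>quart N. F p q r k) \<le> (\<Sum>(p, q, r, k)\<in>quart N. G p q r k)"
  by (rule sum_norm_le) (use assms in auto)

section \<open>Weights with moderate growth\<close>

text \<open>
  The increment condition says that \<open>k W\<^sub>k\<close> behaves like a power of \<open>k\<close>: its slope on a dyadic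
  block is comparable to \<open>W\<^sub>k\<close>.
\<close>

definition doubling_weight :: "real \<Rightarrow> (nat \<Rightarrow> real) \<Rightarrow> bool" where
  "doubling_weight C W \<longleftrightarrow> 2 \<le> C \<and> (\<forall>k. 0 \<le> W k) \<and> (\<forall>k l. 1 \<le> k \<longrightarrow> k \<le> l \<longrightarrow> W k \<le> W l) \<and>
     (\<forall>k l. 1 \<le> k \<longrightarrow> k \<le> l \<longrightarrow> l \<le> 2 * k \<longrightarrow>
        real l * W l - real k * W k \<le> C * (real l - real k) * W k)"

text \<open>
  Beyond the dyadic block the increment is bounded by \<open>l W\<^sub>l\<close>, and \<open>l \<le> 2 (l - k)\<close> there; this is
  where \<open>2 \<le> C\<close> enters.
\<close>

lemma doubling_weight_increment:
  assumes "doubling_weight C W" "1 \<le> k" "k \<le> l"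
  shows "real l * W l - real k * W k \<le> C * (real l - real k) * W l"
proof (cases "l \<le> 2 * k")
  case True
  have "real l * W l - real k * W k \<le> C * (real l - real k) * W k"
    using assms True by (auto simp: doubling_weight_def)
  also have "\<dots> \<le> C * (real l - real k) * W l"
    using assms by (intro mult_left_mono mult_nonneg_nonneg) (auto simp: doubling_weight_def)
  finally show ?thesis .
next
  case False
  have W: "0 \<le> W k" "0 \<le> W l" "2 \<le> C" using assms by (auto simp: doubling_weight_def)
  have "real l * W l - real k * W k \<le> real l * W l" using W by simp
  also have "\<dots> \<le> (2 * (real l - real k)) * W l"
    using False W by (intro mult_right_mono) auto
  also have "\<dots> \<le> C * (real l - real k) * W l"
    using W assms by (intro mult_right_mono) auto
  finally show ?thesis .
qed

text \<open>
  With \<open>r \<le> q \<le> k \<le> p\<close> the expression is a difference of two nonnegative increments over intervals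
  of the same length \<open>p - k = q - r \<le> q\<close>.  Both are at most \<open>C q W\<^sub>k\<close>: the first because
  \<open>p = k + (q - r) \<le> 2 k\<close>, the second because \<open>q \<le> k\<close>.
\<close>

lemma resonant_increment_ordered:
  assumes "doubling_weight C W" "1 \<le> r" "r \<le> q" "q \<le> k" "k \<le> p" "p + r = q + k"
  shows "\<bar>real k * W k + real q * W q - real p * W p - real r * W r\<bar> * real (min (min p q) (min r k))
    \<le> C * (sqrt (W p) * sqrt (W k) * real q * real r)"
proof -
  have W: "0 \<le> W j" "2 \<le> C" for j using assms by (auto simp: doubling_weight_def)
  have mono: "1 \<le> i \<Longrightarrow> i \<le> j \<Longrightarrow> W i \<le> W j" for i j using assms by (auto simp: doubling_weight_def)
  have d: "real q - real r = real p - real k" using assms(6) by linarith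
  have m: "min (min p q) (min r k) = r" using assms by auto
  have 1: "real p * W p - real k * W k \<le> C * (real p - real k) * W k"
    using assms by (auto simp: doubling_weight_def)
  have "real q * W q - real r * W r \<le> C * (real q - real r) * W q"
    using assms by (intro doubling_weight_increment) auto
  also have "\<dots> \<le> C * (real q - real r) * W k"
    using assms W mono[of q k] by (intro mult_left_mono mult_nonneg_nonneg) auto
  finally have 2: "real q * W q - real r * W r \<le> C * (real p - real k) * W k" using d by simp
  have 3: "0 \<le> real p * W p - real k * W k" "0 \<le> real q * W q - real r * W r"
    using assms mono W by (auto intro!: mult_mono)
  have "\<bar>real k * W k + real q * W q - real p * W p - real r * W r\<bar> \<le> C * (real p - real k) * W k"
    using 1 2 3 by linarith
  also have "\<dots> \<le> C * real q * W k"
    using W d assms by (intro mult_right_mono mult_left_mono) auto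
  also have "C * real q * W k = C * real q * (sqrt (W k) * sqrt (W k))" using W by simp
  also have "\<dots> \<le> C * real q * (sqrt (W p) * sqrt (W k))"
    using W mono[of k p] assms by (intro mult_left_mono mult_right_mono mult_nonneg_nonneg) auto
  finally have "\<bar>real k * W k + real q * W q - real p * W p - real r * W r\<bar> * real r
      \<le> C * real q * (sqrt (W p) * sqrt (W k)) * real r"
    by (intro mult_right_mono) auto
  then show ?thesis unfolding m by (simp add: mult_ac)
qed

text \<open>
  The two largest frequencies lie on opposite sides of the resonance, so one of the four summands
  on the right always dominates.
\<close>

lemma resonant_increment:
  assumes W: "doubling_weight C W" and pos: "1 \<le> p" "1 \<le> q" "1 \<le> r" "1 \<le> k" and res: "p + r = q + k"
  shows "\<bar>real k * W k + real q * W q - real p * W p - real r * W r\<bar> * real (min (min p q) (min r k))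
    \<le> C * (sqrt (W p) * sqrt (W k) * real q * real r + sqrt (W p) * sqrt (W q) * real k * real r
         + sqrt (W r) * sqrt (W k) * real q * real p + sqrt (W r) * sqrt (W q) * real k * real p)"
proof -
  have half: "\<bar>real k * W k + real q * W q - real p * W p - real r * W r\<bar> * real (min (min p q) (min r k))
      \<le> C * (sqrt (W p) * sqrt (W k) * real q * real r)"
    if "r \<le> p" "q \<le> k" "1 \<le> r" "1 \<le> q" "p + r = q + k" for p q r k
  proof (cases "k \<le> p")
    case True
    then show ?thesis using that by (intro resonant_increment_ordered[OF W]) auto
  next
    case False
    have "\<bar>real p * W p + real r * W r - real k * W k - real q * W q\<bar> * real (min (min k r) (min q p))
      \<le> C * (sqrt (W k) * sqrt (W p) * real r * real q)"
      using that False by (intro resonant_increment_ordered[OF W]) auto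
    moreover have "min (min k r) (min q p) = min (min p q) (min r k)" by simp
    moreover have "\<bar>real p * W p + real r * W r - real k * W k - real q * W q\<bar>
      = \<bar>real k * W k + real q * W q - real p * W p - real r * W r\<bar>" by linarith
    ultimately show ?thesis by (simp add: mult_ac)
  qed
  have nn: "0 \<le> W j" "0 \<le> C" for j using W by (auto simp: doubling_weight_def)
  have C4: "C * t \<le> C * (t1 + t2 + t3 + t4)" if "t \<le> t1 + t2 + t3 + t4" for t t1 t2 t3 t4
    using that nn by (intro mult_left_mono) auto
  have rw: "real q * W q + real k * W k = real k * W k + real q * W q" by simp
  consider "r \<le> p" "q \<le> k" | "r \<le> p" "k \<le> q" | "p \<le> r" "q \<le> k" | "p \<le> r" "k \<le> q" by linarith
  then show ?thesis
  proof cases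
    case 1
    from half[OF this pos(3,2) res] show ?thesis
      by (rule order_trans) (intro C4, simp add: nn)
  next
    case 2
    have "\<bar>real q * W q + real k * W k - real p * W p - real r * W r\<bar> * real (min (min p k) (min r q))
      \<le> C * (sqrt (W p) * sqrt (W q) * real k * real r)"
      using half[of r p k q] 2 pos res by auto
    also have "\<dots> \<le> C * (sqrt (W p) * sqrt (W k) * real q * real r + sqrt (W p) * sqrt (W q) * real k * real r
         + sqrt (W r) * sqrt (W k) * real q * real p + sqrt (W r) * sqrt (W q) * real k * real p)"
      by (intro C4) (simp add: nn)
    finally show ?thesis unfolding rw by (simp add: min.commute min.left_commute min.assoc)
  next
    case 3
    have "\<bar>real k * W k + real q * W q - real r * W r - real p * W p\<bar> * real (min (min r q) (min p k))
      \<le> C * (sqrt (W r) * sqrt (W k) * real q * real p)"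
      using half[of p r q k] 3 pos res by auto
    also have "\<dots> \<le> C * (sqrt (W p) * sqrt (W k) * real q * real r + sqrt (W p) * sqrt (W q) * real k * real r
         + sqrt (W r) * sqrt (W k) * real q * real p + sqrt (W r) * sqrt (W q) * real k * real p)"
      by (intro C4) (simp add: nn)
    also have "real k * W k + real q * W q - real r * W r - real p * W p
      = real k * W k + real q * W q - real p * W p - real r * W r" by simp
    finally show ?thesis by (simp add: min.commute min.left_commute min.assoc)
  next
    case 4
    have "\<bar>real q * W q + real k * W k - real r * W r - real p * W p\<bar> * real (min (min r k) (min p q))
      \<le> C * (sqrt (W r) * sqrt (W q) * real k * real p)"
      using half[of p r k q] 4 pos res by auto
    also have "\<dots> \<le> C * (sqrt (W p) * sqrt (W k) * real q * real r + sqrt (W p) * sqrt (W q) * real k * real r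
         + sqrt (W r) * sqrt (W k) * real q * real p + sqrt (W r) * sqrt (W q) * real k * real p)"
      by (intro C4) (simp add: nn)
    also have "real q * W q + real k * W k - real r * W r - real p * W p
      = real k * W k + real q * W q - real p * W p - real r * W r" by simp
    finally show ?thesis by (simp add: min.commute min.left_commute min.assoc)
  qed
qed

section \<open>Energy fluxes of the truncated cubic term\<close>

lemma coupling_bounds:
  assumes "0 \<le> \<sigma>" "\<sigma> \<le> 1" "1 \<le> p" "1 \<le> q" "1 \<le> r" "1 \<le> k"
  shows "0 \<le> coupling \<sigma> p q r k" "coupling \<sigma> p q r k \<le> real (min (min p q) (min r k))"
  using assms by (auto simp: coupling_def)

lemma coupling_sym:
  "coupling \<sigma> r q p k = coupling \<sigma> p q r k" "coupling \<sigma> p k r q = coupling \<sigma> p q r k"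
  "coupling \<sigma> q p k r = coupling \<sigma> p q r k" "coupling \<sigma> k r q p = coupling \<sigma> p q r k"
  by (auto simp: coupling_def min.commute min.left_commute)

lemma sum_trilinear_eq_sum_quart:
  "(\<Sum>k\<in>{1..N}. g k * (trilinear \<sigma> N a b c k * cnj (d k)))
    = (\<Sum>(p, q, r, k)\<in>quart N. g k * (of_real (coupling \<sigma> p q r k) * (a p * cnj (b q) * c r * cnj (d k))))"
  by (subst sum_quart_eq_sum_triads[symmetric])
     (simp add: trilinear_def sum_distrib_left sum_distrib_right case_prod_unfold mult_ac)

text \<open>
  Exchanging \<open>q\<close> with \<open>k\<close>, or \<open>p\<close> with \<open>r\<close>, leaves the interaction term unchanged, and exchanging the
  two sides of the resonance conjugates it; averaging over these symmetries gives the identity.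
\<close>

lemma energy_flux_symmetrized:
  fixes f :: "nat \<Rightarrow> real"
  shows "4 * Im (\<Sum>k\<in>{1..N}. of_real (f k) * (cubic \<sigma> N a k * cnj (a k)))
    = Im (\<Sum>(p, q, r, k)\<in>quart N. of_real ((f k + f q - f p - f r) * coupling \<sigma> p q r k)
        * (a p * cnj (a q) * a r * cnj (a k)))"
proof -
  define X where "X p q r k = of_real (coupling \<sigma> p q r k) * (a p * cnj (a q) * a r * cnj (a k))" for p q r k
  have X: "X r q p k = X p q r k" "X p k r q = X p q r k" "X q p k r = cnj (X p q r k)" for p q r k
    by (simp_all add: X_def coupling_sym mult_ac)
  define S where "S = (\<Sum>(p, q, r, k)\<in>quart N. of_real (f k) * X p q r k)"
  have S1: "(\<Sum>(p, q, r, k)\<in>quart N. of_real (f q) * X p q r k) = S"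
    unfolding S_def by (subst quart_swap_out) (simp add: X(2))
  have S2: "(\<Sum>(p, q, r, k)\<in>quart N. of_real (f r) * X p q r k) = cnj S"
    unfolding S_def by (subst quart_swap_sides) (simp add: X(3)[symmetric] case_prod_unfold)
  have S3: "(\<Sum>(p, q, r, k)\<in>quart N. of_real (f p) * X p q r k) = cnj S"
    by (subst S2[symmetric], subst quart_swap_in) (simp add: X(1))
  have "(\<Sum>(p, q, r, k)\<in>quart N. of_real ((f k + f q - f p - f r) * coupling \<sigma> p q r k)
        * (a p * cnj (a q) * a r * cnj (a k)))
     = S + (\<Sum>(p, q, r, k)\<in>quart N. of_real (f q) * X p q r k)
       - (\<Sum>(p, q, r, k)\<in>quart N. of_real (f p) * X p q r k)
       - (\<Sum>(p, q, r, k)\<in>quart N. of_real (f r) * X p q r k)"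
    unfolding S_def sum.distrib[symmetric] sum_subtractf[symmetric]
    by (intro sum.cong refl) (auto simp: X_def algebra_simps)
  also have "\<dots> = 2 * S - 2 * cnj S" unfolding S1 S2 S3 by simp
  finally have eq: "(\<Sum>(p, q, r, k)\<in>quart N. of_real ((f k + f q - f p - f r) * coupling \<sigma> p q r k)
        * (a p * cnj (a q) * a r * cnj (a k))) = 2 * S - 2 * cnj S" .
  have S': "(\<Sum>k\<in>{1..N}. of_real (f k) * (cubic \<sigma> N a k * cnj (a k))) = S"
    unfolding sum_trilinear_eq_sum_quart S_def X_def ..
  show ?thesis unfolding eq S' by simp
qed

text \<open>
  For the weight \<open>1\<close> the symmetrized factor is the resonance condition itself.
\<close>

lemma energy_flux_L2: "Im (\<Sum>k\<in>{1..N}. of_real (real k) * (cubic \<sigma> N a k * cnj (a k))) = 0"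
proof -
  have "(\<Sum>(p, q, r, k)\<in>quart N. of_real ((real k + real q - real p - real r) * coupling \<sigma> p q r k)
        * (a p * cnj (a q) * a r * cnj (a k))) = 0"
  proof (rule sum.neutral, clarify)
    fix p q r k assume "(p, q, r, k) \<in> quart N"
    then have "real k + real q - real p - real r = 0" by (auto simp: quart_def)
    then show "of_real ((real k + real q - real p - real r) * coupling \<sigma> p q r k)
        * (a p * cnj (a q) * a r * cnj (a k)) = 0" by simp
  qed
  then show ?thesis using energy_flux_symmetrized[where f = real and N = N and \<sigma> = \<sigma> and a = a] by simp
qed

text \<open>
  Each of the four terms of \<open>resonant_increment\<close> puts the square roots of the
  weights on one incoming and one outgoing frequency and a full derivative on the two others, so
  Young's inequality bounds it by the energy times the square of the Wiener norm.
\<close>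

lemma energy_flux_bound:
  assumes \<sigma>: "0 \<le> \<sigma>" "\<sigma> \<le> 1" and W: "doubling_weight C W"
  shows "\<bar>Im (\<Sum>k\<in>{1..N}. of_real (real k * W k) * (cubic \<sigma> N a k * cnj (a k)))\<bar>
    \<le> C * (wiener_norm N a)\<^sup>2 * (\<Sum>k\<in>{1..N}. W k * (cmod (a k))\<^sup>2)"
proof -
  have nn: "0 \<le> W j" "0 \<le> C" for j using W by (auto simp: doubling_weight_def)
  define f where "f k = real k * W k" for k
  define x where "x k = sqrt (W k) * cmod (a k)" for k
  define y where "y k = real k * cmod (a k)" for k
  have xy: "0 \<le> x k" "0 \<le> y k" for k by (auto simp: x_def y_def nn)
  define A where "A = sum y {1..N}"
  define E where "E = (\<Sum>k\<in>{1..N}. (x k)\<^sup>2)"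
  have E: "E = (\<Sum>k\<in>{1..N}. W k * (cmod (a k))\<^sup>2)"
    by (simp add: E_def x_def power_mult_distrib nn)
  have "norm (\<Sum>(p, q, r, k)\<in>quart N. of_real ((f k + f q - f p - f r) * coupling \<sigma> p q r k)
        * (a p * cnj (a q) * a r * cnj (a k)))
    \<le> (\<Sum>(p, q, r, k)\<in>quart N. C * (x p * y q * y r * x k + x p * x q * y r * y k
          + y p * y q * x r * x k + y p * x q * x r * y k))"
  proof (rule norm_sum_quart_le)
    fix p q r k assume Q: "(p, q, r, k) \<in> quart N"
    then have pos: "1 \<le> p" "1 \<le> q" "1 \<le> r" "1 \<le> k" "p + r = q + k" by (auto simp: quart_def)
    define m where "m = cmod (a p) * cmod (a q) * cmod (a r) * cmod (a k)"
    have "norm (of_real ((f k + f q - f p - f r) * coupling \<sigma> p q r k) * (a p * cnj (a q) * a r * cnj (a k)))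
      = (\<bar>f k + f q - f p - f r\<bar> * coupling \<sigma> p q r k) * m"
      using coupling_bounds(1)[OF \<sigma> pos(1-4)] unfolding norm_mult norm_of_real complex_mod_cnj by (simp add: abs_mult m_def)
    also have "\<dots> \<le> (\<bar>f k + f q - f p - f r\<bar> * real (min (min p q) (min r k))) * m"
      using coupling_bounds(2)[OF \<sigma> pos(1-4)] by (intro mult_right_mono mult_left_mono) (auto simp: m_def)
    also have "\<dots> \<le> (C * (sqrt (W p) * sqrt (W k) * real q * real r + sqrt (W p) * sqrt (W q) * real k * real r
         + sqrt (W r) * sqrt (W k) * real q * real p + sqrt (W r) * sqrt (W q) * real k * real p)) * m"
      unfolding f_def by (intro mult_right_mono resonant_increment[OF W] pos) (auto simp: m_def)
    also have "\<dots> = C * (x p * y q * y r * x k + x p * x q * y r * y k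
          + y p * y q * x r * x k + y p * x q * x r * y k)"
      by (simp add: m_def x_def y_def algebra_simps)
    finally show "norm (of_real ((f k + f q - f p - f r) * coupling \<sigma> p q r k) * (a p * cnj (a q) * a r * cnj (a k)))
      \<le> C * (x p * y q * y r * x k + x p * x q * y r * y k
          + y p * y q * x r * x k + y p * x q * x r * y k)" .
  qed
  also have "\<dots> = C * ((\<Sum>(p, q, r, k)\<in>quart N. x p * y q * y r * x k) + (\<Sum>(p, q, r, k)\<in>quart N. x p * x q * y r * y k)
     + (\<Sum>(p, q, r, k)\<in>quart N. y p * y q * x r * x k) + (\<Sum>(p, q, r, k)\<in>quart N. y p * x q * x r * y k))"
    by (simp add: case_prod_unfold sum.distrib sum_distrib_left algebra_simps)
  also have "(\<Sum>(p, q, r, k)\<in>quart N. x p * x q * y r * y k) = (\<Sum>(p, q, r, k)\<in>quart N. x p * y q * y r * x k)"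
    by (subst quart_swap_out) (simp add: mult_ac case_prod_unfold)
  also have "(\<Sum>(p, q, r, k)\<in>quart N. y p * x q * x r * y k) = (\<Sum>(p, q, r, k)\<in>quart N. y p * y q * x r * x k)"
    by (subst quart_swap_out) (simp add: mult_ac case_prod_unfold)
  also have "(\<Sum>(p, q, r, k)\<in>quart N. y p * y q * x r * x k) = (\<Sum>(p, q, r, k)\<in>quart N. x p * y q * y r * x k)"
    by (subst quart_swap_in) (simp add: mult_ac case_prod_unfold)
  also have "C * ((\<Sum>(p, q, r, k)\<in>quart N. x p * y q * y r * x k) + (\<Sum>(p, q, r, k)\<in>quart N. x p * y q * y r * x k)
     + (\<Sum>(p, q, r, k)\<in>quart N. x p * y q * y r * x k) + (\<Sum>(p, q, r, k)\<in>quart N. x p * y q * y r * x k))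
     \<le> C * (E * A\<^sup>2 + E * A\<^sup>2 + E * A\<^sup>2 + E * A\<^sup>2)"
    using quart_sum_le_across[where x = x and y = y and z = y and d = x and N = N] xy nn
    by (intro mult_left_mono add_mono) (auto simp: E_def A_def power2_eq_square)
  finally have "norm (\<Sum>(p, q, r, k)\<in>quart N. of_real ((f k + f q - f p - f r) * coupling \<sigma> p q r k)
        * (a p * cnj (a q) * a r * cnj (a k))) \<le> 4 * (C * A\<^sup>2 * E)" by (simp add: algebra_simps)
  then have "\<bar>Im (\<Sum>(p, q, r, k)\<in>quart N. of_real ((f k + f q - f p - f r) * coupling \<sigma> p q r k)
        * (a p * cnj (a q) * a r * cnj (a k)))\<bar> \<le> 4 * (C * A\<^sup>2 * E)"
    using abs_Im_le_cmod order_trans by blast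
  then have "\<bar>4 * Im (\<Sum>k\<in>{1..N}. of_real (f k) * (cubic \<sigma> N a k * cnj (a k)))\<bar> \<le> 4 * (C * A\<^sup>2 * E)"
    unfolding energy_flux_symmetrized .
  then show ?thesis unfolding E by (simp add: f_def A_def y_def abs_mult)
qed

section \<open>Differences and truncation errors\<close>

lemma trilinear_diff:
  "cubic \<sigma> N a k - cubic \<sigma> N b k = trilinear \<sigma> N (\<lambda>j. a j - b j) a a k
     + trilinear \<sigma> N b (\<lambda>j. a j - b j) a k + trilinear \<sigma> N b b (\<lambda>j. a j - b j) k"
  unfolding trilinear_def sum_subtractf[symmetric] sum.distrib[symmetric]
  by (intro sum.cong refl) (auto simp: algebra_simps)

lemma trilinear_swap: "trilinear \<sigma> N a b c k = trilinear \<sigma> N c b a k"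
  unfolding trilinear_def
  by (rule sum.reindex_bij_witness[of _ "\<lambda>(p, q, r). (r, q, p)" "\<lambda>(p, q, r). (r, q, p)"])
     (auto simp: triads_def coupling_sym mult_ac)

text \<open>
  As \<open>k - p = r - q\<close>, the difference is at most \<open>max q r\<close>, and the minimum is at most \<open>min q r\<close>.
\<close>

lemma min_mult_diff_le:
  assumes "p + r = q + (k::nat)"
  shows "\<bar>real k - real p\<bar> * real (min (min p q) (min r k)) \<le> real q * real r"
proof -
  have "\<bar>real k - real p\<bar> = \<bar>real r - real q\<bar>" using assms by linarith
  also have "\<dots> \<le> real (max q r)" by auto
  finally have "\<bar>real k - real p\<bar> * real (min (min p q) (min r k)) \<le> real (max q r) * real (min q r)"
    by (intro mult_mono) auto
  also have "\<dots> = real q * real r" by (auto simp: max_def min_def)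
  finally show ?thesis .
qed

text \<open>
  The output \<open>k\<close> is at most \<open>2 max p r\<close>, and the minimum is at most \<open>min p r\<close>: the derivative in front
  of the cubic term is shared by the two unconjugated factors.
\<close>

lemma output_mult_min_le:
  assumes "p + r = q + (k::nat)"
  shows "real k * real (min (min p q) (min r k)) \<le> 2 * (real p * real r)"
proof -
  have "real k * real (min (min p q) (min r k)) \<le> (2 * real (max p r)) * real (min p r)"
    using assms by (intro mult_mono) auto
  also have "\<dots> = 2 * (real p * real r)" by (auto simp: max_def min_def)
  finally show ?thesis .
qed

text \<open>
  The operator \<open>d \<mapsto> trilinear d a a\<close> has a Hermitian matrix, so \<open>k\<close> may be replaced by half the
  commutator factor \<open>k - p\<close>, and \<open>min_mult_diff_le\<close> moves both derivatives to \<open>a\<close>.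
\<close>

lemma hermitian_flux_bound:
  assumes \<sigma>: "0 \<le> \<sigma>" "\<sigma> \<le> 1"
  shows "\<bar>Im (\<Sum>k\<in>{1..N}. of_real (real k) * (trilinear \<sigma> N d a a k * cnj (d k)))\<bar>
    \<le> (wiener_norm N a)\<^sup>2 * (\<Sum>k\<in>{1..N}. (cmod (d k))\<^sup>2) / 2"
proof -
  define X where "X p q r k = of_real (coupling \<sigma> p q r k) * (d p * cnj (a q) * a r * cnj (d k))" for p q r k
  define S where "S = (\<Sum>(p, q, r, k)\<in>quart N. of_real (real k) * X p q r k)"
  have S': "(\<Sum>(p, q, r, k)\<in>quart N. of_real (real p) * X p q r k) = cnj S"
    unfolding S_def
    by (subst quart_swap_sides, subst quart_swap_in, subst quart_swap_out)
       (simp add: X_def coupling_sym case_prod_unfold mult_ac)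
  have "(\<Sum>(p, q, r, k)\<in>quart N. of_real (real k - real p) * X p q r k) = S - cnj S"
    unfolding S'[symmetric] unfolding S_def sum_subtractf[symmetric]
    by (intro sum.cong refl) (auto simp: algebra_simps)
  then have "2 * \<bar>Im S\<bar> = \<bar>Im (\<Sum>(p, q, r, k)\<in>quart N. of_real (real k - real p) * X p q r k)\<bar>"
    by simp
  also have "\<dots> \<le> norm (\<Sum>(p, q, r, k)\<in>quart N. of_real (real k - real p) * X p q r k)"
    by (rule abs_Im_le_cmod)
  also have "\<dots> \<le> (\<Sum>(p, q, r, k)\<in>quart N. cmod (d p) * (real q * cmod (a q)) * (real r * cmod (a r)) * cmod (d k))"
  proof (rule norm_sum_quart_le)
    fix p q r k assume Q: "(p, q, r, k) \<in> quart N"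
    then have pos: "1 \<le> p" "1 \<le> q" "1 \<le> r" "1 \<le> k" "p + r = q + k" by (auto simp: quart_def)
    define m where "m = cmod (d p) * cmod (a q) * cmod (a r) * cmod (d k)"
    have "norm (of_real (real k - real p) * X p q r k) = (\<bar>real k - real p\<bar> * coupling \<sigma> p q r k) * m"
      using coupling_bounds(1)[OF \<sigma> pos(1-4)]
      unfolding X_def norm_mult norm_of_real complex_mod_cnj by (simp add: abs_mult m_def)
    also have "\<dots> \<le> (\<bar>real k - real p\<bar> * real (min (min p q) (min r k))) * m"
      using coupling_bounds(2)[OF \<sigma> pos(1-4)] by (intro mult_right_mono mult_left_mono) (auto simp: m_def)
    also have "\<dots> \<le> (real q * real r) * m"
      by (intro mult_right_mono min_mult_diff_le pos) (auto simp: m_def)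
    finally show "norm (of_real (real k - real p) * X p q r k)
      \<le> cmod (d p) * (real q * cmod (a q)) * (real r * cmod (a r)) * cmod (d k)"
      by (simp add: m_def mult_ac)
  qed
  also have "\<dots> \<le> ((\<Sum>k\<in>{1..N}. (cmod (d k))\<^sup>2) + (\<Sum>k\<in>{1..N}. (cmod (d k))\<^sup>2)) / 2 *
      (wiener_norm N a * wiener_norm N a)"
    by (rule quart_sum_le_across) auto
  finally have "2 * \<bar>Im S\<bar> \<le> (wiener_norm N a)\<^sup>2 * (\<Sum>k\<in>{1..N}. (cmod (d k))\<^sup>2)"
    by (simp add: power2_eq_square mult_ac)
  moreover have "(\<Sum>k\<in>{1..N}. of_real (real k) * (trilinear \<sigma> N d a a k * cnj (d k))) = S"
    unfolding sum_trilinear_eq_sum_quart S_def X_def ..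
  ultimately show ?thesis by simp
qed

text \<open>
  When the difference sits in the conjugated slot, \<open>output_mult_min_le\<close> moves the derivative to the
  two other factors directly.  On the physical side this is the smoothing of the commutator between the
  projector onto positive frequencies and a multiplication operator.
\<close>

lemma antihermitian_flux_bound:
  assumes \<sigma>: "0 \<le> \<sigma>" "\<sigma> \<le> 1"
  shows "\<bar>Im (\<Sum>k\<in>{1..N}. of_real (real k) * (trilinear \<sigma> N b d a k * cnj (d k)))\<bar>
    \<le> 2 * wiener_norm N a * wiener_norm N b * (\<Sum>k\<in>{1..N}. (cmod (d k))\<^sup>2)"
proof -
  have "\<bar>Im (\<Sum>k\<in>{1..N}. of_real (real k) * (trilinear \<sigma> N b d a k * cnj (d k)))\<bar>
     \<le> norm (\<Sum>k\<in>{1..N}. of_real (real k) * (trilinear \<sigma> N b d a k * cnj (d k)))"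
    by (rule abs_Im_le_cmod)
  also have "\<dots> \<le> (\<Sum>(p, q, r, k)\<in>quart N. (2 * (real p * cmod (b p))) * cmod (d q) * (real r * cmod (a r)) * cmod (d k))"
    unfolding sum_trilinear_eq_sum_quart
  proof (rule norm_sum_quart_le)
    fix p q r k assume Q: "(p, q, r, k) \<in> quart N"
    then have pos: "1 \<le> p" "1 \<le> q" "1 \<le> r" "1 \<le> k" "p + r = q + k" by (auto simp: quart_def)
    define m where "m = cmod (b p) * cmod (d q) * cmod (a r) * cmod (d k)"
    have "norm (of_real (real k) * (of_real (coupling \<sigma> p q r k) * (b p * cnj (d q) * a r * cnj (d k))))
        = (real k * coupling \<sigma> p q r k) * m"
      using coupling_bounds(1)[OF \<sigma> pos(1-4)] unfolding norm_mult norm_of_real complex_mod_cnj by (simp add: abs_mult m_def)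
    also have "\<dots> \<le> (real k * real (min (min p q) (min r k))) * m"
      using coupling_bounds(2)[OF \<sigma> pos(1-4)] by (intro mult_right_mono mult_left_mono) (auto simp: m_def)
    also have "\<dots> \<le> (2 * (real p * real r)) * m"
      by (intro mult_right_mono output_mult_min_le pos) (auto simp: m_def)
    finally show "norm (of_real (real k) * (of_real (coupling \<sigma> p q r k) * (b p * cnj (d q) * a r * cnj (d k))))
      \<le> (2 * (real p * cmod (b p))) * cmod (d q) * (real r * cmod (a r)) * cmod (d k)"
      by (simp add: m_def mult_ac)
  qed
  also have "\<dots> \<le> ((\<Sum>k\<in>{1..N}. (cmod (d k))\<^sup>2) + (\<Sum>k\<in>{1..N}. (cmod (d k))\<^sup>2)) / 2 *
      ((\<Sum>k\<in>{1..N}. 2 * (real k * cmod (b k))) * wiener_norm N a)"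
    by (rule quart_sum_le_same_side) auto
  also have "\<dots> = 2 * wiener_norm N a * wiener_norm N b *
      (\<Sum>k\<in>{1..N}. (cmod (d k))\<^sup>2)"
    unfolding sum_distrib_left[symmetric] by simp
  finally show ?thesis .
qed

text \<open>
  The difference of the cubic terms is the sum of three trilinear terms with the difference in one
  slot each; the outer two are Hermitian and the middle one is antilinear in the difference.
\<close>

lemma difference_flux_bound:
  assumes \<sigma>: "0 \<le> \<sigma>" "\<sigma> \<le> 1"
    and A: "wiener_norm N a \<le> A" and B: "wiener_norm N b \<le> A"
  shows "\<bar>Im (\<Sum>k\<in>{1..N}. of_real (real k) * ((cubic \<sigma> N a k - cubic \<sigma> N b k) * cnj (a k - b k)))\<bar>
    \<le> 3 * A\<^sup>2 * (\<Sum>k\<in>{1..N}. (cmod (a k - b k))\<^sup>2)"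
proof -
  define d where "d k = a k - b k" for k
  define D where "D = (\<Sum>k\<in>{1..N}. (cmod (d k))\<^sup>2)"
  define A' where "A' = wiener_norm N a"
  define B' where "B' = wiener_norm N b"
  have nn: "0 \<le> D" "0 \<le> A'" "0 \<le> B'" "A' \<le> A" "B' \<le> A"
    using A B by (auto simp: D_def A'_def B'_def intro!: sum_nonneg)
  define T where "T u v w = (\<Sum>k\<in>{1..N}. of_real (real k) * (trilinear \<sigma> N u v w k * cnj (d k)))" for u v w
  have "(\<Sum>k\<in>{1..N}. of_real (real k) * ((cubic \<sigma> N a k - cubic \<sigma> N b k) * cnj (a k - b k)))
     = T d a a + T b d a + T d b b"
    unfolding T_def trilinear_diff d_def sum.distrib[symmetric]
    by (simp add: algebra_simps trilinear_swap[of \<sigma> N b b])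
  moreover have "\<bar>Im (T d a a)\<bar> \<le> A'\<^sup>2 * D / 2" "\<bar>Im (T d b b)\<bar> \<le> B'\<^sup>2 * D / 2"
    "\<bar>Im (T b d a)\<bar> \<le> 2 * A' * B' * D"
    using hermitian_flux_bound[OF \<sigma>, of N d a] hermitian_flux_bound[OF \<sigma>, of N d b]
      antihermitian_flux_bound[OF \<sigma>, of N b d a]
    by (auto simp: T_def A'_def B'_def D_def)
  moreover have "A'\<^sup>2 * D \<le> A\<^sup>2 * D" "B'\<^sup>2 * D \<le> A\<^sup>2 * D" "A' * B' * D \<le> A\<^sup>2 * D"
    using nn by (auto intro!: mult_right_mono power_mono mult_mono simp: power2_eq_square)
  ultimately show ?thesis by (simp add: D_def d_def)
qed

text \<open>
  The factor \<open>k\<close> is absorbed by \<open>output_mult_min_le\<close>, and a triad that is lost by the truncation has an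
  entry above \<open>n\<close>; there are three positions for it.
\<close>

lemma cubic_truncation_error:
  assumes \<sigma>: "0 \<le> \<sigma>" "\<sigma> \<le> 1" and "n \<le> N"
    and A: "wiener_norm N a \<le> A"
  shows "(\<Sum>k\<in>{1..K}. real k * cmod (cubic \<sigma> N a k - cubic \<sigma> n a k))
    \<le> 6 * A\<^sup>2 * (\<Sum>k\<in>{n<..N}. real k * cmod (a k))"
proof -
  define y where "y k = real k * cmod (a k)" for k
  have y: "0 \<le> y k" for k by (simp add: y_def)
  define I where "I = {1..N}"
  define J where "J = {n<..N}"
  have A': "sum y I \<le> A" "0 \<le> sum y I" "0 \<le> sum y J" using A y by (auto simp: y_def I_def J_def intro!: sum_nonneg)
  define G where "G = (\<lambda>(p, q, r). 2 * (y p * y q * y r))"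
  have "real k * cmod (cubic \<sigma> N a k - cubic \<sigma> n a k) \<le> (\<Sum>t\<in>triads N k - triads n k. G t)"
    if "1 \<le> k" for k
  proof -
    have sub: "triads n k \<subseteq> triads N k" using \<open>n \<le> N\<close> by (auto simp: triads_def)
    have "cubic \<sigma> N a k - cubic \<sigma> n a k = (\<Sum>(p, q, r)\<in>triads N k - triads n k.
        of_real (coupling \<sigma> p q r k) * (a p * cnj (a q) * a r))"
      unfolding trilinear_def by (subst sum_diff[OF finite_triads sub]) simp
    then have "real k * cmod (cubic \<sigma> N a k - cubic \<sigma> n a k) = norm (\<Sum>(p, q, r)\<in>triads N k - triads n k.
        of_real (real k * coupling \<sigma> p q r k) * (a p * cnj (a q) * a r))"
      by (simp add: case_prod_unfold sum_distrib_left[symmetric] mult.assoc norm_mult)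
    also have "\<dots> \<le> (\<Sum>t\<in>triads N k - triads n k. G t)"
    proof (rule sum_norm_le, clarify)
      fix p q r assume "(p, q, r) \<in> triads N k"
      then have pos: "1 \<le> p" "1 \<le> q" "1 \<le> r" "p + r = q + k" by (auto simp: triads_def)
      define m where "m = cmod (a p) * cmod (a q) * cmod (a r)"
      have "norm (of_real (real k * coupling \<sigma> p q r k) * (a p * cnj (a q) * a r)) = (real k * coupling \<sigma> p q r k) * m"
        using coupling_bounds(1)[OF \<sigma> pos(1-3) that] unfolding norm_mult norm_of_real complex_mod_cnj by (simp add: abs_mult m_def)
      also have "\<dots> \<le> (real k * real (min (min p q) (min r k))) * m"
        using coupling_bounds(2)[OF \<sigma> pos(1-3) that] by (intro mult_right_mono mult_left_mono) (auto simp: m_def)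
      also have "\<dots> \<le> (2 * (real p * real r)) * m"
        by (intro mult_right_mono output_mult_min_le pos) (auto simp: m_def)
      also have "\<dots> \<le> (2 * (real p * real r)) * (real q * m)"
        using pos mult_right_mono[of 1 "real q" m] by (intro mult_left_mono) (auto simp: m_def)
      finally show "norm (of_real (real k * coupling \<sigma> p q r k) * (a p * cnj (a q) * a r)) \<le> G (p, q, r)"
        by (simp add: m_def G_def y_def mult_ac)
    qed
    finally show ?thesis .
  qed
  then have "(\<Sum>k\<in>{1..K}. real k * cmod (cubic \<sigma> N a k - cubic \<sigma> n a k))
     \<le> (\<Sum>k\<in>{1..K}. \<Sum>t\<in>triads N k - triads n k. G t)" by (intro sum_mono) auto
  also have "\<dots> = sum G (\<Union>k\<in>{1..K}. triads N k - triads n k)"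
    by (rule sum.UNION_disjoint[symmetric], simp, simp) (auto simp: triads_def)
  also have "\<dots> \<le> sum G (J \<times> I \<times> I \<union> I \<times> J \<times> I \<union> I \<times> I \<times> J)"
    by (rule sum_mono2) (auto simp: triads_def I_def J_def G_def y)
  also have "\<dots> \<le> sum G (J \<times> I \<times> I) + sum G (I \<times> J \<times> I) + sum G (I \<times> I \<times> J)"
  proof -
    have fin: "finite I" "finite J" by (auto simp: I_def J_def)
    have un: "sum G (S \<union> S') \<le> sum G S + sum G S'" if "finite S" "finite S'" for S S'
      using that by (subst sum_Un) (auto intro!: sum_nonneg simp: G_def y)
    show ?thesis
      using un[of "J \<times> I \<times> I \<union> I \<times> J \<times> I" "I \<times> I \<times> J"] un[of "J \<times> I \<times> I" "I \<times> J \<times> I"] fin by simp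
  qed
  also have "\<dots> = 6 * (sum y I * sum y I) * sum y J"
  proof -
    have "sum G (S1 \<times> S2 \<times> S3) = 2 * (sum y S1 * sum y S2 * sum y S3)" for S1 S2 S3
      by (simp add: G_def sum.cartesian_product[symmetric] sum_distrib_left[symmetric]
        sum_distrib_right[symmetric])
    then show ?thesis by simp
  qed
  also have "\<dots> \<le> 6 * A\<^sup>2 * sum y J"
    unfolding power2_eq_square using A' by (intro mult_right_mono mult_left_mono mult_mono) auto
  finally show ?thesis by (simp add: y_def J_def)
qed

lemma cubic_lipschitz:
  assumes \<sigma>: "0 \<le> \<sigma>" "\<sigma> \<le> 1" and "1 \<le> k" and "k \<le> N"
    and a: "\<And>j. j \<in> {1..N} \<Longrightarrow> cmod (a j) \<le> R" and b: "\<And>j. j \<in> {1..N} \<Longrightarrow> cmod (b j) \<le> R"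
    and d: "\<And>j. j \<in> {1..N} \<Longrightarrow> cmod (a j - b j) \<le> \<delta>"
  shows "cmod (cubic \<sigma> N a k - cubic \<sigma> N b k) \<le> real (card (triads N k)) * real N * (3 * R\<^sup>2) * \<delta>"
proof -
  have "cubic \<sigma> N a k - cubic \<sigma> N b k = (\<Sum>(p, q, r)\<in>triads N k. of_real (coupling \<sigma> p q r k) *
      ((a p - b p) * cnj (a q) * a r + b p * cnj (a q - b q) * a r + b p * cnj (b q) * (a r - b r)))"
    unfolding trilinear_def sum_subtractf[symmetric]
    by (intro sum.cong refl) (auto simp: algebra_simps)
  also have "cmod \<dots> \<le> of_nat (card (triads N k)) * (real N * (\<delta> * R * R + R * \<delta> * R + R * R * \<delta>))"
  proof (rule sum_norm_bound, clarify)
    fix p q r assume "(p, q, r) \<in> triads N k"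
    then have pos: "p \<in> {1..N}" "q \<in> {1..N}" "r \<in> {1..N}" by (auto simp: triads_def)
    then have c: "0 \<le> coupling \<sigma> p q r k" "coupling \<sigma> p q r k \<le> real N"
      using coupling_bounds[OF \<sigma>, of p q r k] assms(3) by auto
    have R: "0 \<le> R" "0 \<le> \<delta>" using a[OF pos(1)] d[OF pos(1)] norm_ge_zero order_trans by blast+
    have "cmod ((a p - b p) * cnj (a q) * a r + b p * cnj (a q - b q) * a r + b p * cnj (b q) * (a r - b r))
      \<le> cmod ((a p - b p) * cnj (a q) * a r) + cmod (b p * cnj (a q - b q) * a r)
        + cmod (b p * cnj (b q) * (a r - b r))"
      by (intro norm_triangle_mono order_refl)
    also have "\<dots> \<le> \<delta> * R * R + R * \<delta> * R + R * R * \<delta>"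
      unfolding norm_mult complex_mod_cnj using pos R
      by (intro add_mono mult_mono a b d) (auto intro!: mult_nonneg_nonneg)
    finally show "cmod (of_real (coupling \<sigma> p q r k) *
      ((a p - b p) * cnj (a q) * a r + b p * cnj (a q - b q) * a r + b p * cnj (b q) * (a r - b r)))
      \<le> real N * (\<delta> * R * R + R * \<delta> * R + R * R * \<delta>)"
      unfolding norm_mult using c R by (intro mult_mono) auto
  qed
  also have "\<dots> = real (card (triads N k)) * real N * (3 * R\<^sup>2) * \<delta>"
    by (simp add: power2_eq_square algebra_simps)
  finally show ?thesis .
qed

section \<open>Ordinary differential equations\<close>

text \<open>
  The function \<open>exp (- c t) E t - \<epsilon> t\<close> is nonincreasing.
\<close>

lemma gronwall:
  fixes E :: "real \<Rightarrow> real"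
  assumes E: "\<And>t. t \<in> {0..T} \<Longrightarrow> (E has_real_derivative E' t) (at t within {0..T})"
    and le: "\<And>t. t \<in> {0..T} \<Longrightarrow> E' t \<le> c * E t + \<epsilon>"
    and "0 \<le> c" "0 \<le> \<epsilon>" and t: "t \<in> {0..T}"
  shows "E t \<le> (E 0 + \<epsilon> * t) * exp (c * t)"
proof -
  define h where "h \<tau> = exp (- c * \<tau>) * E \<tau> - \<epsilon> * \<tau>" for \<tau>
  have der: "(h has_real_derivative exp (- c * \<tau>) * (E' \<tau> - c * E \<tau>) - \<epsilon>) (at \<tau> within {0..T})"
    if "\<tau> \<in> {0..T}" for \<tau>
    unfolding h_def by (rule derivative_eq_intros E[OF that] refl | simp)+ (simp add: algebra_simps)
  have "h t \<le> h 0"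
  proof (rule DERIV_nonpos_imp_decreasing_open[of 0 t h])
    fix x assume x: "0 < x" "x < t"
    have *: "(h has_real_derivative exp (- c * x) * (E' x - c * E x) - \<epsilon>) (at x)"
      using der[of x] x t at_within_Icc_at[of 0 x T] by auto
    have "exp (- c * x) * (E' x - c * E x) \<le> exp (- c * x) * \<epsilon>"
      using le[of x] x t by (intro mult_left_mono) auto
    moreover have "exp (- c * x) * \<epsilon> \<le> 1 * \<epsilon>"
      using x assms(3,4) by (intro mult_right_mono) auto
    ultimately have "exp (- c * x) * (E' x - c * E x) - \<epsilon> \<le> 0" by linarith
    with * show "\<exists>y. (h has_real_derivative y) (at x) \<and> y \<le> 0" by blast
  next
    show "continuous_on {0..t} h"
      by (rule continuous_on_subset[OF DERIV_continuous_on[OF der]]) (use t in auto)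
  qed (use t in auto)
  then have "exp (- c * t) * E t \<le> E 0 + \<epsilon> * t" by (simp add: h_def)
  then have "exp (c * t) * (exp (- c * t) * E t) \<le> exp (c * t) * (E 0 + \<epsilon> * t)"
    by (intro mult_left_mono) auto
  moreover have "exp (c * t) * (exp (- c * t) * E t) = E t" by (simp add: exp_minus)
  ultimately have "E t \<le> exp (c * t) * (E 0 + \<epsilon> * t)" by linarith
  then show ?thesis by (simp only: mult.commute)
qed

text \<open>
  The function \<open>- 1 / (E t + 1) - C t\<close> is nonincreasing; adding \<open>1\<close> avoids a case distinction for
  vanishing energy.  The condition on \<open>T\<close> keeps \<open>1 / (E t + 1)\<close> above half its initial value.
\<close>

lemma riccati:
  fixes E :: "real \<Rightarrow> real"
  assumes E: "\<And>t. t \<in> {0..T} \<Longrightarrow> (E has_real_derivative E' t) (at t within {0..T})"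
    and le: "\<And>t. t \<in> {0..T} \<Longrightarrow> E' t \<le> C * (E t)\<^sup>2"
    and nn: "\<And>t. t \<in> {0..T} \<Longrightarrow> 0 \<le> E t" and "0 \<le> C"
    and T: "2 * C * T * (E 0 + 1) \<le> 1" and t: "t \<in> {0..T}"
  shows "E t \<le> 2 * (E 0 + 1)"
proof -
  define h where "h \<tau> = - inverse (E \<tau> + 1) - C * \<tau>" for \<tau>
  have der: "(h has_real_derivative E' \<tau> / (E \<tau> + 1)\<^sup>2 - C) (at \<tau> within {0..T})"
    if "\<tau> \<in> {0..T}" for \<tau>
    unfolding h_def using nn[OF that]
    by - (rule derivative_eq_intros E[OF that] refl | simp add: power2_eq_square field_simps)+
  have "h t \<le> h 0"
  proof (rule DERIV_nonpos_imp_decreasing_open[of 0 t h])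
    fix x assume x: "0 < x" "x < t"
    then have xT: "x \<in> {0..T}" using t by auto
    have "(h has_real_derivative E' x / (E x + 1)\<^sup>2 - C) (at x)"
      using der[of x] x t at_within_Icc_at[of 0 x T] by auto
    moreover have "E' x \<le> C * (E x + 1)\<^sup>2"
      using le[OF xT] nn[OF xT] mult_left_mono[OF power_mono[of "E x" "E x + 1" 2] \<open>0 \<le> C\<close>] by auto
    then have "E' x / (E x + 1)\<^sup>2 \<le> C" using nn[OF xT] by (simp add: pos_divide_le_eq)
    ultimately show "\<exists>y. (h has_real_derivative y) (at x) \<and> y \<le> 0" by (intro exI conjI) auto
  next
    show "continuous_on {0..t} h"
      by (rule continuous_on_subset[OF DERIV_continuous_on[OF der]]) (use t in auto)
  qed (use t in auto)
  then have 1: "inverse (E 0 + 1) - C * t \<le> inverse (E t + 1)" by (simp add: h_def)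
  have E0: "0 \<le> E 0" "0 \<le> E t" using nn t by auto
  have "2 * C * t * (E 0 + 1) \<le> 2 * C * T * (E 0 + 1)"
    using t E0 assms(4) by (intro mult_right_mono mult_left_mono) auto
  then have "C * t \<le> inverse (E 0 + 1) / 2" using T E0 by (simp add: field_simps)
  moreover have "inverse (2 * (E 0 + 1)) = inverse (E 0 + 1) / 2"
    by (simp only: inverse_mult_distrib) simp
  ultimately have "inverse (2 * (E 0 + 1)) \<le> inverse (E t + 1)" using 1 by linarith
  then have "E t + 1 \<le> 2 * (E 0 + 1)" using E0 by (subst (asm) inverse_le_iff_le) auto
  then show ?thesis by simp
qed

text \<open>
  Bielecki's argument: in the norm \<open>sup exp (- L t) |x t|\<close> with \<open>L = 2 K + 1\<close> the Picard map contracts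
  by \<open>K / L \<le> 1 / 2\<close> on the whole interval, so no continuation is required.  The unknown \<open>y\<close> below is
  \<open>exp (- L t) x t\<close>, extended constantly outside the interval.
\<close>

lemma picard_lindelof_global:
  fixes G :: "'a::banach \<Rightarrow> 'a"
  assumes lip: "\<And>x y. norm (G x - G y) \<le> K * norm (x - y)" and K: "0 \<le> K" and T: "0 \<le> T"
  shows "\<exists>x. x 0 = x0 \<and> (\<forall>t\<in>{0..T}. (x has_vector_derivative G (x t)) (at t within {0..T}))"
proof -
  define L where "L = 2 * K + 1"
  have L: "0 < L" "K / L \<le> 1 / 2" using K by (auto simp: L_def field_simps)
  have contG: "continuous_on UNIV G"
    by (rule lipschitz_on_continuous_on[of K]) (auto intro!: lipschitz_onI lip K simp: dist_norm)
  define \<phi> where "\<phi> y t = exp (- L * t) *\<^sub>R (x0 + integral {0..t} (\<lambda>\<tau>. G (exp (L * \<tau>) *\<^sub>R apply_bcontfun y \<tau>)))"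
    for y :: "real \<Rightarrow>\<^sub>C 'a" and t
  have contI: "continuous_on S (\<lambda>\<tau>. G (exp (L * \<tau>) *\<^sub>R apply_bcontfun y \<tau>))" for y :: "real \<Rightarrow>\<^sub>C 'a" and S
    by (intro continuous_on_compose2[OF contG] continuous_intros) auto
  have cont: "continuous_on (cbox 0 T) (\<phi> y)" for y
    unfolding \<phi>_def
    by (intro continuous_intros indefinite_integral_continuous_1 integrable_continuous_real contI)
       (simp add: cbox_interval indefinite_integral_continuous_1 integrable_continuous_real contI)
  have "\<exists>g. (\<forall>x\<in>cbox 0 T. apply_bcontfun g x = \<phi> y x) \<and> (\<forall>x. apply_bcontfun g x = \<phi> y (clamp 0 T x))" for y
    using continuous_on_cbox_bcontfunE[OF cont[of y]] by (metis)
  then obtain \<Phi> where \<Phi>: "\<And>y x. x \<in> cbox 0 T \<Longrightarrow> apply_bcontfun (\<Phi> y) x = \<phi> y x"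
      "\<And>y x. apply_bcontfun (\<Phi> y) x = \<phi> y (clamp 0 T x)" by metis
  have contr: "norm (\<phi> y t - \<phi> z t) \<le> 1 / 2 * dist y z" if t: "t \<in> {0..T}" for y z t
  proof -
    have eint: "((\<lambda>\<tau>. exp (L * \<tau>)) has_integral (exp (L * t) / L - exp (L * 0) / L)) {0..t}"
      using t L by (intro fundamental_theorem_of_calculus)
        (auto intro!: derivative_eq_intros simp: has_real_derivative_iff_has_vector_derivative[symmetric])
    have "norm (\<phi> y t - \<phi> z t) = exp (- L * t) * norm (integral {0..t} (\<lambda>\<tau>. G (exp (L * \<tau>) *\<^sub>R apply_bcontfun y \<tau>))
        - integral {0..t} (\<lambda>\<tau>. G (exp (L * \<tau>) *\<^sub>R apply_bcontfun z \<tau>)))"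
      by (simp add: \<phi>_def scaleR_diff_right[symmetric])
    also have "\<dots> = exp (- L * t) * norm (integral {0..t} (\<lambda>\<tau>. G (exp (L * \<tau>) *\<^sub>R apply_bcontfun y \<tau>)
        - G (exp (L * \<tau>) *\<^sub>R apply_bcontfun z \<tau>)))"
      by (subst integral_diff) (auto intro!: integrable_continuous_real contI)
    also have "\<dots> \<le> exp (- L * t) * integral {0..t} (\<lambda>\<tau>. K * dist y z * exp (L * \<tau>))"
    proof (intro mult_left_mono integral_norm_bound_integral)
      fix \<tau> assume "\<tau> \<in> {0..t}"
      have "norm (G (exp (L * \<tau>) *\<^sub>R apply_bcontfun y \<tau>) - G (exp (L * \<tau>) *\<^sub>R apply_bcontfun z \<tau>))
          \<le> K * norm (exp (L * \<tau>) *\<^sub>R apply_bcontfun y \<tau> - exp (L * \<tau>) *\<^sub>R apply_bcontfun z \<tau>)" by (rule lip)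
      also have "\<dots> = K * (exp (L * \<tau>) * dist (apply_bcontfun y \<tau>) (apply_bcontfun z \<tau>))"
        by (simp add: scaleR_diff_right[symmetric] dist_norm)
      also have "\<dots> \<le> K * (exp (L * \<tau>) * dist y z)"
        using K by (intro mult_left_mono dist_bounded) auto
      finally show "norm (G (exp (L * \<tau>) *\<^sub>R apply_bcontfun y \<tau>) - G (exp (L * \<tau>) *\<^sub>R apply_bcontfun z \<tau>))
          \<le> K * dist y z * exp (L * \<tau>)" by (simp add: mult_ac)
    qed (auto intro!: integrable_continuous_real continuous_intros contI)
    also have "integral {0..t} (\<lambda>\<tau>. K * dist y z * exp (L * \<tau>)) = K * dist y z * (exp (L * t) / L - exp (L * 0) / L)"
      by (rule integral_unique[OF has_integral_mult_right[OF eint]])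
    also have "exp (- L * t) * (K * dist y z * (exp (L * t) / L - exp (L * 0) / L))
        = (1 - exp (- L * t)) * (K / L * dist y z)"
      using L by (simp add: field_simps exp_minus)
    also have "\<dots> \<le> 1 * (1 / 2 * dist y z)"
      using L K t by (intro mult_mono mult_right_mono) auto
    finally show ?thesis by simp
  qed
  have "\<exists>!y. \<Phi> y = y"
  proof (rule banach_fix_type[of "1/2"])
    show "\<forall>x y. dist (\<Phi> x) (\<Phi> y) \<le> 1 / 2 * dist x y"
    proof (intro allI dist_bound)
      fix x y :: "real \<Rightarrow>\<^sub>C 'a" and s
      have "clamp 0 T s \<in> {0..T}" using clamp_in_interval[of 0 T s] T by (auto simp: cbox_interval)
      then show "dist (apply_bcontfun (\<Phi> x) s) (apply_bcontfun (\<Phi> y) s) \<le> 1 / 2 * dist x y"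
        using contr[of "clamp 0 T s" x y] by (simp add: \<Phi>(2) dist_norm)
    qed
  qed auto
  then obtain y where y: "\<Phi> y = y" by auto
  define x where "x t = x0 + integral {0..t} (\<lambda>\<tau>. G (exp (L * \<tau>) *\<^sub>R apply_bcontfun y \<tau>))" for t
  have yx: "exp (L * t) *\<^sub>R apply_bcontfun y t = x t" if "t \<in> {0..T}" for t
  proof -
    have "apply_bcontfun y t = exp (- L * t) *\<^sub>R x t"
      using \<Phi>(1)[of t y] that unfolding y by (simp add: \<phi>_def x_def cbox_interval)
    then show ?thesis by (simp add: exp_minus)
  qed
  have "(x has_vector_derivative G (x t)) (at t within {0..T})" if "t \<in> {0..T}" for t
    unfolding x_def[abs_def]
    using integral_has_vector_derivative[OF contI that] yx[OF that]
    by (auto intro!: derivative_eq_intros simp: x_def)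
  moreover have "x 0 = x0" by (simp add: x_def)
  ultimately show ?thesis by blast
qed

text \<open>
  The retraction onto the ball of radius \<open>R\<close>.  It rescales by a positive number, hence does not
  disturb the conservation law of a homogeneous vector field.
\<close>

definition radial :: "real \<Rightarrow> 'a::real_normed_vector \<Rightarrow> 'a" where
  "radial R x = (R / max R (norm x)) *\<^sub>R x"

lemma norm_radial_le:
  assumes "0 < R"
  shows "norm (radial R x) \<le> R"
  using assms by (auto simp: radial_def max_def field_simps)

text \<open>
  Split the difference into a change of the vector at fixed factor and a change of the factor; the
  latter is controlled by the reverse triangle inequality.
\<close>

lemma radial_lipschitz:
  assumes R: "0 < R"
  shows "norm (radial R x - radial R y) \<le> 2 * norm (x - y)"
proof -
  define m where "m z = max R (norm z)" for z :: 'a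
  have m: "0 < m z" "R \<le> m z" "norm z \<le> m z" for z using R by (auto simp: m_def)
  have "radial R x - radial R y = (R / m x) *\<^sub>R (x - y) + (R / m x - R / m y) *\<^sub>R y"
    by (simp add: radial_def m_def algebra_simps)
  also have "norm \<dots> \<le> \<bar>R / m x\<bar> * norm (x - y) + \<bar>R / m x - R / m y\<bar> * norm y"
    by (rule norm_triangle_le) simp
  also have "\<bar>R / m x - R / m y\<bar> * norm y = (R / m x) * (\<bar>m y - m x\<bar> * (norm y / m y))"
  proof -
    have "R / m x - R / m y = (R / m x) * ((m y - m x) / m y)" using m(1)[of x] m(1)[of y] by (simp add: field_simps)
    then have "\<bar>R / m x - R / m y\<bar> = (R / m x) * (\<bar>m y - m x\<bar> / m y)"
      using m(1)[of x] m(1)[of y] R by (simp add: abs_mult)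
    then show ?thesis by simp
  qed
  also have "\<dots> \<le> 1 * (norm (x - y) * 1)"
  proof (intro mult_mono)
    show "\<bar>m y - m x\<bar> \<le> norm (x - y)"
      using norm_triangle_ineq3[of x y] by (auto simp: m_def max_def)
    show "0 \<le> norm y / m y" "norm y / m y \<le> 1"
      using m(1)[of y] m(3)[of y] by simp_all
    then show "0 \<le> \<bar>m y - m x\<bar> * (norm y / m y)" by (intro mult_nonneg_nonneg) auto
  qed (use m R in auto)
  also have "\<bar>R / m x\<bar> * norm (x - y) \<le> 1 * norm (x - y)"
    using m(1)[of x] m(2)[of x] R by (intro mult_right_mono) auto
  finally show ?thesis by simp
qed

lemma cmod_power2_has_derivative:
  assumes "(f has_vector_derivative f') (at t within S)"
  shows "((\<lambda>t. (cmod (f t))\<^sup>2) has_real_derivative 2 * Re (cnj (f t) * f')) (at t within S)"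
proof -
  have re: "((\<lambda>t. Re (f t)) has_real_derivative Re f') (at t within S)"
    using bounded_linear.has_vector_derivative[OF bounded_linear_Re assms]
    by (simp add: has_real_derivative_iff_has_vector_derivative)
  have im: "((\<lambda>t. Im (f t)) has_real_derivative Im f') (at t within S)"
    using bounded_linear.has_vector_derivative[OF bounded_linear_Im assms]
    by (simp add: has_real_derivative_iff_has_vector_derivative)
  show ?thesis unfolding cmod_power2
    by (rule derivative_eq_intros re im refl | simp)+
qed

text \<open>
  The term \<open>e\<close> accounts for a perturbation of the equation.
\<close>

lemma energy_has_derivative:
  assumes "\<And>k. k \<in> K \<Longrightarrow> ((\<lambda>t. a t k) has_vector_derivative \<i> * of_real (real k) * c k + e k) (at t within S)"
  shows "((\<lambda>t. \<Sum>k\<in>K. W k * (cmod (a t k))\<^sup>2) has_real_derivative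
      - 2 * Im (\<Sum>k\<in>K. of_real (real k * W k) * (c k * cnj (a t k)))
      + 2 * (\<Sum>k\<in>K. W k * Re (cnj (a t k) * e k))) (at t within S)"
proof -
  have "((\<lambda>t. \<Sum>k\<in>K. W k * (cmod (a t k))\<^sup>2) has_real_derivative
     (\<Sum>k\<in>K. W k * (2 * Re (cnj (a t k) * (\<i> * of_real (real k) * c k + e k))))) (at t within S)"
    by (intro DERIV_sum DERIV_cmult cmod_power2_has_derivative assms)
  also have "(\<Sum>k\<in>K. W k * (2 * Re (cnj (a t k) * (\<i> * of_real (real k) * c k + e k))))
    = (\<Sum>k\<in>K. - 2 * Im (of_real (real k * W k) * (c k * cnj (a t k))) + 2 * (W k * Re (cnj (a t k) * e k)))"
    by (intro sum.cong refl) (simp add: algebra_simps)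
  also have "\<dots> = - 2 * Im (\<Sum>k\<in>K. of_real (real k * W k) * (c k * cnj (a t k)))
      + 2 * (\<Sum>k\<in>K. W k * Re (cnj (a t k) * e k))"
    unfolding Im_sum sum_distrib_left sum.distrib ..
  finally show ?thesis .
qed

section \<open>Galerkin approximations\<close>

lemma trilinear_cong:
  assumes "\<And>k. k \<in> {1..N} \<Longrightarrow> a k = a' k" "\<And>k. k \<in> {1..N} \<Longrightarrow> b k = b' k" "\<And>k. k \<in> {1..N} \<Longrightarrow> c k = c' k"
  shows "trilinear \<sigma> N a b c k = trilinear \<sigma> N a' b' c' k"
  unfolding trilinear_def by (intro sum.cong refl) (auto simp: triads_def assms)

text \<open>
  Sequences supported in \<open>{1..N}\<close> live in the space of bounded functions on the natural numbers with
  the supremum norm, in which the Picard iteration takes place.  The metric on the index set turns this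
  space into an instance of the class of Banach spaces.
\<close>

instantiation nat :: metric_space
begin

definition dist_nat :: "nat \<Rightarrow> nat \<Rightarrow> real" where
  "dist_nat m n = \<bar>real m - real n\<bar>"

definition uniformity_nat :: "(nat \<times> nat) filter" where
  "uniformity_nat = (INF e\<in>{0 <..}. principal {(x, y). dist x y < e})"

instance
proof
  fix U :: "nat set"
  have dist1: "x = y" if "\<bar>real x - real y\<bar> < 1" for x y :: nat using that by linarith
  have "\<forall>\<^sub>F (x', y) in uniformity. x' = x \<longrightarrow> y \<in> U" if "x \<in> U" for x
    unfolding uniformity_nat_def
    by (rule eventually_INF1[of 1]) (use that dist1 in \<open>auto simp: eventually_principal dist_nat_def\<close>)
  then show "open U \<longleftrightarrow> (\<forall>x\<in>U. \<forall>\<^sub>F (x', y) in uniformity. x' = x \<longrightarrow> y \<in> U)"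
    by (simp add: open_discrete)
qed (auto simp: dist_nat_def uniformity_nat_def)

end

instance bcontfun :: (metric_space, banach) banach ..

definition truncate :: "nat \<Rightarrow> (nat \<Rightarrow> complex) \<Rightarrow> (nat \<Rightarrow>\<^sub>C complex)" where
  "truncate N f = Bcontfun (\<lambda>k. if k \<in> {1..N} then f k else 0)"

lemma apply_truncate: "apply_bcontfun (truncate N f) k = (if k \<in> {1..N} then f k else 0)"
proof -
  have "range (\<lambda>k. if k \<in> {1..N} then f k else 0) \<subseteq> insert 0 (f ` {1..N})" by auto
  then have "bounded (range (\<lambda>k. if k \<in> {1..N} then f k else 0))"
    by (meson bounded_subset finite_imp_bounded finite_imageI finite_insert finite_atLeastAtMost)
  then have "(\<lambda>k. if k \<in> {1..N} then f k else 0) \<in> bcontfun" by (simp add: bcontfun_def)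
  then show ?thesis by (simp add: truncate_def Bcontfun_inverse)
qed

lemma bounded_linear_apply_bcontfun:
  "bounded_linear (\<lambda>x :: 'a::topological_space \<Rightarrow>\<^sub>C 'b::real_normed_vector. apply_bcontfun x k)"
  by (rule bounded_linear_intro[of _ 1]) (auto simp: norm_bounded)

text \<open>
  Composing with the radial retraction makes the vector field globally Lipschitz.  The modified flow
  still conserves \<open>\<Sum> |a\<^sub>k|\<^sup>2\<close>, so it never leaves the ball on which nothing was modified.
\<close>

lemma galerkin_solution:
  assumes \<sigma>: "0 \<le> \<sigma>" "\<sigma> \<le> 1" and T: "0 \<le> T"
  shows "\<exists>a. (\<forall>k. a 0 k = (if k \<in> {1..N} then a0 k else 0)) \<and>
     (\<forall>t\<in>{0..T}. \<forall>k\<in>{1..N}. ((\<lambda>t. a t k) has_vector_derivative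
        \<i> * of_real (real k) * cubic \<sigma> N (a t) k) (at t within {0..T}))"
proof -
  define R where "R = sqrt (\<Sum>k\<in>{1..N}. (cmod (a0 k))\<^sup>2) + 1"
  have R: "0 < R" by (auto simp: R_def intro!: add_nonneg_pos sum_nonneg)
  define G :: "(nat \<Rightarrow>\<^sub>C complex) \<Rightarrow> (nat \<Rightarrow>\<^sub>C complex)" where
    "G x = truncate N (\<lambda>k. \<i> * of_real (real k) * cubic \<sigma> N (apply_bcontfun (radial R x)) k)" for x
  define Lk where "Lk k = real k * (real (card (triads N k)) * real N * (3 * R\<^sup>2) * 2)" for k
  have Lk: "0 \<le> Lk k" for k by (simp add: Lk_def)
  have lip: "norm (G x - G y) \<le> (\<Sum>k\<in>{1..N}. Lk k) * norm (x - y)" for x y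
  proof (rule norm_bound)
    fix k
    show "norm (apply_bcontfun (G x - G y) k) \<le> (\<Sum>k\<in>{1..N}. Lk k) * norm (x - y)"
    proof (cases "k \<in> {1..N}")
      case True
      have "norm (apply_bcontfun (G x - G y) k) = real k *
         cmod (cubic \<sigma> N (apply_bcontfun (radial R x)) k - cubic \<sigma> N (apply_bcontfun (radial R y)) k)"
        using True by (simp add: G_def apply_truncate right_diff_distrib[symmetric] norm_mult)
      also have "\<dots> \<le> real k * (real (card (triads N k)) * real N * (3 * R\<^sup>2) * (2 * norm (x - y)))"
      proof (intro mult_left_mono cubic_lipschitz \<sigma>)
        fix j
        show "cmod (apply_bcontfun (radial R x) j) \<le> R" "cmod (apply_bcontfun (radial R y) j) \<le> R"
          using norm_bounded norm_radial_le[OF R] order_trans by blast+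
        have "cmod (apply_bcontfun (radial R x) j - apply_bcontfun (radial R y) j) \<le> norm (radial R x - radial R y)"
          using norm_bounded[of "radial R x - radial R y" j] by simp
        then show "cmod (apply_bcontfun (radial R x) j - apply_bcontfun (radial R y) j) \<le> 2 * norm (x - y)"
          using radial_lipschitz[OF R, of x y] by linarith
      qed (use True in auto)
      also have "\<dots> = Lk k * norm (x - y)" by (simp add: Lk_def)
      also have "\<dots> \<le> (\<Sum>k\<in>{1..N}. Lk k) * norm (x - y)"
        using True by (intro mult_right_mono member_le_sum) (auto simp: Lk)
      finally show ?thesis .
    next
      case False
      then have "apply_bcontfun (G x - G y) k = 0" by (auto simp: G_def apply_truncate)
      moreover have "0 \<le> (\<Sum>k\<in>{1..N}. Lk k)" by (intro sum_nonneg Lk)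
      ultimately show ?thesis by simp
    qed
  qed
  have "\<exists>x. x 0 = truncate N a0 \<and> (\<forall>t\<in>{0..T}. (x has_vector_derivative G (x t)) (at t within {0..T}))"
    by (rule picard_lindelof_global[where G = G and K = "\<Sum>k\<in>{1..N}. Lk k"]) (rule lip, intro sum_nonneg Lk, rule T)
  then obtain x where x0: "x 0 = truncate N a0"
    and x: "\<And>t. t \<in> {0..T} \<Longrightarrow> (x has_vector_derivative G (x t)) (at t within {0..T})"
    by blast
  define a where "a t k = apply_bcontfun (x t) k" for t k
  have a0: "a 0 k = (if k \<in> {1..N} then a0 k else 0)" for k by (simp add: a_def x0 apply_truncate)
  have da: "((\<lambda>t. a t k) has_vector_derivative apply_bcontfun (G (x t)) k) (at t within {0..T})"
    if "t \<in> {0..T}" for t k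
    unfolding a_def by (rule bounded_linear.has_vector_derivative[OF bounded_linear_apply_bcontfun x[OF that]])
  have out: "a t k = 0" if "t \<in> {0..T}" "k \<notin> {1..N}" for t k
  proof -
    have "((\<lambda>t. a t k) has_vector_derivative 0) (at \<tau> within {0..T})" if "\<tau> \<in> {0..T}" for \<tau>
      using da[OF that, of k] \<open>k \<notin> {1..N}\<close> unfolding G_def apply_truncate by (simp only: if_False)
    then obtain c where "\<And>\<tau>. \<tau> \<in> {0..T} \<Longrightarrow> a \<tau> k = c"
      using has_vector_derivative_zero_constant[of "{0..T}" "\<lambda>t. a t k"] by auto
    then have "a t k = a 0 k" using that T by auto
    then show ?thesis using \<open>k \<notin> {1..N}\<close> unfolding a0 by (simp only: if_False)
  qed
  define E where "E t = (\<Sum>k\<in>{1..N}. 1 * (cmod (a t k))\<^sup>2)" for t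
  have "(E has_real_derivative 0) (at t within {0..T})" if t: "t \<in> {0..T}" for t
  proof -
    \<comment> \<open>The retracted sequence is \<open>\<mu>\<close> times the solution, so the flux identity for the former
      applies up to a positive factor.\<close>
    define \<mu> where "\<mu> = R / max R (norm (x t))"
    have \<mu>: "0 < \<mu>" using R by (simp add: \<mu>_def)
    define b where "b k = apply_bcontfun (radial R (x t)) k" for k
    have ba: "b k = of_real \<mu> * a t k" for k
      by (simp add: b_def radial_def \<mu>_def a_def scaleR_conv_of_real)
    define z where "z = (\<Sum>k\<in>{1..N}. of_real (real k * 1) * (cubic \<sigma> N b k * cnj (a t k)))"
    have dE: "(E has_real_derivative - 2 * Im z + 2 * (\<Sum>k\<in>{1..N}. 1 * Re (cnj (a t k) * 0))) (at t within {0..T})"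
      unfolding E_def z_def
    proof (rule energy_has_derivative)
      fix k assume "k \<in> {1..N}"
      then show "((\<lambda>t. a t k) has_vector_derivative \<i> * of_real (real k) * cubic \<sigma> N b k + 0) (at t within {0..T})"
        using da[OF t, of k] by (simp add: G_def apply_truncate b_def[abs_def])
    qed
    have "of_real \<mu> * z = (\<Sum>k\<in>{1..N}. of_real (real k) * (cubic \<sigma> N b k * cnj (b k)))"
      unfolding z_def sum_distrib_left ba by (intro sum.cong refl) simp
    moreover have "\<mu> * Im z = Im (of_real \<mu> * z)" by simp
    ultimately have "\<mu> * Im z = 0" using energy_flux_L2[where a = b and \<sigma> = \<sigma> and N = N] by (simp only:)
    then show ?thesis using dE \<mu> by simp
  qed
  then obtain c where c: "\<And>\<tau>. \<tau> \<in> {0..T} \<Longrightarrow> E \<tau> = c"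
    using has_vector_derivative_zero_constant[of "{0..T}" E] by (auto simp: has_real_derivative_iff_has_vector_derivative)
  have inR: "norm (x t) \<le> R" if t: "t \<in> {0..T}" for t
  proof (rule norm_bound)
    fix k
    show "norm (apply_bcontfun (x t) k) \<le> R"
    proof (cases "k \<in> {1..N}")
      case True
      have "(cmod (a t k))\<^sup>2 \<le> (\<Sum>k\<in>{1..N}. (cmod (a t k))\<^sup>2)" using True by (intro member_le_sum) auto
      also have "\<dots> = E 0" using c[OF t] c[of 0] T by (simp add: E_def)
      also have "\<dots> = (\<Sum>k\<in>{1..N}. (cmod (a0 k))\<^sup>2)" by (simp add: E_def a0)
      finally have "cmod (a t k) \<le> sqrt (\<Sum>k\<in>{1..N}. (cmod (a0 k))\<^sup>2)" by (rule real_le_rsqrt)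
      then show ?thesis by (simp add: a_def R_def)
    next
      case False
      then show ?thesis using out[OF t False] R by (simp add: a_def)
    qed
  qed
  have "((\<lambda>t. a t k) has_vector_derivative \<i> * of_real (real k) * cubic \<sigma> N (a t) k) (at t within {0..T})"
    if t: "t \<in> {0..T}" and k: "k \<in> {1..N}" for t k
  proof -
    have "radial R (x t) = x t" using inR[OF t] R by (simp add: radial_def max_def)
    then show ?thesis using da[OF t, of k] k by (simp add: G_def apply_truncate a_def[abs_def])
  qed
  with a0 show ?thesis by blast
qed

section \<open>Sobolev weights and the Wiener norm\<close>

definition sobolev_weight :: "real \<Rightarrow> nat \<Rightarrow> real" where
  "sobolev_weight s k = (1 + (real k)\<^sup>2) powr s"

lemma sobolev_weight_ge_1: "0 \<le> s \<Longrightarrow> 1 \<le> sobolev_weight s k"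
  unfolding sobolev_weight_def by (rule ge_one_powr_ge_zero) auto

lemma sobolev_weight_pos: "0 < sobolev_weight s k"
proof -
  have "0 < 1 + (real k)\<^sup>2" by (intro add_pos_nonneg) auto
  then show ?thesis by (simp add: sobolev_weight_def)
qed

text \<open>
  For \<open>k \<le> l \<le> 2 k\<close> the growth condition bounds \<open>l W\<^sub>l / (k W\<^sub>k)\<close> by \<open>x\<^sup>q\<^sup>+\<^sup>1\<close> with \<open>x = l / k \<le> 2\<close>, and
  \<open>x\<^sup>m - 1 \<le> (2\<^sup>m - 1) (x - 1)\<close> by convexity.
\<close>

lemma doubling_weight_power:
  assumes nn: "\<And>k. 0 \<le> W k" and mono: "\<And>k l. 1 \<le> k \<Longrightarrow> k \<le> l \<Longrightarrow> W k \<le> W l"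
    and growth: "\<And>k l. 1 \<le> k \<Longrightarrow> k \<le> l \<Longrightarrow> W l \<le> (real l / real k) ^ q * W k"
  shows "doubling_weight (2 ^ Suc q) W"
  unfolding doubling_weight_def
proof (intro conjI allI impI nn mono)
  have bernoulli: "x ^ m - 1 \<le> (2 ^ m - 1) * (x - 1)" if x: "1 \<le> x" "x \<le> 2" for x :: real and m
  proof (induction m)
    case (Suc m)
    have "x ^ Suc m - 1 = x * (x ^ m - 1) + (x - 1)" by (simp add: algebra_simps)
    also have "\<dots> \<le> 2 * (x ^ m - 1) + (x - 1)"
      using x by (intro add_mono mult_right_mono) auto
    also have "\<dots> \<le> 2 * ((2 ^ m - 1) * (x - 1)) + (x - 1)" using Suc by simp
    finally show ?case by (simp add: algebra_simps)
  qed simp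
  fix k l :: nat assume kl: "1 \<le> k" "k \<le> l" "l \<le> 2 * k"
  have k: "0 < real k" using kl by simp
  define x where "x = real l / real k"
  have x: "1 \<le> x" "x \<le> 2" "real l = x * real k" using kl k by (auto simp: x_def field_simps)
  have "real l * W l - real k * W k \<le> x * real k * (x ^ q * W k) - real k * W k"
    using growth[of k l] kl x k unfolding x(3) by (auto simp: x_def intro!: mult_left_mono)
  also have "\<dots> = real k * W k * (x ^ Suc q - 1)" by (simp add: algebra_simps)
  also have "\<dots> \<le> real k * W k * ((2 ^ Suc q - 1) * (x - 1))"
    using nn by (intro mult_left_mono bernoulli x) auto
  also have "\<dots> \<le> real k * W k * (2 ^ Suc q * (x - 1))"
    using nn x by (intro mult_left_mono mult_right_mono) auto
  also have "\<dots> = 2 ^ Suc q * (real l - real k) * W k" unfolding x(3) by (simp add: algebra_simps)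
  finally show "real l * W l - real k * W k \<le> 2 ^ Suc q * (real l - real k) * W k" .
qed simp

text \<open>
  The constant is independent of \<open>n\<close>.  For \<open>n = 1\<close> the weight is the Sobolev weight on positive frequencies; for large \<open>n\<close> it
  agrees with it from \<open>n\<close> onwards and is small on fixed frequencies.
\<close>

lemma doubling_weight_sobolev:
  assumes s: "0 \<le> s" and n: "1 \<le> n"
  shows "doubling_weight (2 ^ Suc (Suc (nat \<lceil>2 * s\<rceil>))) (\<lambda>k. sobolev_weight s k * min 1 (real k / real n))"
proof (rule doubling_weight_power)
  fix k l :: nat assume kl: "1 \<le> k" "k \<le> l"
  have k: "0 < real k" using kl by simp
  have "1 + (real l)\<^sup>2 \<le> (real l / real k)\<^sup>2 * (1 + (real k)\<^sup>2)"
    using kl k by (simp add: field_simps power_mono)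
  then have "sobolev_weight s l \<le> ((real l / real k)\<^sup>2 * (1 + (real k)\<^sup>2)) powr s"
    unfolding sobolev_weight_def using s by (intro powr_mono2) auto
  also have "\<dots> = (real l / real k) powr (2 * s) * sobolev_weight s k"
    using kl by (simp add: powr_mult sobolev_weight_def powr_powr[symmetric] powr_realpow)
  also have "\<dots> \<le> (real l / real k) powr (real (nat \<lceil>2 * s\<rceil>)) * sobolev_weight s k"
    using kl s k by (intro mult_right_mono powr_mono) (auto simp: sobolev_weight_def)
  also have "(real l / real k) powr (real (nat \<lceil>2 * s\<rceil>)) = (real l / real k) ^ nat \<lceil>2 * s\<rceil>"
    using kl by (intro powr_realpow) auto
  finally have 1: "sobolev_weight s l \<le> (real l / real k) ^ nat \<lceil>2 * s\<rceil> * sobolev_weight s k" .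
  have 2: "min 1 (real l / real n) \<le> (real l / real k) * min 1 (real k / real n)"
    using kl n k by (auto simp: min_def field_simps)
  have "sobolev_weight s l * min 1 (real l / real n)
     \<le> ((real l / real k) ^ nat \<lceil>2 * s\<rceil> * sobolev_weight s k) * ((real l / real k) * min 1 (real k / real n))"
    by (intro mult_mono 1 2) (auto simp: sobolev_weight_def)
  then show "sobolev_weight s l * min 1 (real l / real n)
     \<le> (real l / real k) ^ Suc (nat \<lceil>2 * s\<rceil>) * (sobolev_weight s k * min 1 (real k / real n))"
    by (simp add: mult_ac)
  show "sobolev_weight s k * min 1 (real k / real n) \<le> sobolev_weight s l * min 1 (real l / real n)"
    using kl s n unfolding sobolev_weight_def
    by (intro mult_mono powr_mono2 min.mono divide_right_mono add_left_mono power_mono) auto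
qed (auto simp: sobolev_weight_def)

text \<open>
  The constant in the Cauchy-Schwarz bound of \<open>\<Sum>\<^sub>k\<^sub>>\<^sub>n k |a\<^sub>k|\<close> by the \<open>H\<^sup>s\<close> norm.
\<close>

definition wiener_tail :: "real \<Rightarrow> nat \<Rightarrow> real" where
  "wiener_tail s n = sqrt (\<Sum>k. (real (k + Suc n))\<^sup>2 / sobolev_weight s (k + Suc n))"

text \<open>
  The terms are at most \<open>k\<^sup>2\<^sup>-\<^sup>2\<^sup>s\<close>; this is where the threshold \<open>3/2\<close> comes from.
\<close>

lemma summable_wiener:
  assumes "3 / 2 < s"
  shows "summable (\<lambda>k. (real k)\<^sup>2 / sobolev_weight s k)"
proof (rule summable_comparison_test')
  show "summable (\<lambda>k. real k powr (2 - 2 * s))" using assms by (subst summable_real_powr_iff) simp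
  fix k :: nat assume "1 \<le> k"
  then have k: "0 < real k" by simp
  have "real k powr (2 * s) = ((real k)\<^sup>2) powr s"
    using k by (simp add: powr_powr[symmetric] powr_realpow)
  also have "\<dots> \<le> sobolev_weight s k"
    unfolding sobolev_weight_def using assms by (intro powr_mono2) auto
  finally have "(real k)\<^sup>2 / sobolev_weight s k \<le> (real k)\<^sup>2 / real k powr (2 * s)"
    using k by (intro divide_left_mono mult_pos_pos) (auto simp: sobolev_weight_def add_pos_nonneg)
  also have "\<dots> = real k powr (2 - 2 * s)" using k by (simp add: powr_diff powr_realpow)
  finally show "norm ((real k)\<^sup>2 / sobolev_weight s k) \<le> real k powr (2 - 2 * s)"
    by (simp add: sobolev_weight_def)
qed

lemma wiener_tail_nonneg: "3 / 2 < s \<Longrightarrow> 0 \<le> wiener_tail s n"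
  unfolding wiener_tail_def
  by (intro real_sqrt_ge_zero suminf_nonneg summable_ignore_initial_segment[OF summable_wiener])
     (auto simp: sobolev_weight_def simp del: of_nat_add of_nat_Suc)

lemma suminf_tail_tendsto_0:
  fixes f :: "nat \<Rightarrow> real"
  assumes "summable f"
  shows "(\<lambda>n. \<Sum>k. f (k + n)) \<longlonglongrightarrow> 0"
proof -
  have "(\<lambda>n. suminf f - sum f {..<n}) \<longlonglongrightarrow> suminf f - suminf f"
    by (intro tendsto_intros summable_LIMSEQ assms)
  then show ?thesis by (simp add: suminf_minus_initial_segment[OF assms])
qed

lemma wiener_tail_tendsto_0:
  assumes "3 / 2 < s"
  shows "wiener_tail s \<longlonglongrightarrow> 0"
proof -
  have "(\<lambda>n. sqrt (\<Sum>k. (real (k + Suc n))\<^sup>2 / sobolev_weight s (k + Suc n))) \<longlonglongrightarrow> sqrt 0"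
    using suminf_tail_tendsto_0[OF summable_wiener[OF assms], THEN LIMSEQ_Suc]
    by (intro tendsto_real_sqrt)
  then show ?thesis by (simp add: wiener_tail_def[abs_def])
qed

abbreviation sobolev_energy :: "real \<Rightarrow> nat \<Rightarrow> nat \<Rightarrow> (nat \<Rightarrow> complex) \<Rightarrow> real" where
  "sobolev_energy s m N a \<equiv> \<Sum>k\<in>{m..N}. sobolev_weight s k * (cmod (a k))\<^sup>2"

text \<open>
  Bounds on the \<open>H\<^sup>s\<close> norm of an infinite sequence are expressed by quantifying over \<open>N\<close>, which keeps
  all sums finite.
\<close>

definition sobolev_bounded :: "real \<Rightarrow> real \<Rightarrow> nat \<Rightarrow> (nat \<Rightarrow> complex) \<Rightarrow> bool" where
  "sobolev_bounded s R N a \<longleftrightarrow> 0 \<le> R \<and> sobolev_energy s 1 N a \<le> R\<^sup>2"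

lemma sobolev_bounded_mono:
  assumes "sobolev_bounded s R N a" "n \<le> N" "R \<le> R'"
  shows "sobolev_bounded s R' n a"
proof -
  have "sobolev_energy s 1 n a \<le> sobolev_energy s 1 N a"
    using assms by (intro sum_mono2) (auto simp: sobolev_weight_def)
  also have "\<dots> \<le> R'\<^sup>2" using assms power_mono[of R R' 2] by (auto simp: sobolev_bounded_def intro: order_trans)
  finally show ?thesis using assms by (auto simp: sobolev_bounded_def)
qed

lemma wiener_tail_bound:
  assumes s: "3 / 2 < s" and a: "sobolev_bounded s R N a"
  shows "(\<Sum>k\<in>{n<..N}. real k * cmod (a k)) \<le> wiener_tail s n * R"
proof -
  note W = sobolev_weight_pos[of s]
  define x where "x k = real k / sqrt (sobolev_weight s k)" for k
  define y where "y k = sqrt (sobolev_weight s k) * cmod (a k)" for k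
  have "(\<Sum>k\<in>{n<..N}. real k * cmod (a k)) = (\<Sum>k\<in>{n<..N}. x k * y k)"
    using W by (intro sum.cong refl) (simp add: x_def y_def less_imp_neq[symmetric])
  also have "\<dots> \<le> sqrt ((\<Sum>k\<in>{n<..N}. (x k)\<^sup>2) * (\<Sum>k\<in>{n<..N}. (y k)\<^sup>2))"
    by (rule real_le_rsqrt) (rule Cauchy_Schwarz_ineq_sum)
  also have "\<dots> \<le> sqrt ((wiener_tail s n)\<^sup>2 * R\<^sup>2)"
  proof (intro real_sqrt_le_mono mult_mono)
    define f where "f k = (real k)\<^sup>2 / sobolev_weight s k" for k
    have f: "0 \<le> f k" "summable f" for k using W summable_wiener[OF s] by (auto simp: f_def[abs_def] less_imp_le)
    have "(\<Sum>k\<in>{n<..N}. (x k)\<^sup>2) = (\<Sum>k\<in>{n<..N}. f k)"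
      using W by (intro sum.cong refl) (simp add: x_def f_def power_divide less_imp_le)
    also have "\<dots> = (\<Sum>k\<in>{..<N - n}. f (k + Suc n))"
      by (rule sum.reindex_bij_witness[of _ "\<lambda>k. k + Suc n" "\<lambda>k. k - Suc n"]) auto
    also have "\<dots> \<le> (\<Sum>k. f (k + Suc n))"
      by (intro sum_le_suminf summable_ignore_initial_segment f) auto
    also have "\<dots> = (wiener_tail s n)\<^sup>2"
      unfolding wiener_tail_def f_def using f
      by (subst real_sqrt_pow2) (auto intro!: suminf_nonneg summable_ignore_initial_segment simp: f_def[symmetric]
        summable_Suc_iff simp del: of_nat_add of_nat_Suc)
    finally show "(\<Sum>k\<in>{n<..N}. (x k)\<^sup>2) \<le> (wiener_tail s n)\<^sup>2" .
    have "(\<Sum>k\<in>{n<..N}. (y k)\<^sup>2) = (\<Sum>k\<in>{n<..N}. sobolev_weight s k * (cmod (a k))\<^sup>2)"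
      using W by (intro sum.cong refl) (simp add: y_def power_mult_distrib less_imp_le)
    also have "\<dots> \<le> sobolev_energy s 1 N a"
      using W by (intro sum_mono2) (auto simp: less_imp_le)
    also have "\<dots> \<le> R\<^sup>2" using a by (simp add: sobolev_bounded_def)
    finally show "(\<Sum>k\<in>{n<..N}. (y k)\<^sup>2) \<le> R\<^sup>2" .
  qed (auto intro!: sum_nonneg)
  also have "\<dots> = wiener_tail s n * R"
    using wiener_tail_nonneg[OF s] a by (simp add: real_sqrt_mult sobolev_bounded_def)
  finally show ?thesis .
qed

lemma wiener_bound:
  assumes "3 / 2 < s" and "sobolev_bounded s R N a"
  shows "wiener_norm N a \<le> wiener_tail s 0 * R"
proof -
  have "{1..N} = {0<..N}" by auto
  then show ?thesis using wiener_tail_bound[OF assms, of 0] by simp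
qed

lemma sobolev_bounded_coeff:
  assumes "0 \<le> s" "sobolev_bounded s R N a" "k \<in> {1..N}"
  shows "cmod (a k) \<le> R"
proof -
  have "1 * (cmod (a k))\<^sup>2 \<le> sobolev_weight s k * (cmod (a k))\<^sup>2"
    by (intro mult_right_mono sobolev_weight_ge_1 assms) auto
  also have "\<dots> \<le> sobolev_energy s 1 N a"
    using assms(3) by (intro member_le_sum) (auto simp: sobolev_weight_def)
  also have "\<dots> \<le> R\<^sup>2" using assms by (simp add: sobolev_bounded_def)
  finally show ?thesis using assms(2) by (auto simp: sobolev_bounded_def intro: power2_le_imp_le)
qed

subsection \<open>The limit of the cubic term\<close>

definition cubic_limit :: "real \<Rightarrow> (nat \<Rightarrow> complex) \<Rightarrow> nat \<Rightarrow> complex" where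
  "cubic_limit \<sigma> a k = lim (\<lambda>N. cubic \<sigma> N a k)"

text \<open>
  The bound that \<open>cubic_truncation_error\<close> yields for sequences of \<open>H\<^sup>s\<close> norm at most \<open>R\<close>.
\<close>

definition truncation_error :: "real \<Rightarrow> real \<Rightarrow> nat \<Rightarrow> real" where
  "truncation_error s R n = 6 * (wiener_tail s 0 * R)\<^sup>2 * (wiener_tail s n * R)"

lemma truncation_error_tendsto_0: "3 / 2 < s \<Longrightarrow> truncation_error s R \<longlonglongrightarrow> 0"
proof -
  assume s: "3 / 2 < s"
  have "(\<lambda>n. 6 * (wiener_tail s 0 * R)\<^sup>2 * (wiener_tail s n * R)) \<longlonglongrightarrow> 6 * (wiener_tail s 0 * R)\<^sup>2 * (0 * R)"
    by (intro tendsto_intros wiener_tail_tendsto_0 s)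
  then show ?thesis by (simp add: truncation_error_def[abs_def])
qed

lemma cubic_truncation_sobolev:
  assumes \<sigma>: "0 \<le> \<sigma>" "\<sigma> \<le> 1" and s: "3 / 2 < s" and a: "sobolev_bounded s R N a" and "n \<le> N"
  shows "(\<Sum>k\<in>{1..K}. real k * cmod (cubic \<sigma> N a k - cubic \<sigma> n a k)) \<le> truncation_error s R n"
proof -
  have "(\<Sum>k\<in>{1..K}. real k * cmod (cubic \<sigma> N a k - cubic \<sigma> n a k))
    \<le> 6 * (wiener_tail s 0 * R)\<^sup>2 * (\<Sum>k\<in>{n<..N}. real k * cmod (a k))"
    by (intro cubic_truncation_error \<sigma> \<open>n \<le> N\<close> wiener_bound[OF s a])
  also have "\<dots> \<le> truncation_error s R n"
    unfolding truncation_error_def by (intro mult_left_mono wiener_tail_bound[OF s a]) auto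
  finally show ?thesis .
qed

lemma cubic_limit_LIMSEQ:
  assumes \<sigma>: "0 \<le> \<sigma>" "\<sigma> \<le> 1" and s: "3 / 2 < s" and a: "\<And>N. sobolev_bounded s R N a" and k: "1 \<le> k"
  shows "(\<lambda>N. cubic \<sigma> N a k) \<longlonglongrightarrow> cubic_limit \<sigma> a k"
proof -
  have err: "cmod (cubic \<sigma> N a k - cubic \<sigma> n a k) \<le> truncation_error s R n" if "n \<le> N" for n N
  proof -
    have "1 * cmod (cubic \<sigma> N a k - cubic \<sigma> n a k) \<le> real k * cmod (cubic \<sigma> N a k - cubic \<sigma> n a k)"
      using k by (intro mult_right_mono) auto
    also have "\<dots> \<le> (\<Sum>k\<in>{1..k}. real k * cmod (cubic \<sigma> N a k - cubic \<sigma> n a k))"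
      using k by (intro member_le_sum) auto
    also have "\<dots> \<le> truncation_error s R n" by (rule cubic_truncation_sobolev[OF \<sigma> s a that])
    finally show ?thesis by simp
  qed
  have "Cauchy (\<lambda>N. cubic \<sigma> N a k)"
  proof (rule CauchyI')
    fix e :: real assume "0 < e"
    then have "eventually (\<lambda>n. truncation_error s R n < e) sequentially"
      using order_tendstoD(2)[OF truncation_error_tendsto_0[OF s, of R]] by blast
    then obtain M where M: "\<And>n. n \<ge> M \<Longrightarrow> truncation_error s R n < e" by (auto simp: eventually_sequentially)
    show "\<exists>M. \<forall>m\<ge>M. \<forall>n>m. dist (cubic \<sigma> m a k) (cubic \<sigma> n a k) < e"
    proof (intro exI allI impI)
      fix m n assume "M \<le> m" "m < n"
      then show "dist (cubic \<sigma> m a k) (cubic \<sigma> n a k) < e"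
        using err[of m n] M[of m] by (simp add: dist_norm norm_minus_commute)
    qed
  qed
  then show ?thesis unfolding cubic_limit_def by (simp add: Cauchy_convergent_iff convergent_LIMSEQ_iff)
qed

lemma cubic_limit_truncation:
  assumes \<sigma>: "0 \<le> \<sigma>" "\<sigma> \<le> 1" and s: "3 / 2 < s" and a: "\<And>N. sobolev_bounded s R N a"
  shows "(\<Sum>k\<in>{1..K}. real k * cmod (cubic_limit \<sigma> a k - cubic \<sigma> n a k)) \<le> truncation_error s R n"
proof (rule tendsto_upperbound)
  show "(\<lambda>N. \<Sum>k\<in>{1..K}. real k * cmod (cubic \<sigma> N a k - cubic \<sigma> n a k))
    \<longlonglongrightarrow> (\<Sum>k\<in>{1..K}. real k * cmod (cubic_limit \<sigma> a k - cubic \<sigma> n a k))"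
    by (intro tendsto_intros cubic_limit_LIMSEQ[OF \<sigma> s a]) auto
  show "\<forall>\<^sub>F N in sequentially. (\<Sum>k\<in>{1..K}. real k * cmod (cubic \<sigma> N a k - cubic \<sigma> n a k)) \<le> truncation_error s R n"
    using eventually_ge_at_top[of n] by eventually_elim (rule cubic_truncation_sobolev[OF \<sigma> s a])
qed simp

lemma triads_0: "triads 0 k = {}"
  by (auto simp: triads_def)

text \<open>
  Comparison with the empty truncation \<open>n = 0\<close>.
\<close>

lemma cubic_limit_partial_sums:
  assumes \<sigma>: "0 \<le> \<sigma>" "\<sigma> \<le> 1" and s: "3 / 2 < s" and a: "\<And>N. sobolev_bounded s R N a"
  shows "(\<Sum>k\<in>{1..K}. cmod (cubic_limit \<sigma> a k)) \<le> truncation_error s R 0"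
proof -
  have "cubic \<sigma> 0 a k = 0" for k by (auto simp: trilinear_def triads_0)
  then have "(\<Sum>k\<in>{1..K}. real k * cmod (cubic_limit \<sigma> a k)) \<le> truncation_error s R 0"
    using cubic_limit_truncation[OF assms, where K = K and n = 0] by simp
  moreover have "(\<Sum>k\<in>{1..K}. 1 * cmod (cubic_limit \<sigma> a k)) \<le> (\<Sum>k\<in>{1..K}. real k * cmod (cubic_limit \<sigma> a k))"
    by (intro sum_mono mult_right_mono) auto
  ultimately show ?thesis by simp
qed

section \<open>Stability in the square norm\<close>

text \<open>
  The sequence \<open>v\<close> may solve the infinite system or a finer truncation;
  the difference between its cubic term and the truncation at \<open>N\<close> is then an error of size \<open>\<epsilon>\<close>.  The error
  is summable in \<open>k\<close> even after multiplication by \<open>k\<close>, so it suffices to bound the difference itself by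
  \<open>2 R\<close>.
\<close>

lemma l2_stability:
  assumes \<sigma>: "0 \<le> \<sigma>" "\<sigma> \<le> 1" and s: "3 / 2 < s" and R: "0 \<le> R"
    and v: "\<And>t. t \<in> {0..T} \<Longrightarrow> sobolev_bounded s R N (v t)"
    and u: "\<And>t. t \<in> {0..T} \<Longrightarrow> sobolev_bounded s R N (u t)"
    and dv: "\<And>t k. t \<in> {0..T} \<Longrightarrow> k \<in> {1..N} \<Longrightarrow>
      ((\<lambda>t. v t k) has_vector_derivative \<i> * of_real (real k) * c t k) (at t within {0..T})"
    and du: "\<And>t k. t \<in> {0..T} \<Longrightarrow> k \<in> {1..N} \<Longrightarrow>
      ((\<lambda>t. u t k) has_vector_derivative \<i> * of_real (real k) * cubic \<sigma> N (u t) k) (at t within {0..T})"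
    and c: "\<And>t. t \<in> {0..T} \<Longrightarrow> (\<Sum>k\<in>{1..N}. real k * cmod (c t k - cubic \<sigma> N (v t) k)) \<le> \<epsilon>"
    and eq: "\<And>k. k \<in> {1..N} \<Longrightarrow> v 0 k = u 0 k" and t: "t \<in> {0..T}"
  shows "(\<Sum>k\<in>{1..N}. (cmod (v t k - u t k))\<^sup>2)
    \<le> 4 * R * \<epsilon> * T * exp (6 * (wiener_tail s 0 * R)\<^sup>2 * T)"
proof -
  define A where "A = wiener_tail s 0 * R"
  define d where "d t k = v t k - u t k" for t k
  define e where "e t k = \<i> * of_real (real k) * (c t k - cubic \<sigma> N (v t) k)" for t k
  define D where "D t = (\<Sum>k\<in>{1..N}. 1 * (cmod (d t k))\<^sup>2)" for t
  define D' where "D' t = - 2 * Im (\<Sum>k\<in>{1..N}. of_real (real k * 1) * ((cubic \<sigma> N (v t) k - cubic \<sigma> N (u t) k) * cnj (d t k)))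
      + 2 * (\<Sum>k\<in>{1..N}. 1 * Re (cnj (d t k) * e t k))" for t
  have \<epsilon>: "0 \<le> \<epsilon>" using c[OF t] by (rule order_trans[rotated]) (auto intro!: sum_nonneg)
  have "D t \<le> (D 0 + 4 * R * \<epsilon> * t) * exp (6 * A\<^sup>2 * t)"
  proof (rule gronwall[where E' = D' and T = T])
    fix t assume t: "t \<in> {0..T}"
    show "(D has_real_derivative D' t) (at t within {0..T})"
      unfolding D_def D'_def
    proof (rule energy_has_derivative)
      fix k assume k: "k \<in> {1..N}"
      show "((\<lambda>t. d t k) has_vector_derivative \<i> * of_real (real k) * (cubic \<sigma> N (v t) k - cubic \<sigma> N (u t) k) + e t k)
         (at t within {0..T})"
        using has_vector_derivative_diff[OF dv[OF t k] du[OF t k]] by (simp add: d_def e_def algebra_simps)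
    qed
    have "\<bar>Im (\<Sum>k\<in>{1..N}. of_real (real k) * ((cubic \<sigma> N (v t) k - cubic \<sigma> N (u t) k) * cnj (v t k - u t k)))\<bar>
      \<le> 3 * A\<^sup>2 * (\<Sum>k\<in>{1..N}. (cmod (v t k - u t k))\<^sup>2)"
      unfolding A_def by (intro difference_flux_bound \<sigma> wiener_bound s u v t)
    then have 1: "- 2 * Im (\<Sum>k\<in>{1..N}. of_real (real k * 1) * ((cubic \<sigma> N (v t) k - cubic \<sigma> N (u t) k) * cnj (d t k)))
      \<le> 6 * A\<^sup>2 * D t" by (simp add: D_def d_def)
    have "(\<Sum>k\<in>{1..N}. 1 * Re (cnj (d t k) * e t k)) \<le> (\<Sum>k\<in>{1..N}. 2 * R * (real k * cmod (c t k - cubic \<sigma> N (v t) k)))"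
    proof (rule sum_mono)
      fix k assume k: "k \<in> {1..N}"
      have "cmod (d t k) \<le> cmod (v t k) + cmod (u t k)" unfolding d_def by (rule norm_triangle_ineq4)
      also have "\<dots> \<le> R + R"
        using s by (intro add_mono sobolev_bounded_coeff[OF _ v[OF t] k] sobolev_bounded_coeff[OF _ u[OF t] k]) auto
      finally have d: "cmod (d t k) \<le> 2 * R" by simp
      have "1 * Re (cnj (d t k) * e t k) \<le> cmod (cnj (d t k) * e t k)" by (simp only: mult_1_left complex_Re_le_cmod)
      also have "\<dots> = cmod (d t k) * (real k * cmod (c t k - cubic \<sigma> N (v t) k))" by (simp add: norm_mult e_def)
      also have "\<dots> \<le> 2 * R * (real k * cmod (c t k - cubic \<sigma> N (v t) k))" by (intro mult_right_mono d) auto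
      finally show "1 * Re (cnj (d t k) * e t k) \<le> 2 * R * (real k * cmod (c t k - cubic \<sigma> N (v t) k))" .
    qed
    also have "\<dots> \<le> 2 * R * \<epsilon>"
      unfolding sum_distrib_left[symmetric] using R by (intro mult_left_mono c t) auto
    finally show "D' t \<le> 6 * A\<^sup>2 * D t + 4 * R * \<epsilon>" using 1 unfolding D'_def by linarith
  qed (use t R \<epsilon> in auto)
  also have "D 0 = 0" by (simp add: D_def d_def eq)
  also have "(0 + 4 * R * \<epsilon> * t) * exp (6 * A\<^sup>2 * t) \<le> 4 * R * \<epsilon> * T * exp (6 * A\<^sup>2 * T)"
    using t R \<epsilon> by (simp, intro mult_mono mult_left_mono) (auto intro!: mult_nonneg_nonneg mult_left_mono)
  finally show ?thesis by (simp add: D_def d_def A_def)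
qed

section \<open>A priori bounds for the Galerkin approximations\<close>

text \<open>
  Dominated convergence for series: the factors are at most \<open>1\<close> and tend to \<open>0\<close> for each fixed \<open>k\<close>.
\<close>

lemma tail_weights_tendsto_0:
  fixes f :: "nat \<Rightarrow> real"
  assumes f: "summable f" and nn: "\<And>k. 0 \<le> f k"
  shows "(\<lambda>n. \<Sum>k. f k * min 1 (real k / real n)) \<longlonglongrightarrow> 0"
proof (rule tendstoI)
  fix e :: real assume e: "0 < e"
  have sm: "summable (\<lambda>k. f k * min 1 (real k / real n))" for n
    by (rule summable_comparison_test'[OF f, of 0]) (auto simp: nn abs_mult intro!: mult_left_le)
  obtain K where K: "(\<Sum>k. f (k + K)) < e / 2"
    using order_tendstoD(2)[OF suminf_tail_tendsto_0[OF f], of "e / 2"] e by (auto simp: eventually_sequentially)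
  define F where "F = suminf f"
  have F: "0 \<le> F" unfolding F_def by (intro suminf_nonneg f nn)
  obtain n0 :: nat where n0: "real K * F < real n0 * (e / 2)"
    using reals_Archimedean3[of "e / 2"] e by (metis half_gt_zero)
  show "\<forall>\<^sub>F n in sequentially. dist (\<Sum>k. f k * min 1 (real k / real n)) 0 < e"
    using eventually_ge_at_top[of "Suc n0"]
  proof eventually_elim
    case (elim n)
    have n: "0 < real n" "real n0 \<le> real n" using elim by auto
    have "(\<Sum>k. f k * min 1 (real k / real n)) = (\<Sum>k. f (k + K) * min 1 (real (k + K) / real n))
        + (\<Sum>k<K. f k * min 1 (real k / real n))"
      by (rule suminf_split_initial_segment[OF sm])
    also have "(\<Sum>k. f (k + K) * min 1 (real (k + K) / real n)) \<le> (\<Sum>k. f (k + K))"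
      by (intro suminf_le summable_ignore_initial_segment f sm[THEN summable_ignore_initial_segment])
         (auto simp: nn intro!: mult_left_le)
    also have "(\<Sum>k<K. f k * min 1 (real k / real n)) \<le> (\<Sum>k<K. f k * (real K / real n))"
      using n by (intro sum_mono mult_left_mono nn) (auto intro!: min.coboundedI2 divide_right_mono)
    also have "\<dots> \<le> F * (real K / real n)"
      unfolding sum_distrib_right[symmetric] F_def
      by (intro mult_right_mono sum_le_suminf f nn) auto
    also have "\<dots> < e / 2"
    proof -
      have "real K * F < real n * (e / 2)"
        using n0 n e mult_right_mono[of "real n0" "real n" "e / 2"] by linarith
      then show ?thesis using n by (simp add: field_simps)
    qed
    finally have "(\<Sum>k. f k * min 1 (real k / real n)) < e" using K by simp
    moreover have "0 \<le> (\<Sum>k. f k * min 1 (real k / real n))"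
      by (intro suminf_nonneg sm) (auto simp: nn)
    ultimately show ?case by simp
  qed
qed

lemma energy_growth:
  assumes \<sigma>: "0 \<le> \<sigma>" "\<sigma> \<le> 1" and W: "doubling_weight C W"
    and A: "wiener_norm N (a t) \<le> A"
    and a: "\<And>k. k \<in> {1..N} \<Longrightarrow> ((\<lambda>t. a t k) has_vector_derivative \<i> * of_real (real k) * cubic \<sigma> N (a t) k) (at t within S)"
  shows "\<exists>E'. ((\<lambda>t. \<Sum>k\<in>{1..N}. W k * (cmod (a t k))\<^sup>2) has_real_derivative E') (at t within S) \<and>
     E' \<le> 2 * C * A\<^sup>2 * (\<Sum>k\<in>{1..N}. W k * (cmod (a t k))\<^sup>2)"
proof (intro exI conjI)
  show "((\<lambda>t. \<Sum>k\<in>{1..N}. W k * (cmod (a t k))\<^sup>2) has_real_derivative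
      - 2 * Im (\<Sum>k\<in>{1..N}. of_real (real k * W k) * (cubic \<sigma> N (a t) k * cnj (a t k)))
      + 2 * (\<Sum>k\<in>{1..N}. W k * Re (cnj (a t k) * 0))) (at t within S)"
    by (rule energy_has_derivative) (use a in simp)
  have nn: "0 \<le> W k" "0 \<le> C" for k using W by (auto simp: doubling_weight_def)
  define A' where "A' = wiener_norm N (a t)"
  have A': "A'\<^sup>2 \<le> A\<^sup>2" unfolding A'_def by (intro power_mono A sum_nonneg) auto
  define E where "E = (\<Sum>k\<in>{1..N}. W k * (cmod (a t k))\<^sup>2)"
  have E: "0 \<le> E" unfolding E_def by (intro sum_nonneg mult_nonneg_nonneg nn) auto
  have "\<bar>Im (\<Sum>k\<in>{1..N}. of_real (real k * W k) * (cubic \<sigma> N (a t) k * cnj (a t k)))\<bar> \<le> C * A'\<^sup>2 * E"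
    unfolding A'_def E_def by (rule energy_flux_bound[OF \<sigma> W])
  also have "C * A'\<^sup>2 * E \<le> C * A\<^sup>2 * E" by (intro mult_right_mono mult_left_mono A' nn E)
  finally show "- 2 * Im (\<Sum>k\<in>{1..N}. of_real (real k * W k) * (cubic \<sigma> N (a t) k * cnj (a t k)))
      + 2 * (\<Sum>k\<in>{1..N}. W k * Re (cnj (a t k) * 0)) \<le> 2 * C * A\<^sup>2 * (\<Sum>k\<in>{1..N}. W k * (cmod (a t k))\<^sup>2)"
    by (simp add: E_def)
qed

text \<open>
  Both bounds come from \<open>energy_growth\<close>.  With the Sobolev weight the Wiener norm is itself
  bounded by the energy, which gives a quadratic differential inequality and a lifespan \<open>T\<close> that depends
  only on the initial energy.  Once the \<open>H\<^sup>s\<close> bound \<open>R\<close> is known, the inequality for the other weights is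
  linear, and their initial energies tend to \<open>0\<close> as \<open>n\<close> grows.
\<close>

lemma galerkin_family:
  assumes \<sigma>: "0 \<le> \<sigma>" "\<sigma> \<le> 1" and s: "3 / 2 < s"
    and a0: "summable (\<lambda>k. sobolev_weight s k * (cmod (a0 k))\<^sup>2)"
  obtains T R \<theta> a where "0 < T" "0 \<le> R" "\<theta> \<longlonglongrightarrow> (0::real)"
    "\<And>N k. k \<in> {1..N} \<Longrightarrow> a N 0 k = a0 k"
    "\<And>N t k. t \<in> {0..T} \<Longrightarrow> k \<in> {1..N} \<Longrightarrow>
       ((\<lambda>t. a N t k) has_vector_derivative \<i> * of_real (real k) * cubic \<sigma> N (a N t) k) (at t within {0..T})"
    "\<And>N t. t \<in> {0..T} \<Longrightarrow> sobolev_bounded s R N (a N t)"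
    "\<And>N n t. 1 \<le> n \<Longrightarrow> t \<in> {0..T} \<Longrightarrow> sobolev_energy s n N (a N t) \<le> \<theta> n"
proof -
  define w where "w = sobolev_weight s"
  have w: "0 < w k" "0 \<le> w k" for k using sobolev_weight_pos[of s k] by (auto simp: w_def)
  define wn where "wn n k = w k * min 1 (real k / real n)" for n k
  define C :: real where "C = 2 ^ Suc (Suc (nat \<lceil>2 * s\<rceil>))"
  have C: "0 \<le> C" by (simp add: C_def)
  have dbl: "doubling_weight C (wn n)" if "1 \<le> n" for n
    using doubling_weight_sobolev[of s n] that s by (simp add: wn_def[abs_def] w_def C_def)
  define K where "K = wiener_tail s 0"
  have K: "0 \<le> K" unfolding K_def by (rule wiener_tail_nonneg[OF s])
  define E0 where "E0 = (\<Sum>k. w k * (cmod (a0 k))\<^sup>2)"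
  have E0: "0 \<le> E0" unfolding E0_def using a0 w by (intro suminf_nonneg) (auto simp: w_def)
  define L where "L = 2 * C * K\<^sup>2"
  have L: "0 \<le> L" using C by (simp add: L_def)
  \<comment> \<open>The lifespan is dictated by \<open>riccati\<close>; \<open>L + 1\<close> in place of \<open>L\<close> guards against \<open>L = 0\<close>.\<close>
  define T where "T = 1 / (2 * (L + 1) * (E0 + 1))"
  have T: "0 < T" using L E0 by (simp add: T_def)
  define R where "R = sqrt (2 * (E0 + 1))"
  have R: "0 \<le> R" "R\<^sup>2 = 2 * (E0 + 1)" using E0 by (auto simp: R_def)
  have "\<exists>a. (\<forall>k. a 0 k = (if k \<in> {1..N} then a0 k else 0)) \<and>
     (\<forall>t\<in>{0..T}. \<forall>k\<in>{1..N}. ((\<lambda>t. a t k) has_vector_derivative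
        \<i> * of_real (real k) * cubic \<sigma> N (a t) k) (at t within {0..T}))" for N
    using T by (intro galerkin_solution \<sigma>) auto
  then obtain a where a_0: "\<And>N k. a N 0 k = (if k \<in> {1..N} then a0 k else 0)"
    and da: "\<And>N t k. t \<in> {0..T} \<Longrightarrow> k \<in> {1..N} \<Longrightarrow>
       ((\<lambda>t. a N t k) has_vector_derivative \<i> * of_real (real k) * cubic \<sigma> N (a N t) k) (at t within {0..T})"
    by metis
  define E where "E n N t = (\<Sum>k\<in>{1..N}. wn n k * (cmod (a N t k))\<^sup>2)" for n N t
  have Enn: "0 \<le> E n N t" for n N t
    unfolding E_def wn_def by (intro sum_nonneg mult_nonneg_nonneg w) auto
  have E1: "E 1 N t = sobolev_energy s 1 N (a N t)" for N t
    unfolding E_def wn_def w_def by (intro sum.cong refl) auto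
  have sm: "summable (\<lambda>k. w k * (cmod (a0 k))\<^sup>2 * min 1 (real k / real n))" for n
    using a0 w by (intro summable_comparison_test'[OF a0, of 0]) (auto simp: w_def[symmetric] abs_mult intro!: mult_left_le)
  define t0 where "t0 n = (\<Sum>k. w k * (cmod (a0 k))\<^sup>2 * min 1 (real k / real n))" for n
  have t0: "t0 \<longlonglongrightarrow> 0"
    unfolding t0_def[abs_def] using a0 w by (intro tail_weights_tendsto_0) (auto simp: w_def)
  have init: "E n N 0 \<le> t0 n" for n N
  proof -
    have "E n N 0 = (\<Sum>k\<in>{1..N}. w k * (cmod (a0 k))\<^sup>2 * min 1 (real k / real n))"
      unfolding E_def wn_def by (intro sum.cong refl) (simp add: a_0 mult_ac)
    also have "\<dots> \<le> t0 n"
      unfolding t0_def using w by (intro sum_le_suminf sm) auto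
    finally show ?thesis .
  qed
  have init1: "E 1 N 0 \<le> E0" for N
  proof -
    have "E 1 N 0 = (\<Sum>k\<in>{1..N}. w k * (cmod (a0 k))\<^sup>2)"
      unfolding E1 w_def by (intro sum.cong refl) (simp add: a_0)
    also have "\<dots> \<le> E0"
      unfolding E0_def using w a0 by (intro sum_le_suminf) (auto simp: w_def)
    finally show ?thesis .
  qed
  have bounded: "sobolev_bounded s (sqrt (E 1 N t)) N (a N t)" for N t
    unfolding sobolev_bounded_def E1[symmetric] using Enn[of 1 N t] by simp
  have "\<exists>E'. (E n N has_real_derivative E') (at t within {0..T}) \<and> E' \<le> 2 * C * (K * r)\<^sup>2 * E n N t"
    if "t \<in> {0..T}" "1 \<le> n" "sobolev_bounded s r N (a N t)" for n N t r
    unfolding E_def[abs_def]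
    by (rule energy_growth[OF \<sigma> dbl[OF that(2)]])
       (auto simp: K_def intro!: wiener_bound[OF s that(3), simplified] da[OF that(1), simplified])
  then have growth: "\<exists>E'. (E n N has_real_derivative E') (at t within {0..T}) \<and> E' \<le> (L * r\<^sup>2) * E n N t"
    if "t \<in> {0..T}" "1 \<le> n" "sobolev_bounded s r N (a N t)" for n N t r
    using that by (simp add: L_def power_mult_distrib mult.assoc)
  have bnd: "E 1 N t \<le> R\<^sup>2" if t: "t \<in> {0..T}" for N t
  proof -
    have "\<exists>E'. (E 1 N has_real_derivative E') (at t within {0..T}) \<and> E' \<le> L * (E 1 N t)\<^sup>2" if "t \<in> {0..T}" for t
      using growth[OF that order_refl bounded[of N t]] Enn[of 1 N t] by (simp add: power2_eq_square mult.assoc)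
    then obtain E' where E': "\<And>t. t \<in> {0..T} \<Longrightarrow> (E 1 N has_real_derivative E' t) (at t within {0..T})"
      "\<And>t. t \<in> {0..T} \<Longrightarrow> E' t \<le> L * (E 1 N t)\<^sup>2" by metis
    have "2 * L * T * (E 1 N 0 + 1) \<le> 2 * (L + 1) * T * (E0 + 1)"
      using L T init1[of N] Enn[of 1 N 0] by (intro mult_mono mult_right_mono) auto
    also have "\<dots> = 1" using L E0 by (simp add: T_def)
    finally have "E 1 N t \<le> 2 * (E 1 N 0 + 1)"
      by (intro riccati[OF E' Enn L _ t])
    also have "\<dots> \<le> R\<^sup>2" using init1[of N] R by simp
    finally show ?thesis .
  qed
  have sb: "sobolev_bounded s R N (a N t)" if "t \<in> {0..T}" for N t
    unfolding sobolev_bounded_def E1[symmetric] using bnd[OF that] R by simp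
  define \<theta> where "\<theta> n = t0 n * exp (L * R\<^sup>2 * T)" for n
  have t0nn: "0 \<le> t0 n" for n using order_trans[OF Enn init[of n 0]] .
  show ?thesis
  proof (rule that[of T R \<theta> a])
    have "(\<lambda>n. t0 n * exp (L * R\<^sup>2 * T)) \<longlonglongrightarrow> 0 * exp (L * R\<^sup>2 * T)"
      by (intro tendsto_intros t0)
    then show "\<theta> \<longlonglongrightarrow> 0" by (simp add: \<theta>_def[abs_def])
    show "sobolev_energy s n N (a N t) \<le> \<theta> n" if n: "1 \<le> n" and t: "t \<in> {0..T}" for N n t
    proof -
      have "\<exists>E'. (E n N has_real_derivative E') (at t within {0..T}) \<and> E' \<le> (L * R\<^sup>2) * E n N t" if "t \<in> {0..T}" for t
        by (rule growth[OF that n sb[OF that]])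
      then obtain E' where E': "\<And>t. t \<in> {0..T} \<Longrightarrow> (E n N has_real_derivative E' t) (at t within {0..T})"
        "\<And>t. t \<in> {0..T} \<Longrightarrow> E' t \<le> (L * R\<^sup>2) * E n N t + 0" by (metis add.right_neutral)
      have "sobolev_energy s n N (a N t) = (\<Sum>k\<in>{n..N}. wn n k * (cmod (a N t k))\<^sup>2)"
        using n by (intro sum.cong refl) (auto simp: wn_def w_def)
      also have "\<dots> \<le> E n N t"
        unfolding E_def using n w by (intro sum_mono2) (auto simp: wn_def)
      also have "\<dots> \<le> (E n N 0 + 0 * t) * exp (L * R\<^sup>2 * t)"
        using L by (intro gronwall[OF E' _ _ t]) auto
      also have "\<dots> \<le> t0 n * exp (L * R\<^sup>2 * T)"
        using init[of n N] t L t0nn by (intro mult_mono) (auto intro!: mult_left_mono)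
      finally show ?thesis by (simp add: \<theta>_def)
    qed
  qed (use T R sb da in \<open>auto simp: a_0\<close>)
qed

section \<open>Well-posedness of the coefficient system\<close>

text \<open>
  The coefficient with index \<open>0\<close> is left unconstrained.
\<close>

definition coefficient_solution ::
    "real \<Rightarrow> real \<Rightarrow> (nat \<Rightarrow> complex) \<Rightarrow> real \<Rightarrow> (real \<Rightarrow> nat \<Rightarrow> complex) \<Rightarrow> bool" where
  "coefficient_solution \<sigma> s a0 T a \<longleftrightarrow>
     (\<forall>k\<ge>1. a 0 k = a0 k) \<and>
     (\<forall>t\<in>{0..T}. \<forall>k\<ge>1. ((\<lambda>t. a t k) has_vector_derivative
        \<i> * of_real (real k) * cubic_limit \<sigma> (a t) k) (at t within {0..T})) \<and>
     (\<exists>R. \<forall>t\<in>{0..T}. \<forall>N. sobolev_bounded s R N (a t))"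

text \<open>
  The truncations form a Cauchy sequence, uniformly in time, because the finer one solves the coarser
  system up to a truncation error.  The derivatives converge uniformly as well, so the limit solves the
  infinite system.  Any bounded solution of the infinite system is compared with the truncations in
  the same way and hence equals their limit.
\<close>

theorem coefficient_wellposedness:
  assumes \<sigma>: "0 \<le> \<sigma>" "\<sigma> \<le> 1" and s: "3 / 2 < s"
    and a0: "summable (\<lambda>k. sobolev_weight s k * (cmod (a0 k))\<^sup>2)"
  obtains T \<theta> a where "0 < T" "coefficient_solution \<sigma> s a0 T a" "\<theta> \<longlonglongrightarrow> (0::real)"
    "\<And>N n t. 1 \<le> n \<Longrightarrow> t \<in> {0..T} \<Longrightarrow> sobolev_energy s n N (a t) \<le> \<theta> n"
    "\<forall>v. coefficient_solution \<sigma> s a0 T v \<longrightarrow> (\<forall>t\<in>{0..T}. \<forall>k\<ge>1. v t k = a t k)"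
proof -
  obtain T R \<theta> g where T: "0 < T" and R: "0 \<le> R" and \<theta>: "\<theta> \<longlonglongrightarrow> (0::real)"
    and g0: "\<And>N k. k \<in> {1..N} \<Longrightarrow> g N 0 k = a0 k"
    and dg: "\<And>N t k. t \<in> {0..T} \<Longrightarrow> k \<in> {1..N} \<Longrightarrow>
       ((\<lambda>t. g N t k) has_vector_derivative \<i> * of_real (real k) * cubic \<sigma> N (g N t) k) (at t within {0..T})"
    and gR: "\<And>N t. t \<in> {0..T} \<Longrightarrow> sobolev_bounded s R N (g N t)"
    and g\<theta>: "\<And>N n t. 1 \<le> n \<Longrightarrow> t \<in> {0..T} \<Longrightarrow> sobolev_energy s n N (g N t) \<le> \<theta> n"
    using galerkin_family[OF assms] by blast
  define \<eta> where "\<eta> R N = sqrt (4 * R * truncation_error s R N * T * exp (6 * (wiener_tail s 0 * R)\<^sup>2 * T))" for R N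
  have \<eta>0: "\<eta> R \<longlonglongrightarrow> 0" for R
  proof -
    have "(\<lambda>N. sqrt (4 * R * truncation_error s R N * T * exp (6 * (wiener_tail s 0 * R)\<^sup>2 * T)))
      \<longlonglongrightarrow> sqrt (4 * R * 0 * T * exp (6 * (wiener_tail s 0 * R)\<^sup>2 * T))"
      by (intro tendsto_intros truncation_error_tendsto_0 s)
    then show ?thesis by (simp add: \<eta>_def[abs_def])
  qed
  have coord: "cmod (x k - y k) \<le> \<eta> R' N" if "(\<Sum>k\<in>{1..N}. (cmod (x k - y k))\<^sup>2)
      \<le> 4 * R' * truncation_error s R' N * T * exp (6 * (wiener_tail s 0 * R')\<^sup>2 * T)" "k \<in> {1..N}" for x y k R' N
  proof -
    have "(cmod (x k - y k))\<^sup>2 \<le> (\<Sum>k\<in>{1..N}. (cmod (x k - y k))\<^sup>2)" using that(2) by (intro member_le_sum) auto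
    also note that(1)
    finally show ?thesis unfolding \<eta>_def by (rule real_le_rsqrt)
  qed
  have cauchy: "cmod (g M t k - g N t k) \<le> \<eta> R N" if "N \<le> M" "t \<in> {0..T}" "k \<in> {1..N}" for M N t k
  proof (rule coord[OF l2_stability[OF \<sigma> s R]])
    show "sobolev_bounded s R N (g M t)" if "t \<in> {0..T}" for t
      using sobolev_bounded_mono[OF gR[OF that] \<open>N \<le> M\<close> order_refl] .
    show "(\<Sum>k\<in>{1..N}. real k * cmod (cubic \<sigma> M (g M t) k - cubic \<sigma> N (g M t) k)) \<le> truncation_error s R N"
      if "t \<in> {0..T}" for t
      by (intro cubic_truncation_sobolev \<sigma> s gR that \<open>N \<le> M\<close>)
  qed (use that gR g0 in \<open>auto intro!: dg[simplified]\<close>)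
  define a where "a t k = lim (\<lambda>N. g N t k)" for t k
  have lim: "(\<lambda>N. g N t k) \<longlonglongrightarrow> a t k" if t: "t \<in> {0..T}" and k: "1 \<le> k" for t k
  proof -
    have "Cauchy (\<lambda>N. g N t k)"
    proof (rule CauchyI')
      fix e :: real assume "0 < e"
      then have "eventually (\<lambda>n. \<eta> R n < e) sequentially" using order_tendstoD(2)[OF \<eta>0] by blast
      then obtain M where M: "\<And>n. n \<ge> M \<Longrightarrow> \<eta> R n < e" by (auto simp: eventually_sequentially)
      show "\<exists>M. \<forall>m\<ge>M. \<forall>n>m. dist (g m t k) (g n t k) < e"
      proof (intro exI allI impI)
        fix m n assume "max M k \<le> m" "m < n"
        then show "dist (g m t k) (g n t k) < e"
          using cauchy[of m n t k] M[of m] t k by (simp add: dist_norm norm_minus_commute)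
      qed
    qed
    then show ?thesis unfolding a_def by (simp add: Cauchy_convergent_iff convergent_LIMSEQ_iff)
  qed
  have dist: "cmod (g N t k - a t k) \<le> \<eta> R N" if "t \<in> {0..T}" "k \<in> {1..N}" for t k N
  proof (rule tendsto_upperbound)
    show "(\<lambda>M. cmod (g N t k - g M t k)) \<longlonglongrightarrow> cmod (g N t k - a t k)"
      using that by (intro tendsto_intros lim) auto
    show "\<forall>\<^sub>F M in sequentially. cmod (g N t k - g M t k) \<le> \<eta> R N"
      using eventually_ge_at_top[of N]
      by eventually_elim (use cauchy[OF _ that] in \<open>simp add: norm_minus_commute\<close>)
  qed simp
  have sums_le: "sobolev_energy s n M (a t) \<le> B"
    if t: "t \<in> {0..T}" and n: "1 \<le> n" and B: "\<And>N. sobolev_energy s n N (g N t) \<le> B" for t n M B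
  proof (rule tendsto_upperbound)
    show "(\<lambda>N. \<Sum>k\<in>{n..M}. sobolev_weight s k * (cmod (g N t k))\<^sup>2)
        \<longlonglongrightarrow> (sobolev_energy s n M (a t))"
      using t n by (intro tendsto_intros lim) auto
    show "\<forall>\<^sub>F N in sequentially. sobolev_energy s n M (g N t) \<le> B"
      using eventually_ge_at_top[of M]
    proof eventually_elim
      case (elim N)
      then have "sobolev_energy s n M (g N t) \<le> sobolev_energy s n N (g N t)"
        by (intro sum_mono2) (auto simp: less_imp_le[OF sobolev_weight_pos])
      then show ?case using B[of N] by simp
    qed
  qed simp
  have aR: "sobolev_bounded s R N (a t)" if "t \<in> {0..T}" for N t
    unfolding sobolev_bounded_def using R gR[OF that]
    by (auto simp del: One_nat_def intro!: sums_le[OF that] simp: sobolev_bounded_def)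
  have a_0: "a 0 k = a0 k" if k: "1 \<le> k" for k
  proof -
    have "(\<lambda>N. g N 0 k) \<longlonglongrightarrow> a0 k"
      by (rule tendsto_eventually) (use eventually_ge_at_top[of k] in eventually_elim, use k g0 in auto)
    with lim[of 0 k] k T show ?thesis by (auto intro: LIMSEQ_unique)
  qed
  have unif: "\<forall>\<^sub>F N in sequentially. \<forall>t\<in>{0..T}. cmod (\<i> * of_real (real k) * cubic \<sigma> N (g N t) k
       - \<i> * of_real (real k) * cubic_limit \<sigma> (a t) k) \<le> e" if k: "1 \<le> k" and e: "0 < e" for k e
  proof -
    have "\<forall>\<^sub>F n in sequentially. truncation_error s R n < e / 3"
      using e by (intro order_tendstoD(2)[OF truncation_error_tendsto_0[OF s]]) auto
    then obtain n where n: "truncation_error s R n < e / 3" "k \<le> n"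
      by (metis eventually_sequentially linorder_le_cases)
    \<comment> \<open>Three errors: truncating the cubic term of \<open>g N\<close> at level \<open>n\<close>, replacing \<open>g N\<close> by its limit in
      the truncated term, which is locally Lipschitz with constant \<open>B\<close>, and removing the truncation.\<close>
    define B where "B = real k * (real (card (triads n k)) * real n * (3 * R\<^sup>2))"
    have B: "0 \<le> B" by (simp add: B_def)
    have "(\<lambda>N. B * \<eta> R N) \<longlonglongrightarrow> B * 0" by (intro tendsto_intros \<eta>0)
    then have ev: "\<forall>\<^sub>F N in sequentially. B * \<eta> R N < e / 3"
      using e by (intro order_tendstoD(2)) auto
    show ?thesis using ev eventually_ge_at_top[of n]
    proof eventually_elim
      case (elim N)
      show ?case
      proof
        fix t assume t: "t \<in> {0..T}"
        have single: "real k * cmod (x k) \<le> z" if "(\<Sum>k\<in>{1..k}. real k * cmod (x k)) \<le> z" for x z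
          using member_le_sum[of k "{1..k}" "\<lambda>k. real k * cmod (x k)"] k that by auto
        have 1: "real k * cmod (cubic \<sigma> N (g N t) k - cubic \<sigma> n (g N t) k) \<le> truncation_error s R n"
          by (rule single) (intro cubic_truncation_sobolev \<sigma> s gR t elim)
        have 2: "real k * cmod (cubic_limit \<sigma> (a t) k - cubic \<sigma> n (a t) k) \<le> truncation_error s R n"
          by (rule single) (intro cubic_limit_truncation \<sigma> s aR t)
        have "cmod (cubic \<sigma> n (g N t) k - cubic \<sigma> n (a t) k)
           \<le> real (card (triads n k)) * real n * (3 * R\<^sup>2) * \<eta> R N"
        proof (rule cubic_lipschitz[OF \<sigma> k n(2)])
          fix j assume j: "j \<in> {1..n}"
          show "cmod (g N t j) \<le> R" using sobolev_bounded_coeff[OF _ gR[OF t], of j N] j elim s by auto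
          show "cmod (a t j) \<le> R" using sobolev_bounded_coeff[OF _ aR[OF t], of j n] j s by auto
          show "cmod (g N t j - a t j) \<le> \<eta> R N" using dist[OF t, of j N] j elim by auto
        qed
        then have 3: "real k * cmod (cubic \<sigma> n (g N t) k - cubic \<sigma> n (a t) k) \<le> B * \<eta> R N"
          unfolding B_def by (simp add: mult.assoc mult_left_mono)
        have "cmod (\<i> * of_real (real k) * cubic \<sigma> N (g N t) k - \<i> * of_real (real k) * cubic_limit \<sigma> (a t) k)
          = real k * cmod ((cubic \<sigma> N (g N t) k - cubic \<sigma> n (g N t) k) + (cubic \<sigma> n (g N t) k - cubic \<sigma> n (a t) k)
              - (cubic_limit \<sigma> (a t) k - cubic \<sigma> n (a t) k))"
          by (simp add: right_diff_distrib[symmetric] norm_mult)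
        also have "\<dots> \<le> real k * (cmod (cubic \<sigma> N (g N t) k - cubic \<sigma> n (g N t) k) + cmod (cubic \<sigma> n (g N t) k - cubic \<sigma> n (a t) k)
              + cmod (cubic_limit \<sigma> (a t) k - cubic \<sigma> n (a t) k))"
          by (intro mult_left_mono order_trans[OF norm_triangle_ineq4] add_right_mono norm_triangle_ineq) auto
        also have "\<dots> \<le> e" using 1 2 3 n elim by (simp add: distrib_left)
        finally show "cmod (\<i> * of_real (real k) * cubic \<sigma> N (g N t) k - \<i> * of_real (real k) * cubic_limit \<sigma> (a t) k) \<le> e" .
      qed
    qed
  qed
  have da: "((\<lambda>t. a t k) has_vector_derivative \<i> * of_real (real k) * cubic_limit \<sigma> (a t) k) (at t within {0..T})"
    if t: "t \<in> {0..T}" and k: "1 \<le> k" for t k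
  proof -
    define c where "c t = \<i> * of_real (real k) * cubic_limit \<sigma> (a t) k" for t
    define f where "f n t = g (n + k) t k" for n t
    have "\<exists>h. \<forall>x\<in>{0..T}. (\<lambda>n. f n x) \<longlonglongrightarrow> h x \<and> (h has_derivative (\<lambda>y. y *\<^sub>R c x)) (at x within {0..T})"
    proof (rule has_derivative_sequence)
      show "(f n has_derivative (\<lambda>y. y *\<^sub>R (\<i> * of_real (real k) * cubic \<sigma> (n + k) (g (n + k) x) k))) (at x within {0..T})"
        if "x \<in> {0..T}" for n x
        using dg[OF that, of k "n + k"] k by (simp add: has_vector_derivative_def f_def[abs_def])
      show "\<forall>\<^sub>F n in sequentially. \<forall>x\<in>{0..T}. \<forall>h. norm (h *\<^sub>R (\<i> * of_real (real k) * cubic \<sigma> (n + k) (g (n + k) x) k) - h *\<^sub>R c x) \<le> e * norm h"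
        if "0 < e" for e
      proof -
        have "\<forall>\<^sub>F N in sequentially. \<forall>t\<in>{0..T}. cmod (\<i> * of_real (real k) * cubic \<sigma> (N + k) (g (N + k) t) k - c t) \<le> e"
          using unif[OF k that] unfolding c_def by (rule eventually_compose_filterlim[OF _ filterlim_add_const_nat_at_top])
        then show ?thesis
        proof eventually_elim
          case (elim n)
          show ?case
          proof (intro ballI allI)
            fix x and h :: real assume "x \<in> {0..T}"
            then have "\<bar>h\<bar> * cmod (\<i> * of_real (real k) * cubic \<sigma> (n + k) (g (n + k) x) k - c x) \<le> \<bar>h\<bar> * e"
              using elim by (intro mult_left_mono) auto
            then show "norm (h *\<^sub>R (\<i> * of_real (real k) * cubic \<sigma> (n + k) (g (n + k) x) k) - h *\<^sub>R c x) \<le> e * norm h"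
              by (simp add: scaleR_diff_right[symmetric] mult.commute)
          qed
        qed
      qed
      show "(\<lambda>n. f n 0) \<longlonglongrightarrow> a 0 k"
        unfolding f_def using T k by (intro LIMSEQ_ignore_initial_segment lim) auto
    qed (use T in auto)
    then obtain h where h: "\<And>x. x \<in> {0..T} \<Longrightarrow> (\<lambda>n. f n x) \<longlonglongrightarrow> h x"
      "\<And>x. x \<in> {0..T} \<Longrightarrow> (h has_vector_derivative c x) (at x within {0..T})"
      unfolding has_vector_derivative_def by blast
    have ha: "h x = a x k" if "x \<in> {0..T}" for x
      using h(1)[OF that] LIMSEQ_ignore_initial_segment[OF lim[OF that k], of k]
      unfolding f_def by (rule LIMSEQ_unique)
    show ?thesis
      using has_vector_derivative_transform[OF t _ h(2)[OF t], of "\<lambda>t. a t k"] ha by (simp add: c_def)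
  qed
  have sol: "coefficient_solution \<sigma> s a0 T a"
    unfolding coefficient_solution_def using a_0 da aR by blast
  show ?thesis
  proof (rule that[OF T sol \<theta>], goal_cases)
    case (1 n t N)
    then show ?case by (intro sums_le g\<theta>)
  next
    case 2
    show ?case
    proof (intro allI impI ballI)
    fix v t k
    assume v: "coefficient_solution \<sigma> s a0 T v" and t: "t \<in> {0..T}" and k: "1 \<le> (k::nat)"
    from v obtain R' where v0: "\<And>k. 1 \<le> k \<Longrightarrow> v 0 k = a0 k"
      and dv: "\<And>t k. t \<in> {0..T} \<Longrightarrow> 1 \<le> k \<Longrightarrow>
         ((\<lambda>t. v t k) has_vector_derivative \<i> * of_real (real k) * cubic_limit \<sigma> (v t) k) (at t within {0..T})"
      and vR: "\<And>N t. t \<in> {0..T} \<Longrightarrow> sobolev_bounded s R' N (v t)"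
      unfolding coefficient_solution_def by blast
    define Q where "Q = max R R'"
    have vQ: "sobolev_bounded s Q N (v t)" and gQ: "sobolev_bounded s Q N (g N t)" if "t \<in> {0..T}" for N t
      using sobolev_bounded_mono[OF vR[OF that] order_refl] sobolev_bounded_mono[OF gR[OF that] order_refl]
      by (auto simp: Q_def)
    have close: "cmod (v t k - g N t k) \<le> \<eta> Q N" if "k \<le> N" for N
    proof (rule coord[OF l2_stability[OF \<sigma> s]])
      show "(\<Sum>k\<in>{1..N}. real k * cmod (cubic_limit \<sigma> (v t) k - cubic \<sigma> N (v t) k)) \<le> truncation_error s Q N"
        if "t \<in> {0..T}" for t
        by (intro cubic_limit_truncation \<sigma> s vQ that)
    qed (use that t k R vQ gQ g0 v0 in \<open>auto simp: Q_def intro!: dg[simplified] dv[simplified]\<close>)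
    have "(\<lambda>N. g N t k - v t k) \<longlonglongrightarrow> 0"
    proof (rule Lim_null_comparison[OF _ \<eta>0[of Q]])
      show "\<forall>\<^sub>F N in sequentially. norm (g N t k - v t k) \<le> \<eta> Q N"
        using eventually_ge_at_top[of k] by eventually_elim (use close in \<open>simp add: norm_minus_commute\<close>)
    qed
    then have "(\<lambda>N. g N t k) \<longlonglongrightarrow> v t k" by (simp add: LIM_zero_iff)
    with lim[OF t k] show "v t k = a t k" by (rule LIMSEQ_unique[rotated])
    qed
  qed
qed

section \<open>Fourier series\<close>

definition expi :: "int \<Rightarrow> real \<Rightarrow> complex" where
  "expi k x = exp (\<i> * of_int k * of_real x)"

lemma expi_0 [simp]: "expi 0 x = 1"
  by (simp add: expi_def)

lemma expi_add: "expi (j + k) x = expi j x * expi k x"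
  by (simp add: expi_def exp_add[symmetric] algebra_simps)

lemma norm_expi [simp]: "cmod (expi k x) = 1"
  by (simp add: expi_def)

lemma continuous_on_expi [continuous_intros]: "continuous_on S (expi k)"
  unfolding expi_def[abs_def] by (intro continuous_intros)

lemma borel_measurable_expi [measurable]: "expi k \<in> borel_measurable borel"
  by (intro borel_measurable_continuous_onI continuous_on_expi)

lemma expi_periodic: "expi k (x + 2 * pi) = expi k x"
proof -
  have "exp (\<i> * of_int k * (2 * of_real pi)) = 1" using exp_integer_2pi[of "of_int k"] by (simp add: mult_ac)
  then show ?thesis by (simp add: expi_def distrib_left exp_add)
qed

lemma expi_has_derivative: "(expi k has_vector_derivative \<i> * of_int k * expi k x) (at x within S)"
  unfolding expi_def[abs_def]
  by (rule has_vector_derivative_real_field[OF _ , unfolded o_def] | auto intro!: derivative_eq_intros)+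

lemma fourier_coeff_expi:
  "fourier_coeff f k = 1 / (2 * of_real pi) * (LBINT x:{0..2 * pi}. f x * expi (- k) x)"
  by (simp add: fourier_coeff_def expi_def)

lemma integral_expi: "(LBINT x:{0..2 * pi}. expi k x) = (if k = 0 then 2 * of_real pi else 0)"
proof (cases "k = 0")
  case True
  then show ?thesis by (simp add: set_lebesgue_integral_def scaleR_conv_of_real)
next
  case False
  have "((\<lambda>x. expi k x) has_integral (expi k (2 * pi) / (\<i> * of_int k) - expi k 0 / (\<i> * of_int k))) {0..2 * pi}"
    using False by (intro fundamental_theorem_of_calculus)
      (auto intro!: derivative_eq_intros expi_has_derivative has_vector_derivative_divide[THEN has_vector_derivative_eq_rhs])
  moreover have "expi k (2 * pi) = expi k 0" using expi_periodic[of k 0] by simp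
  ultimately have "integral {0..2 * pi} (expi k) = 0" by (simp add: integral_unique)
  then show ?thesis using False
    by (subst set_borel_integral_eq_integral) (auto intro!: borel_integrable_atLeastAtMost' continuous_intros)
qed

subsection \<open>Uniqueness of Fourier coefficients\<close>

inductive trig_poly :: "(real \<Rightarrow> complex) \<Rightarrow> bool" where
  monomial: "trig_poly (\<lambda>x. c * expi k x)"
| add: "trig_poly f \<Longrightarrow> trig_poly g \<Longrightarrow> trig_poly (\<lambda>x. f x + g x)"

lemma trig_poly_mult_monomial:
  assumes "trig_poly f"
  shows "trig_poly (\<lambda>x. f x * (c * expi k x))"
  using assms
proof induction
  case (monomial d j)
  have "(\<lambda>x. d * expi j x * (c * expi k x)) = (\<lambda>x. (d * c) * expi (j + k) x)"
    by (simp add: expi_add mult_ac)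
  then show ?case using trig_poly.monomial by metis
next
  case (add f g)
  then show ?case using trig_poly.add[OF add.IH] by (simp add: distrib_right)
qed

lemma trig_poly_mult:
  assumes "trig_poly g" "trig_poly f"
  shows "trig_poly (\<lambda>x. f x * g x)"
  using assms(1)
proof induction
  case (monomial c k)
  show ?case by (rule trig_poly_mult_monomial[OF assms(2)])
next
  case (add g h)
  then show ?case using trig_poly.add[OF add.IH] by (simp add: distrib_left)
qed

text \<open>
  Real polynomials on the circle are trigonometric polynomials; for a linear form this is
  Euler's formula.
\<close>

lemma trig_poly_polynomial_function:
  assumes "real_polynomial_function (p :: complex \<Rightarrow> real)"
  shows "trig_poly (\<lambda>x. of_real (p (cis x)))"
  using assms
proof induction
  case (linear L)
  interpret L: bounded_linear L by fact
  have "L (cis x) = cos x * L 1 + sin x * L \<i>" for x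
  proof -
    have "cis x = cos x *\<^sub>R 1 + sin x *\<^sub>R \<i>" by (simp add: complex_eq_iff)
    then show ?thesis by (simp only: L.add L.scaleR real_scaleR_def)
  qed
  then have "of_real (L (cis x)) = ((of_real (L 1) - \<i> * of_real (L \<i>)) / 2) * expi 1 x
      + ((of_real (L 1) + \<i> * of_real (L \<i>)) / 2) * expi (- 1) x" for x
    by (simp add: expi_def exp_Euler exp_minus_Euler cos_of_real sin_of_real complex_eq_iff field_simps)
  then have "(\<lambda>x. of_real (L (cis x))) = (\<lambda>x. ((of_real (L 1) - \<i> * of_real (L \<i>)) / 2) * expi 1 x
      + ((of_real (L 1) + \<i> * of_real (L \<i>)) / 2) * expi (- 1) x)" by blast
  then show ?case by (simp only: trig_poly.intros)
next
  case (const c)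
  show ?case using trig_poly.monomial[of "of_real c" 0] by simp
next
  case (add f g)
  then show ?case using trig_poly.add[OF add.IH] by simp
next
  case (mult f g)
  then show ?case using trig_poly_mult[OF mult.IH(2) mult.IH(1)] by simp
qed

lemma set_integrable_mult_bounded:
  fixes f g :: "real \<Rightarrow> complex"
  assumes f: "set_integrable lborel S f" and S: "S \<in> sets borel" and g: "g \<in> borel_measurable borel"
    and B: "\<And>x. x \<in> S \<Longrightarrow> cmod (g x) \<le> B"
  shows "set_integrable lborel S (\<lambda>x. f x * g x)"
  unfolding set_integrable_def
proof (rule Bochner_Integration.integrable_bound)
  show "integrable lborel (\<lambda>x. B *\<^sub>R (indicator S x *\<^sub>R f x))"
    using f unfolding set_integrable_def by (rule integrable_scaleR_right)
  have [measurable]: "(\<lambda>x. indicator S x *\<^sub>R f x) \<in> borel_measurable lborel" "g \<in> borel_measurable borel"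
    using f g unfolding set_integrable_def by auto
  have "(\<lambda>x. (indicator S x *\<^sub>R f x) * g x) \<in> borel_measurable lborel" by measurable
  then show "(\<lambda>x. indicator S x *\<^sub>R (f x * g x)) \<in> borel_measurable lborel" by simp
  show "AE x in lborel. norm (indicator S x *\<^sub>R (f x * g x)) \<le> norm (B *\<^sub>R (indicator S x *\<^sub>R f x))"
  proof (rule AE_I2)
    fix x
    show "norm (indicator S x *\<^sub>R (f x * g x)) \<le> norm (B *\<^sub>R (indicator S x *\<^sub>R f x))"
    proof (cases "x \<in> S")
      case True
      then have "cmod (f x) * cmod (g x) \<le> cmod (f x) * \<bar>B\<bar>"
        using B[OF True] by (intro mult_left_mono) auto
      with True show ?thesis by (simp add: norm_mult mult.commute)
    qed simp
  qed
qed

lemma L2_torus_integrable: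
  assumes "f \<in> L2_torus"
  shows "set_integrable lborel {0..2 * pi} f"
  unfolding set_integrable_def
proof (rule Bochner_Integration.integrable_bound)
  have f: "f \<in> borel_measurable borel" "set_integrable lborel {0..2 * pi} (\<lambda>x. (cmod (f x))\<^sup>2)"
    using assms by (auto simp: L2_torus_def)
  show "integrable lborel (\<lambda>x. indicator {0..2 * pi} x *\<^sub>R (1 + (cmod (f x))\<^sup>2))"
    using set_integral_add(1)[OF _ f(2), of "\<lambda>_. 1"] borel_integrable_atLeastAtMost'[of 0 "2 * pi" "\<lambda>_. 1 :: real"]
    by (simp add: set_integrable_def)
  show "(\<lambda>x. indicator {0..2 * pi} x *\<^sub>R f x) \<in> borel_measurable lborel" using f by measurable
  have "y \<le> 1 + y\<^sup>2" for y :: real using zero_le_power2[of "y - 1 / 2"] by (simp add: power2_eq_square algebra_simps)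
  then have "cmod (f x) \<le> \<bar>1 + (cmod (f x))\<^sup>2\<bar>" for x using order_trans abs_ge_self by blast
  then show "AE x in lborel. norm (indicator {0..2 * pi} x *\<^sub>R f x) \<le> norm (indicator {0..2 * pi} x *\<^sub>R (1 + (cmod (f x))\<^sup>2))"
    by (auto simp: indicator_def)
qed

lemma integral_trig_poly_eq_0:
  assumes f: "set_integrable lborel {0..2 * pi} f"
    and zero: "\<And>k. fourier_coeff f k = 0" and "trig_poly g"
  shows "set_integrable lborel {0..2 * pi} (\<lambda>x. f x * g x) \<and> (LBINT x:{0..2 * pi}. f x * g x) = 0"
  using assms(3)
proof induction
  case (monomial c k)
  have int: "set_integrable lborel {0..2 * pi} (\<lambda>x. f x * expi k x)"
    by (rule set_integrable_mult_bounded[OF f, of _ 1]) auto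
  have "(LBINT x:{0..2 * pi}. f x * expi k x) = 0"
    using zero[of "- k"] by (simp add: fourier_coeff_expi)
  moreover have "(\<lambda>x. f x * (c * expi k x)) = (\<lambda>x. c * (f x * expi k x))" by (simp add: mult_ac)
  ultimately show ?case using int by simp
next
  case (add g h)
  then show ?case using set_integral_add[of lborel "{0..2*pi}" "\<lambda>x. f x * g x" "\<lambda>x. f x * h x"]
    by (simp add: distrib_left)
qed

text \<open>
  Orthogonality to trigonometric polynomials extends to continuous functions on the circle by the
  theorem of Stone and Weierstrass.
\<close>

lemma integral_continuous_circle_eq_0:
  fixes G :: "complex \<Rightarrow> real"
  assumes f: "set_integrable lborel {0..2 * pi} f"
    and zero: "\<And>k. fourier_coeff f k = 0" and G: "continuous_on UNIV G"
  shows "(LBINT x:{0..2 * pi}. f x * of_real (G (cis x))) = 0"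
proof -
  define M where "M = (LBINT x:{0..2 * pi}. cmod (f x))"
  have intn: "set_integrable lborel {0..2 * pi} (\<lambda>x. cmod (f x))" by (rule set_integrable_norm[OF f])
  have M: "0 \<le> M" unfolding M_def set_lebesgue_integral_def by (intro Bochner_Integration.integral_nonneg) auto
  have contG: "continuous_on UNIV (\<lambda>x. G (cis x))"
    by (intro continuous_on_compose2[OF G] continuous_intros) auto
  have "cmod (LBINT x:{0..2 * pi}. f x * of_real (G (cis x))) \<le> e * M" if e: "0 < e" for e
  proof -
    obtain p where p: "real_polynomial_function p" "\<And>z. z \<in> sphere 0 1 \<Longrightarrow> \<bar>G z - p z\<bar> < e"
      using Stone_Weierstrass_real_polynomial_function[OF compact_sphere[of 0 1] continuous_on_subset[OF G] e] by auto
    have tp: "set_integrable lborel {0..2 * pi} (\<lambda>x. f x * of_real (p (cis x)))"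
       "(LBINT x:{0..2 * pi}. f x * of_real (p (cis x))) = 0"
      using integral_trig_poly_eq_0[OF f zero trig_poly_polynomial_function[OF p(1)]] by auto
    have contp: "continuous_on UNIV (\<lambda>x. p (cis x))"
      by (intro continuous_on_compose2[OF continuous_on_polymonial_function[OF p(1)[unfolded real_polynomial_function_eq]]] continuous_intros) auto
    obtain B where B: "\<forall>x\<in>{0..2 * pi}. norm (G (cis x)) \<le> B"
      using compact_imp_bounded[OF compact_continuous_image[OF continuous_on_subset[OF contG subset_UNIV] compact_Icc[of 0 "2*pi"]]]
      by (auto simp: bounded_iff)
    have iG: "set_integrable lborel {0..2 * pi} (\<lambda>x. f x * of_real (G (cis x)))"
      using B by (intro set_integrable_mult_bounded[OF f, of _ B] borel_measurable_continuous_onI continuous_intros contG) auto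
    have "(LBINT x:{0..2 * pi}. f x * of_real (G (cis x)))
      = (LBINT x:{0..2 * pi}. f x * of_real (G (cis x)) - f x * of_real (p (cis x)))"
      using set_integral_diff(2)[OF iG tp(1)] tp(2) by simp
    also have "cmod \<dots> \<le> (LBINT x:{0..2 * pi}. cmod (f x * of_real (G (cis x)) - f x * of_real (p (cis x))))"
      by (rule set_integral_norm_bound[OF set_integral_diff(1)[OF iG tp(1)]])
    also have "\<dots> \<le> (LBINT x:{0..2 * pi}. e * cmod (f x))"
    proof (rule set_integral_mono)
      show "set_integrable lborel {0..2 * pi} (\<lambda>x. cmod (f x * of_real (G (cis x)) - f x * of_real (p (cis x))))"
        by (rule set_integrable_norm[OF set_integral_diff(1)[OF iG tp(1)]])
      show "set_integrable lborel {0..2 * pi} (\<lambda>x. e * cmod (f x))" using intn by simp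
      fix x
      have "cmod (f x * of_real (G (cis x)) - f x * of_real (p (cis x))) = cmod (f x) * \<bar>G (cis x) - p (cis x)\<bar>"
        by (simp add: right_diff_distrib[symmetric] norm_mult of_real_diff[symmetric] del: of_real_diff)
      also have "\<dots> \<le> cmod (f x) * e" using p(2)[of "cis x"] by (intro mult_left_mono) auto
      finally show "cmod (f x * of_real (G (cis x)) - f x * of_real (p (cis x))) \<le> e * cmod (f x)" by (simp add: mult.commute)
    qed
    also have "\<dots> = e * M" by (simp add: M_def)
    finally show ?thesis .
  qed
  then have le: "cmod (LBINT x:{0..2 * pi}. f x * of_real (G (cis x))) \<le> e * (M + 1)" if "0 < e" for e
    using that mult_left_mono[of M "M + 1" e] by (meson less_imp_le less_add_one order_trans)
  have "cmod (LBINT x:{0..2 * pi}. f x * of_real (G (cis x))) \<le> e" if "0 < e" for e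
    using le[of "e / (M + 1)"] that M by simp
  then have "cmod (LBINT x:{0..2 * pi}. f x * of_real (G (cis x))) \<le> 0" by (meson field_le_epsilon add_0 order.refl le_less_linear dense_ge)
  then show ?thesis by simp
qed

text \<open>
  The continuous functions \<open>max 0 (1 - n dist(z, A))\<close> decrease to the indicator of the compact set \<open>A\<close>,
  the image of \<open>C \<inter> [0, 2\<pi>]\<close> on the circle.
\<close>

lemma integral_closed_eq_0:
  assumes f: "set_integrable lborel {0..2 * pi} f"
    and zero: "\<And>k. fourier_coeff f k = 0" and C: "closed C"
  shows "(LBINT x:C. indicator {0..2 * pi} x *\<^sub>R f x) = 0"
proof (cases "C \<inter> {0..2 * pi} = {}")
  case True
  then have z: "indicator C x *\<^sub>R (indicator {0..2 * pi} x *\<^sub>R f x) = 0" for x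
    by (auto simp: indicator_def)
  show ?thesis unfolding set_lebesgue_integral_def z by simp
next
  case False
  define K where "K = C \<inter> {0..2 * pi}"
  have K: "compact K" "K \<noteq> {}" "K \<subseteq> {0..2 * pi}"
    using False C by (auto simp: K_def intro: closed_Int_compact)
  define A where "A = cis ` K"
  have A: "compact A" "A \<noteq> {}" unfolding A_def using K
    by (auto intro!: compact_continuous_image continuous_intros)
  define G where "G n z = max 0 (1 - real n * infdist z A)" for n z
  have contG: "continuous_on UNIV (G n)" for n
    unfolding G_def by (intro continuous_intros)
  have "(\<lambda>n. LBINT x:{0..2 * pi}. f x * of_real (G n (cis x))) \<longlonglongrightarrow> (LBINT x:{0..2 * pi}. f x * of_real (indicator A (cis x)))"
    unfolding set_lebesgue_integral_def
  proof (rule integral_dominated_convergence)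
    have [measurable]: "(\<lambda>x. G n (cis x)) \<in> borel_measurable borel" for n
      by (intro borel_measurable_continuous_onI continuous_on_compose2[OF contG] continuous_intros) auto
    have [measurable]: "(\<lambda>x. indicator {0..2 * pi} x *\<^sub>R f x) \<in> borel_measurable lborel" using f unfolding set_integrable_def by auto
    have "(\<lambda>x. (indicator {0..2 * pi} x *\<^sub>R f x) * of_real (G n (cis x))) \<in> borel_measurable lborel" for n by measurable
    then show "(\<lambda>x. indicator {0..2 * pi} x *\<^sub>R (f x * of_real (G n (cis x)))) \<in> borel_measurable lborel" for n by simp
    have [measurable]: "A \<in> sets borel" using A by (auto intro: borel_compact)
    have [measurable]: "cis \<in> borel_measurable borel" by (intro borel_measurable_continuous_onI continuous_intros)
    have "(\<lambda>x. (indicator {0..2 * pi} x *\<^sub>R f x) * of_real (indicator A (cis x))) \<in> borel_measurable lborel" by measurable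
    then show "(\<lambda>x. indicator {0..2 * pi} x *\<^sub>R (f x * of_real (indicator A (cis x)))) \<in> borel_measurable lborel" by simp
    show "integrable lborel (\<lambda>x. cmod (indicator {0..2 * pi} x *\<^sub>R f x))" using f unfolding set_integrable_def by (rule integrable_norm)
    show "AE x in lborel. (\<lambda>n. indicator {0..2 * pi} x *\<^sub>R (f x * of_real (G n (cis x))))
        \<longlonglongrightarrow> indicator {0..2 * pi} x *\<^sub>R (f x * of_real (indicator A (cis x)))"
    proof (intro AE_I2 tendsto_intros)
      fix x
      show "(\<lambda>n. G n (cis x)) \<longlonglongrightarrow> indicator A (cis x)"
      proof (cases "cis x \<in> A")
        case True
        then show ?thesis by (simp add: G_def)
      next
        case False
        then have d: "0 < infdist (cis x) A"
          using A infdist_pos_not_in_closed[of A "cis x"] compact_imp_closed by auto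
        obtain n0 where n0: "1 < real n0 * infdist (cis x) A" using reals_Archimedean3[OF d] by blast
        have "\<forall>\<^sub>F n in sequentially. G n (cis x) = 0" using eventually_ge_at_top[of n0]
        proof eventually_elim
          case (elim n)
          then have "real n0 * infdist (cis x) A \<le> real n * infdist (cis x) A" using d by (intro mult_right_mono) auto
          then show ?case using n0 by (simp add: G_def)
        qed
        then show ?thesis using False by (simp add: tendsto_eventually)
      qed
    qed
    show "AE x in lborel. norm (indicator {0..2 * pi} x *\<^sub>R (f x * of_real (G n (cis x)))) \<le> cmod (indicator {0..2 * pi} x *\<^sub>R f x)" for n
    proof (rule AE_I2)
      fix x
      have "\<bar>G n (cis x)\<bar> \<le> 1" by (auto simp: G_def infdist_nonneg)
      then show "norm (indicator {0..2 * pi} x *\<^sub>R (f x * of_real (G n (cis x)))) \<le> cmod (indicator {0..2 * pi} x *\<^sub>R f x)"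
        by (simp add: norm_mult mult_left_le mult_left_mono)
    qed
  qed
  then have "(LBINT x:{0..2 * pi}. f x * of_real (indicator A (cis x))) = 0"
    using integral_continuous_circle_eq_0[OF f zero contG] by (simp add: LIMSEQ_const_iff)
  moreover have "(LBINT x:C. indicator {0..2 * pi} x *\<^sub>R f x) = (LBINT x:{0..2 * pi}. f x * of_real (indicator A (cis x)))"
    unfolding set_lebesgue_integral_def
  proof (rule integral_cong_AE)
    have [measurable]: "(\<lambda>x. indicator {0..2 * pi} x *\<^sub>R f x) \<in> borel_measurable lborel" using f unfolding set_integrable_def by auto
    have [measurable]: "A \<in> sets borel" "C \<in> sets borel" using A C by (auto intro: borel_compact)
    have [measurable]: "cis \<in> borel_measurable borel" by (intro borel_measurable_continuous_onI continuous_intros)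
    have "(\<lambda>x. (indicator {0..2 * pi} x *\<^sub>R f x) * of_real (indicator A (cis x))) \<in> borel_measurable lborel" by measurable
    then show "(\<lambda>x. indicator {0..2 * pi} x *\<^sub>R (f x * of_real (indicator A (cis x)))) \<in> borel_measurable lborel" by simp
    show "(\<lambda>x. indicator C x *\<^sub>R indicator {0..2 * pi} x *\<^sub>R f x) \<in> borel_measurable lborel" by measurable
    \<comment> \<open>The parametrization of the circle is injective once the two end points, which it identifies,
      are removed.\<close>
    have "AE x in lborel. x \<noteq> (0::real)" "AE x in lborel. x \<noteq> 2 * pi" by (auto intro: AE_lborel_singleton)
    then show "AE x in lborel. indicator C x *\<^sub>R indicator {0..2 * pi} x *\<^sub>R f x = indicator {0..2 * pi} x *\<^sub>R (f x * of_real (indicator A (cis x)))"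
    proof eventually_elim
      case (elim x)
      have "cis x \<in> A \<longleftrightarrow> x \<in> C" if x: "x \<in> {0..2 * pi}"
      proof
        assume "cis x \<in> A"
        then obtain y where y: "y \<in> K" "cis x = cis y" by (auto simp: A_def)
        then have "exp (\<i> * of_real x) = exp (\<i> * of_real y)" by (simp add: cis_conv_exp)
        then obtain n :: int where "\<i> * of_real x = \<i> * of_real y + (of_int (2 * n) * pi) * \<i>"
          unfolding exp_eq by auto
        then have "\<i> * of_real x = \<i> * of_real (y + of_int (2 * n) * pi)" by (simp add: algebra_simps)
        then have "(of_real x :: complex) = of_real (y + of_int (2 * n) * pi)" by (metis complex_i_not_zero mult_left_cancel)
        then have n: "x = y + of_int (2 * n) * pi" by (simp only: of_real_eq_iff)
        have "0 < x" "x < 2 * pi" "0 \<le> y" "y \<le> 2 * pi" using x elim y K by auto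
        then have "\<bar>of_int (2 * n) * pi\<bar> < 2 * pi" using n by linarith
        then have "\<bar>real_of_int n\<bar> * (2 * pi) < 1 * (2 * pi)" by (simp add: abs_mult)
        then have "\<bar>real_of_int n\<bar> < 1" by (rule mult_right_less_imp_less) simp
        then have "n = 0" by linarith
        then show "x \<in> C" using n y by (simp add: K_def)
      qed (use x in \<open>auto simp: A_def K_def\<close>)
      then show ?case by (auto simp: indicator_def)
    qed
  qed
  ultimately show ?thesis by simp
qed

text \<open>
  Closed sets generate the Borel sets and are stable under intersection, so all integrals of \<open>f\<close> over
  Borel subsets of \<open>[0, 2\<pi>]\<close> vanish.
\<close>

theorem fourier_coeffs_eq_0_imp_AE_0:
  assumes f: "set_integrable lborel {0..2 * pi} f" and zero: "\<And>k. fourier_coeff f k = 0"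
  shows "AE x in lborel. x \<in> {0..2 * pi} \<longrightarrow> f x = 0"
proof -
  define h where "h x = indicator {0..2 * pi} x *\<^sub>R f x" for x
  have h: "integrable lborel h" using f by (simp add: set_integrable_def h_def[abs_def])
  have hs: "set_integrable lborel A h" if "A \<in> sets borel" for A
    unfolding set_integrable_def using that h by (intro integrable_mult_indicator) auto
  have hU: "(LBINT x:UNIV. h x) = 0"
    unfolding h_def by (rule integral_closed_eq_0[OF f zero]) simp
  have "(LBINT x:A. h x) = 0" if "A \<in> sets borel" for A
  proof -
    have sets_eq: "sets borel = sigma_sets UNIV (Collect closed :: real set set)"
      unfolding borel_eq_closed by simp
    have 1: "Int_stable (Collect closed :: real set set)" by (auto simp: Int_stable_def)
    have 2: "Collect closed \<subseteq> Pow (UNIV :: real set)" by simp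
    have 3: "A \<in> sigma_sets UNIV (Collect closed)" using that sets_eq by simp
    from 1 2 3 show ?thesis
    proof (induction rule: sigma_sets_induct_disjoint)
      case (basic A)
      then show ?case unfolding h_def by (intro integral_closed_eq_0[OF f zero]) simp
    next
      case empty
      show ?case by (simp add: set_lebesgue_integral_def)
    next
      case (compl A)
      have A: "A \<in> sets borel" using compl sets_eq by simp
      have "(LBINT x:(UNIV - A) \<union> A. h x) = (LBINT x:UNIV - A. h x) + (LBINT x:A. h x)"
        using A by (intro set_integral_Un hs) auto
      then show ?case using hU compl by simp
    next
      case (union A)
      have A: "A i \<in> sets borel" for i using union sets_eq by auto
      have "(LBINT x:(\<Union>i. A i). h x) = (\<Sum>i. (LBINT x:A i. h x))"
        using A union(1) by (intro lebesgue_integral_countable_add hs) (auto simp: disjoint_family_on_def)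
      then show ?case using union by simp
    qed
  qed
  then have "AE x in lborel. h x = 0" by (intro sigma_finite_measure.density_zero[OF lborel.sigma_finite_measure_axioms] h) auto
  then show ?thesis by eventually_elim (auto simp: h_def)
qed

lemma AE_periodic:
  assumes per: "\<And>x. P (x + 2 * pi) \<longleftrightarrow> P x" and AE: "AE x in lborel. x \<in> {0..2 * pi} \<longrightarrow> P x"
  shows "AE x::real in lborel. P x"
proof -
  have per_int: "P (x + 2 * pi * of_int n) \<longleftrightarrow> P x" for x and n :: int
  proof (induction n rule: int_induct[where k = 0])
    case (step1 i)
    have "P (x + 2 * pi * of_int (i + 1)) \<longleftrightarrow> P ((x + 2 * pi * of_int i) + 2 * pi)" by (simp add: algebra_simps)
    then show ?case using per step1 by simp
  next
    case (step2 i)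
    have "P ((x + 2 * pi * of_int (i - 1)) + 2 * pi) \<longleftrightarrow> P (x + 2 * pi * of_int i)" by (simp add: algebra_simps)
    then show ?case using per step2 by simp
  qed simp
  have shift: "AE x in lborel. c + x \<in> {0..2 * pi} \<longrightarrow> P (c + x)" for c :: real
  proof -
    have "AE x in distr lborel borel ((+) c). x \<in> {0..2 * pi} \<longrightarrow> P x" using AE by (simp only: lborel_distr_plus)
    then show ?thesis by (rule AE_distrD[rotated]) simp
  qed
  have "AE x in lborel. \<forall>n::int. 2 * pi * of_int n + x \<in> {0..2 * pi} \<longrightarrow> P (2 * pi * of_int n + x)"
    unfolding AE_all_countable using shift by blast
  then show ?thesis
  proof eventually_elim
    case (elim x)
    define n where "n = - \<lfloor>x / (2 * pi)\<rfloor>"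
    have "of_int \<lfloor>x / (2 * pi)\<rfloor> \<le> x / (2 * pi)" "x / (2 * pi) < of_int \<lfloor>x / (2 * pi)\<rfloor> + 1" by linarith+
    then have "of_int \<lfloor>x / (2 * pi)\<rfloor> * (2 * pi) \<le> x" "x < (of_int \<lfloor>x / (2 * pi)\<rfloor> + 1) * (2 * pi)"
      by (simp_all only: pos_le_divide_eq pos_divide_less_eq pi_gt_zero zero_less_mult_iff zero_less_numeral simp_thms)
    then have "2 * pi * of_int n + x \<in> {0..2 * pi}" by (simp add: n_def algebra_simps)
    then have "P (2 * pi * of_int n + x)" using elim by blast
    then show ?case using per_int[of x n] by (simp add: add.commute)
  qed
qed

lemma fourier_coeff_diff:
  assumes "f \<in> L2_torus" "g \<in> L2_torus"
  shows "fourier_coeff (\<lambda>x. f x - g x) k = fourier_coeff f k - fourier_coeff g k"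
proof -
  have "set_integrable lborel {0..2 * pi} (\<lambda>x. f x * expi (- k) x)" if "f \<in> L2_torus" for f
    by (rule set_integrable_mult_bounded[OF L2_torus_integrable[OF that], of _ 1]) auto
  from set_integral_diff(2)[OF this[OF assms(1)] this[OF assms(2)]] show ?thesis
    unfolding fourier_coeff_expi left_diff_distrib by (simp only: right_diff_distrib)
qed

theorem fourier_coeffs_unique:
  assumes f: "f \<in> L2_torus" and g: "g \<in> L2_torus" and eq: "\<And>k. fourier_coeff f k = fourier_coeff g k"
  shows "ae_eq f g"
  unfolding ae_eq_def
proof (rule AE_periodic)
  show "(f (x + 2 * pi) = g (x + 2 * pi)) = (f x = g x)" for x using f g by (simp add: L2_torus_def)
  have "AE x in lborel. x \<in> {0..2 * pi} \<longrightarrow> f x - g x = 0"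
    by (rule fourier_coeffs_eq_0_imp_AE_0)
       (use fourier_coeff_diff[OF f g] eq set_integral_diff(1)[OF L2_torus_integrable[OF f] L2_torus_integrable[OF g]] in auto)
  then show "AE x in lborel. x \<in> {0..2 * pi} \<longrightarrow> f x = g x" by simp
qed

lemma set_integral_cong_ae_eq:
  fixes g :: "real \<Rightarrow> complex"
  assumes "ae_eq f g" "f \<in> borel_measurable borel" "g \<in> borel_measurable borel" "\<phi> \<in> borel_measurable borel"
  shows "(LBINT x:{a..b}. f x * \<phi> x) = (LBINT x:{a..b}. g x * \<phi> x)"
  unfolding set_lebesgue_integral_def
proof (rule integral_cong_AE)
  have [measurable]: "f \<in> borel_measurable borel" "g \<in> borel_measurable borel" "\<phi> \<in> borel_measurable borel" by fact+
  show "(\<lambda>x. indicator {a..b} x *\<^sub>R (f x * \<phi> x)) \<in> borel_measurable lborel"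
    "(\<lambda>x. indicator {a..b} x *\<^sub>R (g x * \<phi> x)) \<in> borel_measurable lborel" by measurable
  show "AE x in lborel. indicator {a..b} x *\<^sub>R (f x * \<phi> x) = indicator {a..b} x *\<^sub>R (g x * \<phi> x)"
    using assms(1) unfolding ae_eq_def by eventually_elim simp
qed

lemma fourier_coeff_ae_eq:
  assumes "ae_eq f g" "f \<in> borel_measurable borel" "g \<in> borel_measurable borel"
  shows "fourier_coeff f k = fourier_coeff g k"
  unfolding fourier_coeff_expi by (subst set_integral_cong_ae_eq[OF assms]) auto

subsection \<open>Absolutely convergent Fourier series\<close>

definition fourier_series :: "(nat \<Rightarrow> complex) \<Rightarrow> real \<Rightarrow> complex" where
  "fourier_series c x = (\<Sum>n. c n * expi (int n) x)"

lemma fourier_series_sums: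
  assumes "summable (\<lambda>n. cmod (c n))"
  shows "(\<lambda>n. c n * expi (int n) x) sums fourier_series c x"
  unfolding fourier_series_def
  by (rule summable_sums, rule summable_norm_cancel) (simp add: norm_mult assms)

lemma continuous_on_fourier_series:
  assumes "summable (\<lambda>n. cmod (c n))"
  shows "continuous_on UNIV (fourier_series c)"
proof (rule uniform_limit_theorem)
  show "uniform_limit UNIV (\<lambda>N x. \<Sum>n<N. c n * expi (int n) x) (fourier_series c) sequentially"
    unfolding fourier_series_def[abs_def]
    by (rule Weierstrass_m_test[OF _ assms]) (simp add: norm_mult)
qed (auto intro!: always_eventually continuous_intros)

text \<open>
  The series may be integrated term by term against any bounded Borel function.
\<close>

lemma fourier_series_integral:
  assumes c: "summable (\<lambda>n. cmod (c n))" and g: "g \<in> borel_measurable borel"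
    and B: "\<And>x. x \<in> {0..2 * pi} \<Longrightarrow> cmod (g x) \<le> B"
  shows "(\<lambda>n. c n * (LBINT x:{0..2 * pi}. expi (int n) x * g x)) sums (LBINT x:{0..2 * pi}. fourier_series c x * g x)"
proof -
  have g1: "set_integrable lborel {0..2 * pi} (\<lambda>x. 1 * g x)"
    by (rule set_integrable_mult_bounded[OF borel_integrable_atLeastAtMost' _ g B]) auto
  then have gi: "integrable lborel (\<lambda>x. indicator {0..2 * pi} x *\<^sub>R g x)" by (simp add: set_integrable_def)
  define F where "F n x = indicator {0..2 * pi} x *\<^sub>R (c n * expi (int n) x * g x)" for n x
  have normF: "norm (F n x) = cmod (c n) * cmod (indicator {0..2 * pi} x *\<^sub>R g x)" for n x
    by (simp add: F_def norm_mult)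
  have "(\<lambda>n. integral\<^sup>L lborel (F n)) sums (\<integral>x. (\<Sum>n. F n x) \<partial>lborel)"
  proof (rule sums_integral)
    show "integrable lborel (F n)" for n
    proof -
      have "set_integrable lborel {0..2 * pi} (\<lambda>x. c n * expi (int n) x * g x)"
        by (rule set_integrable_mult_bounded[OF borel_integrable_atLeastAtMost' _ g B]) (auto intro!: continuous_intros)
      then show ?thesis by (simp add: set_integrable_def F_def[abs_def])
    qed
    show "AE x in lborel. summable (\<lambda>n. norm (F n x))"
      unfolding normF by (intro AE_I2 summable_mult2 c)
    show "summable (\<lambda>n. \<integral>x. norm (F n x) \<partial>lborel)"
      unfolding normF by (simp add: summable_mult2 c)
  qed
  moreover have "integral\<^sup>L lborel (F n) = c n * (LBINT x:{0..2 * pi}. expi (int n) x * g x)" for n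
    unfolding F_def[abs_def] set_lebesgue_integral_def[symmetric] by (simp add: mult.assoc)
  moreover have "(\<Sum>n. F n x) = indicator {0..2 * pi} x *\<^sub>R (fourier_series c x * g x)" for x
  proof -
    have "(\<lambda>n. F n x) sums (indicator {0..2 * pi} x *\<^sub>R (fourier_series c x * g x))"
      unfolding F_def by (intro sums_scaleR_right sums_mult2 fourier_series_sums c)
    then show ?thesis by (rule sums_unique[symmetric])
  qed
  ultimately show ?thesis by (simp add: set_lebesgue_integral_def)
qed

lemma fourier_coeff_fourier_series:
  assumes c: "summable (\<lambda>n. cmod (c n))"
  shows "fourier_coeff (fourier_series c) k = (if 0 \<le> k then c (nat k) else 0)"
proof -
  have "(\<lambda>n. c n * (LBINT x:{0..2 * pi}. expi (int n) x * expi (- k) x))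
      sums (LBINT x:{0..2 * pi}. fourier_series c x * expi (- k) x)"
    by (rule fourier_series_integral[OF c, of _ 1]) auto
  moreover have "(LBINT x:{0..2 * pi}. expi (int n) x * expi (- k) x) = (if int n = k then 2 * of_real pi else 0)" for n
    using integral_expi[of "int n - k"] by (simp add: expi_add[symmetric])
  ultimately have *: "(\<lambda>n. c n * (if int n = k then 2 * of_real pi else 0))
      sums (LBINT x:{0..2 * pi}. fourier_series c x * expi (- k) x)" by simp
  have "(\<lambda>n. c n * (if int n = k then 2 * of_real pi else 0)) sums (if 0 \<le> k then c (nat k) * (2 * of_real pi) else 0)"
  proof (cases "0 \<le> k")
    case True
    have "(\<lambda>n. c n * (if int n = k then 2 * of_real pi else 0)) = (\<lambda>n. if n = nat k then c n * (2 * of_real pi) else 0)"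
    proof -
      have "int n = k \<longleftrightarrow> n = nat k" for n using True by auto
      then show ?thesis by (intro ext) simp
    qed
    then show ?thesis using sums_single[of "nat k" "\<lambda>n. c n * (2 * of_real pi)"] True by simp
  next
    case False
    then have "(\<lambda>n. c n * (if int n = k then 2 * of_real pi else 0)) = (\<lambda>n. 0)" by auto
    then show ?thesis using False by simp
  qed
  then have "(LBINT x:{0..2 * pi}. fourier_series c x * expi (- k) x) = (if 0 \<le> k then c (nat k) * (2 * of_real pi) else 0)"
    using * sums_unique2 by blast
  then show ?thesis by (simp add: fourier_coeff_expi)
qed

lemma fourier_series_L2:
  assumes c: "summable (\<lambda>n. cmod (c n))"
  shows "fourier_series c \<in> L2_torus"
  unfolding L2_torus_def
proof (intro CollectI conjI allI)
  show "fourier_series c (x + 2 * pi) = fourier_series c x" for x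
    by (simp add: fourier_series_def expi_periodic)
  show "fourier_series c \<in> borel_measurable borel"
    by (intro borel_measurable_continuous_onI continuous_on_fourier_series c)
  show "set_integrable lborel {0..2 * pi} (\<lambda>x. (cmod (fourier_series c x))\<^sup>2)"
    by (intro borel_integrable_atLeastAtMost' continuous_intros continuous_on_subset[OF continuous_on_fourier_series[OF c]]) auto
qed

text \<open>
  For absolutely summable coefficients the series itself witnesses the existence of the projection,
  and its uniqueness almost everywhere follows from that of the Fourier coefficients.
\<close>

lemma proj_pos_eq_fourier_series:
  assumes c: "summable (\<lambda>n. cmod (c n))" "c 0 = 0" and f: "\<And>k. 1 \<le> k \<Longrightarrow> fourier_coeff f (int k) = c k"
  shows "proj_pos f \<in> L2_torus" "ae_eq (proj_pos f) (fourier_series c)"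
    "\<And>k. fourier_coeff (proj_pos f) k = (if 1 \<le> k then c (nat k) else 0)"
proof -
  define P where "P g \<longleftrightarrow> g \<in> L2_torus \<and> (\<forall>k::int. fourier_coeff g k = (if 1 \<le> k then fourier_coeff f k else 0))" for g
  have coeff: "(if 1 \<le> k then fourier_coeff f k else 0) = (if 0 \<le> k then c (nat k) else 0)" for k
    using f[of "nat k"] c(2) by (cases "k = 0") auto
  have "P (fourier_series c)"
    unfolding P_def coeff using fourier_series_L2[OF c(1)] fourier_coeff_fourier_series[OF c(1)] by simp
  then have P: "P (proj_pos f)" unfolding proj_pos_def P_def[symmetric] by (rule someI[of P])
  then show L2: "proj_pos f \<in> L2_torus" by (simp add: P_def)
  show "fourier_coeff (proj_pos f) k = (if 1 \<le> k then c (nat k) else 0)" for k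
    using P f[of "nat k"] by (auto simp: P_def)
  show "ae_eq (proj_pos f) (fourier_series c)"
    using P coeff fourier_coeff_fourier_series[OF c(1)]
    by (intro fourier_coeffs_unique L2 fourier_series_L2 c) (simp add: P_def)
qed

section \<open>Fourier coefficients of the cubic term\<close>

abbreviation cubic_kernel :: "(real \<Rightarrow> complex) \<Rightarrow> real \<Rightarrow> real \<Rightarrow> complex" where
  "cubic_kernel u x y \<equiv> of_real ((cmod (u x - u y))\<^sup>2) * (u x - u y) / of_real (1 - cos (x - y))"

text \<open>
  The function under the projector in \<open>cubic_term\<close>.
\<close>

definition cubic_density :: "real \<Rightarrow> (real \<Rightarrow> complex) \<Rightarrow> real \<Rightarrow> complex" where
  "cubic_density \<sigma> u x = 1 / (4 * of_real pi) *
       (LBINT y:{0..2 * pi}.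
          cubic_kernel u x y)
     - of_real \<sigma> * of_real ((cmod (u x))\<^sup>2) * u x"

lemma cubic_term_eq: "cubic_term \<sigma> u = proj_pos (cubic_density \<sigma> u)"
  unfolding cubic_term_def cubic_density_def[abs_def] ..

lemma expi_power: "expi (int n) x = expi 1 x ^ n"
  by (simp add: expi_def exp_of_nat_mult[symmetric] mult_ac)

lemma expi_minus: "expi (- k) x = cnj (expi k x)"
  by (simp add: expi_def exp_cnj)

lemma expi_diff_arg: "expi k (y - x) = expi k y * expi (- k) x"
  by (simp add: expi_def exp_add[symmetric] algebra_simps)

lemma expi_mult_cnj [simp]: "expi k x * cnj (expi k x) = 1" "cnj (expi k x) * expi k x = 1"
  by (simp_all add: expi_minus[symmetric] expi_add[symmetric])

lemma one_minus_expi_mult_cnj: "(1 - expi 1 (y - x)) * cnj (1 - expi 1 (y - x)) = of_real (2 * (1 - cos (x - y)))"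
proof -
  have "expi 1 (y - x) = cis (y - x)" by (simp add: expi_def cis_conv_exp)
  moreover have "cos (y - x) = cos (x - y)" by (metis cos_minus minus_diff_eq)
  moreover have "(cos t)\<^sup>2 + (sin t)\<^sup>2 = 1" for t :: real by simp
  ultimately show ?thesis
    by (simp add: complex_eq_iff algebra_simps power2_eq_square)
qed

lemma expi_diff: "expi k x - expi k y = expi k x * (1 - expi k (y - x))"
  by (simp add: expi_diff_arg expi_minus algebra_simps)

lemma one_minus_expi_nat: "1 - expi (int n) z = (1 - expi 1 z) * (\<Sum>j<n. expi (int j) z)"
  unfolding expi_power[of n] expi_power by (rule one_diff_power_eq)

text \<open>
  The singular kernel applied to three exponentials, with both factors \<open>1 - e\<^sup>\<plusminus>\<^sup>i\<^sup>(\<^sup>y\<^sup>-\<^sup>x\<^sup>)\<close> of the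
  denominator cancelled against geometric sums.
\<close>

definition resonance_kernel :: "nat \<Rightarrow> nat \<Rightarrow> nat \<Rightarrow> real \<Rightarrow> real \<Rightarrow> complex" where
  "resonance_kernel p q r x y = 2 * expi (int p - int q + int r) x *
     (\<Sum>j<p. \<Sum>l<q. expi (int j - int l) (y - x) - expi (int j + int r - int l) (y - x))"

lemma resonance_kernel_eq:
  assumes "cos (x - y) \<noteq> 1"
  shows "(expi (int p) x - expi (int p) y) * cnj (expi (int q) x - expi (int q) y) * (expi (int r) x - expi (int r) y)
     / of_real (1 - cos (x - y)) = resonance_kernel p q r x y"
proof -
  define z where "z = y - x"
  define S where "S n = (\<Sum>j<n. expi (int j) z)" for n
  have c: "of_real (1 - cos (x - y)) \<noteq> (0::complex)" using assms by simp
  have "(expi (int p) x - expi (int p) y) * cnj (expi (int q) x - expi (int q) y) * (expi (int r) x - expi (int r) y)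
    = expi (int p) x * cnj (expi (int q) x) * expi (int r) x * ((1 - expi 1 z) * cnj (1 - expi 1 z)) * (S p * cnj (S q) * (1 - expi (int r) z))"
    unfolding expi_diff one_minus_expi_nat[of p] one_minus_expi_nat[of q] z_def[symmetric] S_def[symmetric]
    by (simp add: mult_ac)
  also have "(1 - expi 1 z) * cnj (1 - expi 1 z) = 2 * of_real (1 - cos (x - y))"
    unfolding z_def one_minus_expi_mult_cnj by simp
  also have "expi (int p) x * cnj (expi (int q) x) * expi (int r) x = expi (int p - int q + int r) x"
    by (simp add: expi_minus[symmetric] expi_add[symmetric])
  also have "S p * cnj (S q) * (1 - expi (int r) z)
     = (\<Sum>j<p. \<Sum>l<q. expi (int j - int l) z - expi (int j + int r - int l) z)"
  proof -
    have "expi (int j) z * cnj (expi (int l) z) * (1 - expi (int r) z)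
       = expi (int j - int l) z - expi (int j + int r - int l) z" for j l
    proof -
      have "expi (int j) z * cnj (expi (int l) z) = expi (int j - int l) z"
        by (simp add: expi_minus[symmetric] expi_add[symmetric])
      moreover have "expi (int j - int l) z * expi (int r) z = expi (int j + int r - int l) z"
        by (simp add: expi_add[symmetric] algebra_simps)
      ultimately show ?thesis by (simp add: right_diff_distrib)
    qed
    then show ?thesis unfolding S_def cnj_sum sum_product unfolding sum_distrib_right by simp
  qed
  finally have e: "(expi (int p) x - expi (int p) y) * cnj (expi (int q) x - expi (int q) y) * (expi (int r) x - expi (int r) y)
    = expi (int p - int q + int r) x * (2 * of_real (1 - cos (x - y))) *
      (\<Sum>j<p. \<Sum>l<q. expi (int j - int l) z - expi (int j + int r - int l) z)" .
  have cancel: "E * (2 * C) * S / C = 2 * E * S" if "C \<noteq> 0" for C E S :: complex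
    using that by simp
  show ?thesis
    unfolding e resonance_kernel_def z_def[symmetric] by (rule cancel[OF c])
qed

lemma continuous_on_expi_comp [continuous_intros]:
  "continuous_on S f \<Longrightarrow> continuous_on S (\<lambda>x. expi k (f x))"
  by (rule continuous_on_compose2[OF continuous_on_expi[of UNIV k]]) auto

lemma continuous_on_resonance_kernel: "continuous_on S (resonance_kernel p q r x)"
  unfolding resonance_kernel_def[abs_def] by (intro continuous_intros)

lemma set_integral_sum:
  fixes f :: "'i \<Rightarrow> real \<Rightarrow> complex"
  assumes "\<And>i. i \<in> I \<Longrightarrow> set_integrable lborel S (f i)"
  shows "(LBINT x:S. \<Sum>i\<in>I. f i x) = (\<Sum>i\<in>I. LBINT x:S. f i x)"
  using assms unfolding set_lebesgue_integral_def set_integrable_def scaleR_sum_right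
  by (rule Bochner_Integration.integral_sum)

lemma set_integrable_continuous:
  fixes f :: "real \<Rightarrow> complex"
  shows "continuous_on UNIV f \<Longrightarrow> set_integrable lborel {a..b} f"
  by (intro borel_integrable_atLeastAtMost') (auto intro: continuous_on_subset)

lemma integral_expi_shift: "(LBINT y:{0..2 * pi}. expi k (y - x)) = (if k = 0 then 2 * of_real pi else 0)"
proof -
  have "(LBINT y:{0..2 * pi}. expi k (y - x)) = expi (- k) x * (LBINT y:{0..2 * pi}. expi k y)"
    unfolding expi_diff_arg by (simp add: mult.commute)
  then show ?thesis by (simp add: integral_expi)
qed

text \<open>
  The subtraction on the right is truncated, as it should be: for \<open>q \<le> r\<close> there are no such pairs.
\<close>

lemma count_shifted_pairs:
  "(\<Sum>j<p. \<Sum>l<q. if j + r = l then 1 else (0::complex)) = of_nat (min p (q - r))"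
proof -
  have "(\<Sum>j<p. \<Sum>l<q. if j + r = l then 1 else (0::complex)) = (\<Sum>j<p. if j + r < q then 1 else 0)"
    by (intro sum.cong refl) (simp add: sum.delta')
  also have "\<dots> = of_nat (card ({..<p} \<inter> {j. j + r < q}))"
    by (simp add: sum.If_cases)
  also have "{..<p} \<inter> {j. j + r < q} = {..<min p (q - r)}" by auto
  finally show ?thesis by simp
qed

lemma integral_resonance_kernel:
  "(LBINT y:{0..2 * pi}. resonance_kernel p q r x y)
     = 4 * of_real pi * (of_nat (min p q) - of_nat (min p (q - r))) * expi (int p - int q + int r) x"
proof -
  have ci: "set_integrable lborel {0..2 * pi} (\<lambda>y. expi k (y - x))" for k
    by (intro set_integrable_continuous continuous_intros)
  have "(LBINT y:{0..2 * pi}. resonance_kernel p q r x y) = 2 * expi (int p - int q + int r) x *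
     (\<Sum>j<p. \<Sum>l<q. (LBINT y:{0..2 * pi}. expi (int j - int l) (y - x)) - (LBINT y:{0..2 * pi}. expi (int j + int r - int l) (y - x)))"
    unfolding resonance_kernel_def set_integral_mult_right
    by (subst set_integral_sum; (intro set_integrable_continuous continuous_intros)?)
       (simp add: set_integral_sum set_integral_diff ci set_integrable_continuous continuous_intros)
  also have "\<dots> = 2 * expi (int p - int q + int r) x * (2 * of_real pi *
     ((\<Sum>j<p. \<Sum>l<q. if j + 0 = l then 1 else 0) - (\<Sum>j<p. \<Sum>l<q. if j + r = l then 1 else 0)))"
    unfolding integral_expi_shift sum_subtractf[symmetric] sum_distrib_left
    by (intro sum.cong refl) (auto simp: algebra_simps)
  also have "\<dots> = 4 * of_real pi * (of_nat (min p q) - of_nat (min p (q - r))) * expi (int p - int q + int r) x"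
    unfolding count_shifted_pairs by simp
  finally show ?thesis .
qed

lemma AE_cos_neq_1:
  fixes x :: real
  shows "AE y in lborel. cos (x - y) \<noteq> 1"
proof (rule AE_I')
  have "{y. cos (x - y) = 1} \<subseteq> range (\<lambda>n::int. x - real_of_int n * 2 * pi)"
  proof
    fix y assume "y \<in> {y. cos (x - y) = 1}"
    then obtain n :: int where "x - y = real_of_int n * 2 * pi" using cos_one_2pi_int by auto
    then have "y = x - real_of_int n * 2 * pi" by simp
    then show "y \<in> range (\<lambda>n::int. x - real_of_int n * 2 * pi)" by blast
  qed
  then show "{y \<in> space lborel. \<not> cos (x - y) \<noteq> 1} \<subseteq> range (\<lambda>n::int. x - real_of_int n * 2 * pi)" by auto
  show "range (\<lambda>n::int. x - real_of_int n * 2 * pi) \<in> null_sets lborel"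
    by (intro countable_imp_null_set_lborel) simp
qed

subsection \<open>Trigonometric polynomials\<close>

definition partial_series :: "(nat \<Rightarrow> complex) \<Rightarrow> nat \<Rightarrow> real \<Rightarrow> complex" where
  "partial_series c N x = (\<Sum>n\<in>{1..N}. c n * expi (int n) x)"

lemma continuous_on_partial_series [continuous_intros]: "continuous_on S (partial_series c N)"
  unfolding partial_series_def[abs_def] by (intro continuous_intros)

lemma triple_product_sum:
  fixes f g h :: "nat \<Rightarrow> complex"
  shows "sum f A * sum g A * sum h A = (\<Sum>(p, q, r)\<in>A \<times> A \<times> A. f p * g q * h r)"
  by (simp add: sum.cartesian_product[symmetric] sum_distrib_left[symmetric] sum_distrib_right[symmetric])

lemma cubic_density_partial_series:
  "cubic_density \<sigma> (partial_series c N) x =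
    (\<Sum>(p, q, r)\<in>{1..N} \<times> {1..N} \<times> {1..N}.
       (of_nat (min p q) - of_nat (min p (q - r)) - of_real \<sigma>) * (c p * cnj (c q) * c r) * expi (int p - int q + int r) x)"
proof -
  define u where "u = partial_series c N"
  define I where "I = {1..N} \<times> {1..N} \<times> {1..N}"
  have cube: "of_real ((cmod z)\<^sup>2) * z = z * cnj z * z" for z
    by (simp only: complex_norm_square mult.commute mult.left_commute)
  have ud: "u x - u y = (\<Sum>n\<in>{1..N}. c n * (expi (int n) x - expi (int n) y))" for y
    by (simp add: u_def partial_series_def sum_subtractf[symmetric] right_diff_distrib)
  have int: "cubic_kernel u x y
     = (\<Sum>(p, q, r)\<in>I. c p * cnj (c q) * c r * resonance_kernel p q r x y)" if "cos (x - y) \<noteq> 1" for y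
  proof -
    have "of_real ((cmod (u x - u y))\<^sup>2) * (u x - u y) = (\<Sum>(p, q, r)\<in>I. (c p * (expi (int p) x - expi (int p) y)) *
        (cnj (c q * (expi (int q) x - expi (int q) y))) * (c r * (expi (int r) x - expi (int r) y)))"
      unfolding cube unfolding ud cnj_sum triple_product_sum I_def ..
    then show ?thesis
      by (simp add: sum_divide_distrib case_prod_unfold resonance_kernel_eq[OF that, symmetric] mult_ac)
  qed
  have cont_u: "continuous_on S u" for S unfolding u_def by (rule continuous_on_partial_series)
  have mu [measurable]: "u \<in> borel_measurable borel" by (intro borel_measurable_continuous_onI cont_u)
  have "(LBINT y:{0..2 * pi}. cubic_kernel u x y)
     = (LBINT y:{0..2 * pi}. \<Sum>(p, q, r)\<in>I. c p * cnj (c q) * c r * resonance_kernel p q r x y)"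
    unfolding set_lebesgue_integral_def
  proof (rule integral_cong_AE)
    have [measurable]: "(\<lambda>y. \<Sum>(p, q, r)\<in>I. c p * cnj (c q) * c r * resonance_kernel p q r x y) \<in> borel_measurable borel"
      unfolding case_prod_unfold by (intro borel_measurable_continuous_onI continuous_intros continuous_on_resonance_kernel)
    show "(\<lambda>y. indicator {0..2 * pi} y *\<^sub>R (\<Sum>(p, q, r)\<in>I. c p * cnj (c q) * c r * resonance_kernel p q r x y)) \<in> borel_measurable lborel"
      by measurable
    show "(\<lambda>y. indicator {0..2 * pi} y *\<^sub>R (cubic_kernel u x y)) \<in> borel_measurable lborel"
      by measurable
    show "AE y in lborel. indicator {0..2 * pi} y *\<^sub>R (cubic_kernel u x y)
       = indicator {0..2 * pi} y *\<^sub>R (\<Sum>(p, q, r)\<in>I. c p * cnj (c q) * c r * resonance_kernel p q r x y)"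
      using AE_cos_neq_1[of x] by eventually_elim (rule arg_cong[OF int])
  qed
  also have "\<dots> = (\<Sum>(p, q, r)\<in>I. c p * cnj (c q) * c r * (LBINT y:{0..2 * pi}. resonance_kernel p q r x y))"
    by (simp add: case_prod_unfold set_integral_sum set_integrable_continuous continuous_on_resonance_kernel)
  finally have 0: "(LBINT y:{0..2 * pi}. cubic_kernel u x y)
    = (\<Sum>(p, q, r)\<in>I. c p * cnj (c q) * c r * (LBINT y:{0..2 * pi}. resonance_kernel p q r x y))" .
  have 1: "1 / (4 * of_real pi) * (LBINT y:{0..2 * pi}. cubic_kernel u x y)
    = (\<Sum>(p, q, r)\<in>I. (of_nat (min p q) - of_nat (min p (q - r))) * (c p * cnj (c q) * c r) * expi (int p - int q + int r) x)"
    unfolding 0 integral_resonance_kernel sum_distrib_left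
    by (intro sum.cong refl) (auto simp: field_simps)
  have "of_real ((cmod (u x))\<^sup>2) * u x = (\<Sum>(p, q, r)\<in>I. (c p * expi (int p) x) * cnj (c q * expi (int q) x) * (c r * expi (int r) x))"
    unfolding cube unfolding u_def partial_series_def cnj_sum triple_product_sum I_def ..
  also have "\<dots> = (\<Sum>(p, q, r)\<in>I. (c p * cnj (c q) * c r) * expi (int p - int q + int r) x)"
  proof (intro sum.cong refl, clarify)
    fix p q r
    have "expi (int p - int q + int r) x = expi (int p) x * cnj (expi (int q) x) * expi (int r) x"
      by (simp add: expi_minus[symmetric] expi_add[symmetric])
    then show "(c p * expi (int p) x) * cnj (c q * expi (int q) x) * (c r * expi (int r) x)
      = (c p * cnj (c q) * c r) * expi (int p - int q + int r) x" by (simp add: mult_ac)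
  qed
  finally have 2: "of_real \<sigma> * of_real ((cmod (u x))\<^sup>2) * u x
    = (\<Sum>(p, q, r)\<in>I. of_real \<sigma> * ((c p * cnj (c q) * c r) * expi (int p - int q + int r) x))"
    by (simp add: mult.assoc sum_distrib_left case_prod_unfold)
  show ?thesis
    unfolding cubic_density_def u_def[symmetric] 1 2 I_def[symmetric] sum_subtractf[symmetric]
    by (intro sum.cong refl) (auto simp: algebra_simps)
qed

text \<open>
  If \<open>q \<ge> r\<close> then \<open>q - r = p - k < p\<close>, and otherwise \<open>p < k\<close> and nothing is subtracted; in both cases the number of
  surviving pairs is the smallest frequency.  The hypothesis \<open>1 \<le> k\<close> reflects the projector.
\<close>

lemma coupling_eq_count:
  assumes "p + r = q + k" "1 \<le> k"
  shows "of_nat (min p q) - of_nat (min p (q - r)) - of_real \<sigma> = (of_real (coupling \<sigma> p q r k) :: complex)"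
proof -
  have "min p q = min (min p q) (min r k) + min p (q - r)" using assms by (auto simp: min_def)
  then have "of_nat (min p q) = (of_nat (min (min p q) (min r k)) + of_nat (min p (q - r)) :: complex)"
    by (metis of_nat_add)
  then show ?thesis by (simp add: coupling_def)
qed

lemma fourier_coeff_cubic_density_partial_series:
  assumes k: "1 \<le> k"
  shows "fourier_coeff (cubic_density \<sigma> (partial_series c N)) (int k) = cubic \<sigma> N c k"
proof -
  define I where "I = {1..N} \<times> {1..N} \<times> {1..N}"
  define D where "D p q r = (of_nat (min p q) - of_nat (min p (q - r)) - of_real \<sigma>) * (c p * cnj (c q) * c r)" for p q r
  have "(LBINT x:{0..2 * pi}. cubic_density \<sigma> (partial_series c N) x * expi (- int k) x)
    = (LBINT x:{0..2 * pi}. \<Sum>(p, q, r)\<in>I. D p q r * expi (int p - int q + int r - int k) x)"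
    unfolding cubic_density_partial_series I_def[symmetric] D_def[symmetric] sum_distrib_right
    by (intro arg_cong[where f = "set_lebesgue_integral _ _"] ext sum.cong refl)
       (auto simp: expi_add[symmetric] mult.assoc)
  also have "\<dots> = (\<Sum>(p, q, r)\<in>I. D p q r * (LBINT x:{0..2 * pi}. expi (int p - int q + int r - int k) x))"
    by (simp add: case_prod_unfold set_integral_sum set_integrable_continuous continuous_on_expi)
  also have "\<dots> = (\<Sum>(p, q, r)\<in>I. if p + r = q + k then 2 * of_real pi * D p q r else 0)"
    unfolding integral_expi by (intro sum.cong refl) auto
  also have "\<dots> = (\<Sum>(p, q, r)\<in>triads N k. 2 * of_real pi * D p q r)"
    by (intro sum.mono_neutral_cong_right) (auto simp: I_def triads_def split: if_splits)
  also have "\<dots> = 2 * of_real pi * cubic \<sigma> N c k"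
    unfolding trilinear_def sum_distrib_left
  proof (intro sum.cong refl, clarify)
    fix p q r assume "(p, q, r) \<in> triads N k"
    then have "p + r = q + k" by (simp add: triads_def)
    from coupling_eq_count[OF this k, of \<sigma>] show "2 * of_real pi * D p q r
      = 2 * of_real pi * (of_real (coupling \<sigma> p q r k) * (c p * cnj (c q) * c r))" by (simp add: D_def)
  qed
  finally show ?thesis by (simp add: fourier_coeff_expi)
qed

subsection \<open>Passage to the limit\<close>

lemma norm_one_minus_expi_le: "cmod (1 - expi (int n) z) \<le> real n * cmod (1 - expi 1 z)"
proof -
  have "cmod (\<Sum>j<n. expi (int j) z) \<le> (\<Sum>j<n. 1)" by (rule sum_norm_le) simp
  then have "cmod (1 - expi 1 z) * cmod (\<Sum>j<n. expi (int j) z) \<le> cmod (1 - expi 1 z) * real n"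
    by (intro mult_left_mono) auto
  then show ?thesis by (simp add: one_minus_expi_nat norm_mult mult.commute)
qed

text \<open>
  The numerator is of third order in \<open>|1 - e\<^sup>i\<^sup>(\<^sup>y\<^sup>-\<^sup>x\<^sup>)| \<le> 2\<close> and the denominator is half of its square.
\<close>

lemma integrand_bound:
  assumes d: "cmod d \<le> A * cmod (1 - expi 1 (y - x))" and A: "0 \<le> A"
  shows "cmod (of_real ((cmod d)\<^sup>2) * d / of_real (1 - cos (x - y))) \<le> 4 * A ^ 3"
proof (cases "cos (x - y) = 1")
  case True
  then show ?thesis using A by simp
next
  case False
  define w where "w = cmod (1 - expi 1 (y - x))"
  have w2: "w\<^sup>2 = 2 * (1 - cos (x - y))"
  proof -
    have "of_real (w\<^sup>2) = (of_real (2 * (1 - cos (x - y))) :: complex)"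
      unfolding w_def complex_norm_square one_minus_expi_mult_cnj ..
    then show ?thesis by (simp only: of_real_eq_iff)
  qed
  have "cos (x - y) < 1" using False cos_le_one[of "x - y"] by linarith
  then have w: "0 < w" using w2 by (cases "w = 0") (auto simp: w_def)
  have "w \<le> 1 + 1" unfolding w_def by (rule order_trans[OF norm_triangle_ineq4]) simp
  have "cmod (of_real ((cmod d)\<^sup>2) * d / of_real (1 - cos (x - y))) = cmod d ^ 3 / (1 - cos (x - y))"
    using \<open>cos (x - y) < 1\<close> unfolding norm_divide norm_mult norm_of_real by (simp add: power3_eq_cube power2_eq_square)
  also have "\<dots> = cmod d ^ 3 / (w\<^sup>2 / 2)"
  proof -
    have "1 - cos (x - y) = w\<^sup>2 / 2" using w2 by simp
    then show ?thesis by (simp only:)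
  qed
  also have "\<dots> \<le> (A * w) ^ 3 / (w\<^sup>2 / 2)"
    using d w unfolding w_def by (intro divide_right_mono power_mono) auto
  also have "\<dots> = 2 * A ^ 3 * w" using w by (simp add: power3_eq_cube power2_eq_square)
  also have "\<dots> \<le> 2 * A ^ 3 * 2" using \<open>w \<le> 1 + 1\<close> A by (intro mult_left_mono) auto
  finally show ?thesis by simp
qed

lemma norm_set_integral_le_const:
  fixes f :: "real \<Rightarrow> complex"
  assumes "\<And>y. y \<in> {a..b} \<Longrightarrow> cmod (f y) \<le> B" "0 \<le> B" "a \<le> b"
  shows "cmod (LBINT y:{a..b}. f y) \<le> B * (b - a)"
proof -
  have "cmod (LBINT y:{a..b}. f y) \<le> (\<integral>y. cmod (indicator {a..b} y *\<^sub>R f y) \<partial>lborel)"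
    unfolding set_lebesgue_integral_def by (rule integral_norm_bound)
  also have "\<dots> \<le> (\<integral>y. indicator {a..b} y *\<^sub>R B \<partial>lborel)"
  proof (rule integral_mono')
    show "integrable lborel (\<lambda>y. indicator {a..b} y *\<^sub>R B)"
      using borel_integrable_atLeastAtMost'[of a b "\<lambda>_. B"] by (simp add: set_integrable_def)
  qed (use assms in \<open>auto simp: indicator_def\<close>)
  also have "\<dots> = B * (b - a)" using assms(3) by simp
  finally show ?thesis .
qed

lemma borel_measurable_cubic_density:
  assumes [measurable]: "u \<in> borel_measurable borel"
  shows "cubic_density \<sigma> u \<in> borel_measurable borel"
  unfolding cubic_density_def[abs_def] set_lebesgue_integral_def by measurable

lemma cubic_density_ae_eq:
  assumes [measurable]: "u \<in> borel_measurable borel" "v \<in> borel_measurable borel" and eq: "ae_eq u v"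
  shows "ae_eq (cubic_density \<sigma> u) (cubic_density \<sigma> v)"
  unfolding ae_eq_def using eq[unfolded ae_eq_def]
proof eventually_elim
  case (elim x)
  have "(LBINT y:{0..2 * pi}. cubic_kernel u x y)
     = (LBINT y:{0..2 * pi}. cubic_kernel v x y)"
    unfolding set_lebesgue_integral_def
  proof (rule integral_cong_AE)
    show "AE y in lborel. indicator {0..2 * pi} y *\<^sub>R (cubic_kernel u x y)
      = indicator {0..2 * pi} y *\<^sub>R (cubic_kernel v x y)"
      using eq[unfolded ae_eq_def] by eventually_elim (simp only: elim)
  qed measurable
  then show ?case by (simp only: cubic_density_def elim)
qed

lemma summable_of_wiener:
  assumes "summable (\<lambda>n. real n * cmod (c n))"
  shows "summable (\<lambda>n. cmod (c n))"
proof (rule summable_comparison_test'[OF assms, of 1])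
  fix n :: nat assume "1 \<le> n"
  then have "1 * cmod (c n) \<le> real n * cmod (c n)" by (intro mult_right_mono) auto
  then show "norm (cmod (c n)) \<le> real n * cmod (c n)" by simp
qed

text \<open>
  Dominated convergence is used twice along the partial sums, for the inner integral and for the
  Fourier coefficient.  Both dominating constants come from the Lipschitz constant \<open>A = \<Sum> n |c\<^sub>n|\<close>, which
  bounds all partial sums.
\<close>

theorem fourier_coeff_cubic_density:
  assumes c: "summable (\<lambda>n. real n * cmod (c n))" and c0: "c 0 = 0" and k: "1 \<le> k"
  shows "fourier_coeff (cubic_density \<sigma> (fourier_series c)) (int k) = cubic_limit \<sigma> c k"
proof -
  define A where "A = (\<Sum>n. real n * cmod (c n))"
  define u where "u = fourier_series c"
  define U where "U = partial_series c"
  have A: "0 \<le> A" unfolding A_def by (intro suminf_nonneg c) auto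
  have sumA: "(\<Sum>n\<in>{1..N}. real n * cmod (c n)) \<le> A" for N
    unfolding A_def by (intro sum_le_suminf c) auto
  have lim: "(\<lambda>N. U N x) \<longlonglongrightarrow> u x" for x
  proof -
    have "U N x = (\<Sum>n<Suc N. c n * expi (int n) x)" for N
    proof -
      have "{..<Suc N} = insert 0 {1..N}" by auto
      then show ?thesis by (simp add: U_def partial_series_def c0)
    qed
    then show ?thesis
      using LIMSEQ_Suc[OF fourier_series_sums[OF summable_of_wiener[OF c], unfolded sums_def, of x]] by (simp add: u_def)
  qed
  have diffU: "cmod (U N x - U N y) \<le> A * cmod (1 - expi 1 (y - x))" for N x y
  proof -
    have "U N x - U N y = (\<Sum>n\<in>{1..N}. c n * (expi (int n) x * (1 - expi (int n) (y - x))))"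
      by (simp add: U_def partial_series_def sum_subtractf[symmetric] right_diff_distrib[symmetric] expi_diff[symmetric])
    also have "cmod \<dots> \<le> (\<Sum>n\<in>{1..N}. real n * cmod (c n) * cmod (1 - expi 1 (y - x)))"
    proof (rule sum_norm_le)
      fix n
      have "cmod (c n) * cmod (1 - expi (int n) (y - x)) \<le> cmod (c n) * (real n * cmod (1 - expi 1 (y - x)))"
        by (intro mult_left_mono norm_one_minus_expi_le) auto
      then show "cmod (c n * (expi (int n) x * (1 - expi (int n) (y - x)))) \<le> real n * cmod (c n) * cmod (1 - expi 1 (y - x))"
        by (simp add: norm_mult mult_ac)
    qed
    also have "\<dots> \<le> A * cmod (1 - expi 1 (y - x))"
      unfolding sum_distrib_right[symmetric] by (intro mult_right_mono sumA) auto
    finally show ?thesis .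
  qed
  have normU: "cmod (U N x) \<le> A" for N x
  proof -
    have "cmod (U N x) \<le> (\<Sum>n\<in>{1..N}. real n * cmod (c n))"
      unfolding U_def partial_series_def
    proof (rule sum_norm_le)
      fix n assume "n \<in> {1..N}"
      then have "1 * cmod (c n) \<le> real n * cmod (c n)" by (intro mult_right_mono) auto
      then show "cmod (c n * expi (int n) x) \<le> real n * cmod (c n)" by (simp add: norm_mult)
    qed
    then show ?thesis using sumA order_trans by blast
  qed
  have [measurable]: "U N \<in> borel_measurable borel" for N
    unfolding U_def by (intro borel_measurable_continuous_onI continuous_on_partial_series)
  have [measurable]: "u \<in> borel_measurable borel"
    unfolding u_def by (intro borel_measurable_continuous_onI continuous_on_fourier_series summable_of_wiener c)
  have limD: "(\<lambda>N. cubic_density \<sigma> (U N) x) \<longlonglongrightarrow> cubic_density \<sigma> u x" for x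
  proof -
    have "(\<lambda>N. LBINT y:{0..2 * pi}. cubic_kernel (U N) x y)
      \<longlonglongrightarrow> (LBINT y:{0..2 * pi}. cubic_kernel u x y)"
      unfolding set_lebesgue_integral_def
    proof (rule integral_dominated_convergence)
      show "integrable lborel (\<lambda>y. indicator {0..2 * pi} y *\<^sub>R (4 * A ^ 3))"
        using borel_integrable_atLeastAtMost'[of 0 "2 * pi" "\<lambda>_. 4 * A ^ 3"] by (simp add: set_integrable_def)
      show "AE y in lborel. (\<lambda>N. indicator {0..2 * pi} y *\<^sub>R (cubic_kernel (U N) x y))
         \<longlonglongrightarrow> indicator {0..2 * pi} y *\<^sub>R (cubic_kernel u x y)"
      proof (rule AE_I2)
        fix y
        have "(\<lambda>N. of_real ((cmod (U N x - U N y))\<^sup>2) * (U N x - U N y) * inverse (of_real (1 - cos (x - y))))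
           \<longlonglongrightarrow> of_real ((cmod (u x - u y))\<^sup>2) * (u x - u y) * inverse (of_real (1 - cos (x - y)))"
          by (intro tendsto_intros lim)
        then show "(\<lambda>N. indicator {0..2 * pi} y *\<^sub>R (cubic_kernel (U N) x y))
         \<longlonglongrightarrow> indicator {0..2 * pi} y *\<^sub>R (cubic_kernel u x y)"
          unfolding divide_inverse by (intro tendsto_scaleR tendsto_const)
      qed
      show "AE y in lborel. norm (indicator {0..2 * pi} y *\<^sub>R (cubic_kernel (U N) x y))
         \<le> indicator {0..2 * pi} y *\<^sub>R (4 * A ^ 3)" for N
        unfolding norm_scaleR by (intro AE_I2) (simp only: abs_indicator real_scaleR_def mult_left_mono[OF integrand_bound[OF diffU A]] indicator_pos_le)
    qed measurable
    then show ?thesis unfolding cubic_density_def by (intro tendsto_intros lim)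
  qed
  have boundD: "cmod (cubic_density \<sigma> (U N) x) \<le> 2 * A ^ 3 + \<bar>\<sigma>\<bar> * A ^ 3" for N x
  proof -
    have "cmod (LBINT y:{0..2 * pi}. cubic_kernel (U N) x y)
      \<le> 4 * A ^ 3 * (2 * pi - 0)"
      by (rule norm_set_integral_le_const) (use integrand_bound[OF diffU A] A in auto)
    then have 1: "cmod (1 / (4 * of_real pi) * (LBINT y:{0..2 * pi}. cubic_kernel (U N) x y))
      \<le> 2 * A ^ 3"
      by (simp add: norm_mult norm_divide field_simps)
    have "cmod (of_real \<sigma> * of_real ((cmod (U N x))\<^sup>2) * U N x) = \<bar>\<sigma>\<bar> * cmod (U N x) ^ 3"
      unfolding norm_mult norm_of_real by (simp add: power3_eq_cube power2_eq_square)
    also have "\<dots> \<le> \<bar>\<sigma>\<bar> * A ^ 3" by (intro mult_left_mono power_mono normU) auto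
    finally have "cmod (of_real \<sigma> * of_real ((cmod (U N x))\<^sup>2) * U N x) \<le> \<bar>\<sigma>\<bar> * A ^ 3" .
    with 1 show ?thesis unfolding cubic_density_def by (intro order_trans[OF norm_triangle_ineq4] add_mono)
  qed
  have "(\<lambda>N. LBINT x:{0..2 * pi}. cubic_density \<sigma> (U N) x * expi (- int k) x)
      \<longlonglongrightarrow> (LBINT x:{0..2 * pi}. cubic_density \<sigma> u x * expi (- int k) x)"
    unfolding set_lebesgue_integral_def
  proof (rule integral_dominated_convergence)
    have [measurable]: "cubic_density \<sigma> (U N) \<in> borel_measurable borel" "cubic_density \<sigma> u \<in> borel_measurable borel" for N
      by (simp_all add: borel_measurable_cubic_density)
    show "(\<lambda>x. indicator {0..2 * pi} x *\<^sub>R (cubic_density \<sigma> (U N) x * expi (- int k) x)) \<in> borel_measurable lborel"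
      "(\<lambda>x. indicator {0..2 * pi} x *\<^sub>R (cubic_density \<sigma> u x * expi (- int k) x)) \<in> borel_measurable lborel" for N by measurable
    show "integrable lborel (\<lambda>y. indicator {0..2 * pi} y *\<^sub>R (2 * A ^ 3 + \<bar>\<sigma>\<bar> * A ^ 3))"
      using borel_integrable_atLeastAtMost'[of 0 "2 * pi" "\<lambda>_. 2 * A ^ 3 + \<bar>\<sigma>\<bar> * A ^ 3"] by (simp add: set_integrable_def)
    show "AE x in lborel. (\<lambda>N. indicator {0..2 * pi} x *\<^sub>R (cubic_density \<sigma> (U N) x * expi (- int k) x))
        \<longlonglongrightarrow> indicator {0..2 * pi} x *\<^sub>R (cubic_density \<sigma> u x * expi (- int k) x)"
      by (intro AE_I2 tendsto_intros limD)
    show "AE x in lborel. norm (indicator {0..2 * pi} x *\<^sub>R (cubic_density \<sigma> (U N) x * expi (- int k) x))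
       \<le> indicator {0..2 * pi} x *\<^sub>R (2 * A ^ 3 + \<bar>\<sigma>\<bar> * A ^ 3)" for N
      by (intro AE_I2) (simp add: norm_mult indicator_def boundD)
  qed
  then have "(\<lambda>N. fourier_coeff (cubic_density \<sigma> (U N)) (int k)) \<longlonglongrightarrow> fourier_coeff (cubic_density \<sigma> u) (int k)"
    unfolding fourier_coeff_expi by (intro tendsto_intros)
  then have "(\<lambda>N. cubic \<sigma> N c k) \<longlonglongrightarrow> fourier_coeff (cubic_density \<sigma> u) (int k)"
    by (simp add: U_def fourier_coeff_cubic_density_partial_series[OF k])
  then show ?thesis unfolding cubic_limit_def u_def by (simp add: limI)
qed

text \<open>
  The value at \<open>0\<close> is prescribed by the projector and not by the limit.
\<close>

definition cubic_coeffs :: "real \<Rightarrow> (nat \<Rightarrow> complex) \<Rightarrow> nat \<Rightarrow> complex" where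
  "cubic_coeffs \<sigma> c k = (if k = 0 then 0 else cubic_limit \<sigma> c k)"

theorem cubic_term_series:
  assumes v: "v \<in> L2_torus" "ae_eq v (fourier_series c)"
    and c: "summable (\<lambda>n. real n * cmod (c n))" "c 0 = 0"
    and sm: "summable (\<lambda>k. cmod (cubic_coeffs \<sigma> c k))"
  shows "cubic_term \<sigma> v \<in> L2_torus"
    and "ae_eq (cubic_term \<sigma> v) (fourier_series (cubic_coeffs \<sigma> c))"
    and "\<And>k. 1 \<le> k \<Longrightarrow> fourier_coeff (cubic_term \<sigma> v) (int k) = cubic_limit \<sigma> c k"
proof -
  have meas: "v \<in> borel_measurable borel" "fourier_series c \<in> borel_measurable borel"
    using v(1) fourier_series_L2[OF summable_of_wiener[OF c(1)]] by (auto simp: L2_torus_def)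
  have coeff: "fourier_coeff (cubic_density \<sigma> v) (int k) = cubic_coeffs \<sigma> c k" if "1 \<le> k" for k
  proof -
    have "fourier_coeff (cubic_density \<sigma> v) (int k) = fourier_coeff (cubic_density \<sigma> (fourier_series c)) (int k)"
      by (intro fourier_coeff_ae_eq cubic_density_ae_eq borel_measurable_cubic_density meas v(2))
    then show ?thesis using fourier_coeff_cubic_density[OF c that] that by (simp add: cubic_coeffs_def)
  qed
  have c0: "cubic_coeffs \<sigma> c 0 = 0" by (simp add: cubic_coeffs_def)
  note * = proj_pos_eq_fourier_series[OF sm c0 coeff]
  show "cubic_term \<sigma> v \<in> L2_torus" "ae_eq (cubic_term \<sigma> v) (fourier_series (cubic_coeffs \<sigma> c))"
    unfolding cubic_term_eq using *(1,2) by auto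
  show "fourier_coeff (cubic_term \<sigma> v) (int k) = cubic_limit \<sigma> c k" if "1 \<le> k" for k
    using *(3)[of "int k"] that by (simp add: cubic_term_eq cubic_coeffs_def)
qed

section \<open>Test functions\<close>

text \<open>
  The functions \<open>x\<^sup>-\<^sup>n e\<^sup>-\<^sup>1\<^sup>/\<^sup>x\<close>, extended by \<open>0\<close>; differentiation stays within their linear span.
\<close>

definition flat :: "nat \<Rightarrow> real \<Rightarrow> real" where
  "flat n x = (if 0 < x then inverse x ^ n * exp (- inverse x) else 0)"

lemma flat_at_right_0: "((\<lambda>x. inverse x ^ n * exp (- inverse x)) \<longlongrightarrow> 0) (at_right (0::real))"
proof -
  have "((\<lambda>x. inverse x ^ n / exp (inverse x)) \<longlongrightarrow> 0) (at_right (0::real))"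
    by (rule filterlim_compose[OF tendsto_power_div_exp_0 filterlim_inverse_at_top_right])
  then show ?thesis by (simp add: exp_minus divide_inverse)
qed

lemma flat_has_derivative: "(flat n has_real_derivative flat (n + 2) x - real n * flat (n + 1) x) (at x)"
proof -
  consider "0 < x" | "x < 0" | "x = 0" by linarith
  then show ?thesis
  proof cases
    case 1
    have "((\<lambda>x. inverse x ^ n * exp (- inverse x)) has_real_derivative flat (n + 2) x - real n * flat (n + 1) x) (at x)"
      using 1 by (auto intro!: derivative_eq_intros simp: flat_def power2_eq_square field_simps)
        (cases n; simp add: field_simps)
    then show ?thesis
      by (rule has_field_derivative_transform_within_open[of _ _ _ "{0<..}"]) (use 1 in \<open>auto simp: flat_def\<close>)
  next
    case 2
    have "((\<lambda>x. 0) has_real_derivative flat (n + 2) x - real n * flat (n + 1) x) (at x)"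
      using 2 by (simp add: flat_def)
    then show ?thesis
      by (rule has_field_derivative_transform_within_open[of _ _ _ "{..<0}"]) (use 2 in \<open>auto simp: flat_def\<close>)
  next
    case 3
    have "((\<lambda>y. (flat n y - flat n 0) / (y - 0)) \<longlongrightarrow> 0) (at 0)"
    proof (rule filterlim_split_at)
      show "((\<lambda>y. (flat n y - flat n 0) / (y - 0)) \<longlongrightarrow> 0) (at_left 0)"
        by (rule tendsto_eventually) (auto simp: flat_def eventually_at_filter)
      show "((\<lambda>y. (flat n y - flat n 0) / (y - 0)) \<longlongrightarrow> 0) (at_right 0)"
        by (rule Lim_transform_eventually[OF flat_at_right_0[of "Suc n"]])
           (auto simp: flat_def eventually_at_filter divide_inverse mult_ac)
    qed
    then show ?thesis using 3 by (simp add: has_field_derivative_iff flat_def)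
  qed
qed

text \<open>
  An algebra of smooth functions that is closed under differentiation and contains functions
  supported in any prescribed interval.
\<close>

inductive flat_fun :: "(real \<Rightarrow> real) \<Rightarrow> bool" where
  left: "flat_fun (\<lambda>t. flat n (t - \<alpha>))"
| right: "flat_fun (\<lambda>t. flat n (\<beta> - t))"
| add: "flat_fun f \<Longrightarrow> flat_fun g \<Longrightarrow> flat_fun (\<lambda>t. f t + g t)"
| mult: "flat_fun f \<Longrightarrow> flat_fun g \<Longrightarrow> flat_fun (\<lambda>t. f t * g t)"
| scale: "flat_fun f \<Longrightarrow> flat_fun (\<lambda>t. c * f t)"

lemma flat_fun_derivative:
  assumes "flat_fun f"
  shows "\<exists>g. flat_fun g \<and> (\<forall>t. (f has_real_derivative g t) (at t))"
  using assms
proof induction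
  case (left n \<alpha>)
  have "((\<lambda>t. flat n (t - \<alpha>)) has_real_derivative flat (n + 2) (t - \<alpha>) + (- real n) * flat (n + 1) (t - \<alpha>)) (at t)" for t
  proof -
    have "((\<lambda>t. flat n (t - \<alpha>)) has_real_derivative (flat (n + 2) (t - \<alpha>) - real n * flat (n + 1) (t - \<alpha>)) * 1) (at t)"
      by (rule DERIV_chain2[where f = "flat n" and g = "\<lambda>t. t - \<alpha>"])
         (rule flat_has_derivative, auto intro!: derivative_eq_intros)
    then show ?thesis by simp
  qed
  then show ?case by (intro exI[of _ "\<lambda>t. flat (n + 2) (t - \<alpha>) + (- real n) * flat (n + 1) (t - \<alpha>)"]
       conjI allI flat_fun.add flat_fun.left flat_fun.scale)
next
  case (right n \<beta>)
  have "((\<lambda>t. flat n (\<beta> - t)) has_real_derivative (- 1) * flat (n + 2) (\<beta> - t) + real n * flat (n + 1) (\<beta> - t)) (at t)" for t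
  proof -
    have "((\<lambda>t. flat n (\<beta> - t)) has_real_derivative (flat (n + 2) (\<beta> - t) - real n * flat (n + 1) (\<beta> - t)) * (- 1)) (at t)"
      by (rule DERIV_chain2[where f = "flat n" and g = "\<lambda>t. \<beta> - t"])
         (rule flat_has_derivative, auto intro!: derivative_eq_intros)
    then show ?thesis by simp
  qed
  then show ?case by (intro exI[of _ "\<lambda>t. (- 1) * flat (n + 2) (\<beta> - t) + real n * flat (n + 1) (\<beta> - t)"]
       conjI allI flat_fun.add flat_fun.right flat_fun.scale)
next
  case (add f g)
  then obtain f' g' where "flat_fun f'" "flat_fun g'" "\<And>t. (f has_real_derivative f' t) (at t)" "\<And>t. (g has_real_derivative g' t) (at t)"
    by blast
  then show ?case by (intro exI[of _ "\<lambda>t. f' t + g' t"]) (auto intro!: flat_fun.intros derivative_intros)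
next
  case (mult f g)
  then obtain f' g' where d: "flat_fun f'" "flat_fun g'" "\<And>t. (f has_real_derivative f' t) (at t)" "\<And>t. (g has_real_derivative g' t) (at t)"
    by blast
  have "((\<lambda>t. f t * g t) has_real_derivative f' t * g t + g' t * f t) (at t)" for t
    by (rule DERIV_mult d)+
  then show ?case using d mult by (intro exI[of _ "\<lambda>t. f' t * g t + g' t * f t"]) (auto intro!: flat_fun.intros)
next
  case (scale f c)
  then obtain f' where "flat_fun f'" "\<And>t. (f has_real_derivative f' t) (at t)" by blast
  then show ?case by (intro exI[of _ "\<lambda>t. c * f' t"]) (auto intro!: flat_fun.intros DERIV_cmult)
qed

lemma flat_fun_continuous:
  assumes "flat_fun f"
  shows "continuous_on S f"
proof -
  obtain g where "\<And>t. (f has_real_derivative g t) (at t)" using flat_fun_derivative[OF assms] by blast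
  then show ?thesis by (rule DERIV_continuous_on[OF has_field_derivative_at_within])
qed

lemma separated_has_derivatives:
  assumes "\<And>t. (f has_real_derivative g t) (at t)"
  shows "((\<lambda>\<tau>. of_real (f \<tau>) * c * expi k x) has_vector_derivative of_real (g t) * c * expi k x) (at t)"
    and "((\<lambda>y. of_real (f t) * c * expi k y) has_vector_derivative of_real (f t) * (c * \<i> * of_int k) * expi k x) (at x)"
proof -
  have "((\<lambda>\<tau>. of_real (f \<tau>)) has_vector_derivative (of_real (g t) :: complex)) (at t)"
    using assms[of t] by (intro has_vector_derivative_of_real) (simp add: has_real_derivative_iff_has_vector_derivative)
  from has_vector_derivative_mult_left[OF this, of "c * expi k x"]
  show "((\<lambda>\<tau>. of_real (f \<tau>) * c * expi k x) has_vector_derivative of_real (g t) * c * expi k x) (at t)"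
    by (simp add: mult.assoc)
  from has_vector_derivative_mult_right[OF expi_has_derivative[of k x UNIV], of "of_real (f t) * c"]
  show "((\<lambda>y. of_real (f t) * c * expi k y) has_vector_derivative of_real (f t) * (c * \<i> * of_int k) * expi k x) (at x)"
    by (simp add: mult_ac)
qed

lemma separated_partials:
  assumes "\<And>t. (f has_real_derivative g t) (at t)"
  shows "partial_t (\<lambda>t x. of_real (f t) * c * expi k x) = (\<lambda>t x. of_real (g t) * c * expi k x)"
    and "partial_x (\<lambda>t x. of_real (f t) * c * expi k x) = (\<lambda>t x. of_real (f t) * (c * \<i> * of_int k) * expi k x)"
  unfolding partial_t_def[abs_def] partial_x_def[abs_def]
  using separated_has_derivatives[OF assms] by (auto intro!: ext vector_derivative_at)

text \<open>
  Only the derivative \<open>g\<close> of \<open>f\<close> has to belong to the algebra, which allows \<open>f\<close> to be a primitive of a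
  bump function.  The coinduction invariant is the set of all functions of this separated form.
\<close>

lemma smooth_separated:
  assumes "flat_fun g" "\<And>t. (f has_real_derivative g t) (at t)"
  shows "smooth (\<lambda>t x. of_real (f t) * c * expi k x)"
proof -
  define Q where "Q \<phi> \<longleftrightarrow> (\<exists>f g c k. flat_fun g \<and> (\<forall>t. (f has_real_derivative g t) (at t)) \<and>
     \<phi> = (\<lambda>t x. of_real (f t) * c * expi k x))" for \<phi>
  have "Q (\<lambda>t x. of_real (f t) * c * expi k x)" using assms by (auto simp: Q_def)
  then show ?thesis
  proof (rule smooth.coinduct[of Q])
    fix \<phi> assume "Q \<phi>"
    then obtain f g c k where g: "flat_fun g" and fg: "\<And>t. (f has_real_derivative g t) (at t)"
      and \<phi>: "\<phi> = (\<lambda>t x. of_real (f t) * c * expi k x)" by (auto simp: Q_def)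
    obtain g' where g': "flat_fun g'" "\<And>t. (g has_real_derivative g' t) (at t)"
      using flat_fun_derivative[OF g] by blast
    have "continuous_on UNIV f" by (rule DERIV_continuous_on) (rule fg)
    then have "continuous_on UNIV (\<lambda>z. f (fst z))"
      by (rule continuous_on_compose2) (auto intro: continuous_intros)
    then have "continuous_on UNIV (\<lambda>(t, x). \<phi> t x)"
      unfolding \<phi> case_prod_unfold by (intro continuous_intros)
    moreover have "(\<lambda>\<tau>. \<phi> \<tau> x) differentiable (at t)" "(\<lambda>y. \<phi> t y) differentiable (at x)" for t x
      unfolding \<phi> by (rule differentiableI_vector[OF separated_has_derivatives(1)[OF fg]],
        rule differentiableI_vector[OF separated_has_derivatives(2)[OF fg]])
    moreover have "Q (partial_t \<phi>)" unfolding \<phi> separated_partials[OF fg] using g' by (auto simp: Q_def)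
    moreover have "Q (partial_x \<phi>)" unfolding \<phi> separated_partials[OF fg] using g fg unfolding Q_def by blast
    ultimately show "\<exists>\<phi>'. \<phi> = \<phi>' \<and> continuous_on UNIV (\<lambda>(t, x). \<phi>' t x) \<and>
        (\<forall>t x. (\<lambda>\<tau>. \<phi>' \<tau> x) differentiable (at t)) \<and> (\<forall>t x. (\<lambda>y. \<phi>' t y) differentiable (at x)) \<and>
        (Q (partial_t \<phi>') \<or> smooth (partial_t \<phi>')) \<and> (Q (partial_x \<phi>') \<or> smooth (partial_x \<phi>'))" by blast
  qed
qed

lemma test_function_separated:
  assumes "flat_fun g" "\<And>t. (f has_real_derivative g t) (at t)"
    and "0 < a" "b < T" "\<And>t. f t \<noteq> 0 \<Longrightarrow> t \<in> {a..b}"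
  shows "test_function T (\<lambda>t x. of_real (f t) * c * expi k x)"
proof -
  have "smooth (\<lambda>t x. of_real (f t) * c * expi k x)" by (rule smooth_separated[OF assms(1,2)])
  moreover have "0 < a \<and> b < T \<and> (\<forall>t x. of_real (f t) * c * expi k x \<noteq> 0 \<longrightarrow> t \<in> {a..b})"
    using assms(3-5) by simp
  ultimately show ?thesis unfolding test_function_def by (auto simp: expi_periodic)
qed

section \<open>The lemma of du Bois-Reymond\<close>

text \<open>
  Averages against narrow normalized bumps recover point values.
\<close>

lemma bump_average:
  fixes g :: "real \<Rightarrow> complex"
  assumes g: "continuous_on {0..T} g" and t0: "t0 \<in> {0<..<T}" and e: "0 < e"
  obtains \<eta> a b where "flat_fun \<eta>" "0 < a" "b < T" "\<And>t. \<eta> t \<noteq> 0 \<Longrightarrow> t \<in> {a..b}"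
    "integral {0..T} \<eta> = 1" "cmod (integral {0..T} (\<lambda>t. g t * of_real (\<eta> t)) - g t0) \<le> e"
proof -
  obtain \<delta> where \<delta>: "0 < \<delta>" "\<And>t. t \<in> {0..T} \<Longrightarrow> dist t t0 < \<delta> \<Longrightarrow> dist (g t) (g t0) < e"
    using g t0 e unfolding continuous_on_iff by (metis atLeastAtMost_iff greaterThanLessThan_iff less_imp_le)
  define r where "r = min (\<delta> / 2) (min (t0 / 2) ((T - t0) / 2))"
  have "r \<le> \<delta> / 2" "r \<le> t0 / 2" "r \<le> (T - t0) / 2"
    unfolding r_def by (rule min.cobounded1, rule min.coboundedI2, rule min.cobounded1, rule min.coboundedI2, rule min.cobounded2)
  moreover have "0 < r" using \<delta> t0 by (simp add: r_def)
  ultimately have r: "0 < r" "r < \<delta>" "r < t0" "r < T - t0" using \<delta> t0 by auto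
  define B where "B t = flat 0 (t - (t0 - r)) * flat 0 ((t0 + r) - t)" for t
  have B: "flat_fun B" unfolding B_def[abs_def] by (intro flat_fun.intros)
  have supp: "t \<in> {t0 - r..t0 + r}" if "B t \<noteq> 0" for t using that by (auto simp: B_def flat_def split: if_splits)
  have nn: "0 \<le> B t" for t by (simp add: B_def flat_def)
  have contB: "continuous_on S B" for S by (rule flat_fun_continuous[OF B])
  define I where "I = integral {0..T} B"
  have I: "0 < I"
  proof -
    have "0 \<le> I" unfolding I_def by (intro Henstock_Kurzweil_Integration.integral_nonneg integrable_continuous_real contB nn)
    moreover have "I \<noteq> 0"
    proof
      assume "I = 0"
      then have "B t0 = 0"
        using integral_eq_0_iff[OF contB[of "{0..T}"]] t0 nn by (auto simp: I_def)
      then show False using r by (simp add: B_def flat_def)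
    qed
    ultimately show ?thesis by simp
  qed
  define \<eta> where "\<eta> t = inverse I * B t" for t
  have \<eta>: "flat_fun \<eta>" unfolding \<eta>_def[abs_def] by (intro flat_fun.intros B)
  have cont\<eta>: "continuous_on S \<eta>" for S by (rule flat_fun_continuous[OF \<eta>])
  have int1: "integral {0..T} \<eta> = 1" using I unfolding \<eta>_def by (simp add: I_def)
  have one: "integral {0..T} (\<lambda>t. complex_of_real (\<eta> t)) = 1"
    using int1 integrable_continuous_real[OF cont\<eta>[of "{0..T}"]]
    by (metis has_integral_of_real has_integral_integral integral_unique of_real_1)
  have "cmod (integral {0..T} (\<lambda>t. g t * of_real (\<eta> t)) - g t0)
    = cmod (integral {0..T} (\<lambda>t. g t * of_real (\<eta> t)) - integral {0..T} (\<lambda>t. g t0 * of_real (\<eta> t)))"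
    by (simp add: one)
  also have "\<dots> = cmod (integral {0..T} (\<lambda>t. g t * of_real (\<eta> t) - g t0 * of_real (\<eta> t)))"
    by (subst Henstock_Kurzweil_Integration.integral_diff)
       (auto intro!: integrable_continuous_real continuous_intros g cont\<eta>)
  also have "\<dots> \<le> integral {0..T} (\<lambda>t. e * \<eta> t)"
  proof (rule integral_norm_bound_integral)
    fix t assume t: "t \<in> {0..T}"
    have \<eta>nn: "0 \<le> \<eta> t" using I nn by (simp add: \<eta>_def)
    have "cmod (g t * of_real (\<eta> t) - g t0 * of_real (\<eta> t)) = cmod (g t - g t0) * \<eta> t"
      using \<eta>nn by (simp add: left_diff_distrib[symmetric] norm_mult)
    also have "\<dots> \<le> e * \<eta> t"
    proof (cases "\<eta> t = 0")
      case False
      then have "t \<in> {t0 - r..t0 + r}" using supp by (simp add: \<eta>_def)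
      then have "cmod (g t - g t0) < e" using \<delta>(2)[OF t] r by (auto simp: dist_norm)
      then show ?thesis using \<eta>nn by (intro mult_right_mono) auto
    qed simp
    finally show "cmod (g t * of_real (\<eta> t) - g t0 * of_real (\<eta> t)) \<le> e * \<eta> t" .
  qed (auto intro!: integrable_continuous_real continuous_intros g cont\<eta>)
  also have "\<dots> = e" using int1 by simp
  finally have "cmod (integral {0..T} (\<lambda>t. g t * of_real (\<eta> t)) - g t0) \<le> e" .
  with \<eta> int1 show ?thesis
    by (intro that[of \<eta> "t0 - r" "t0 + r"]) (use r supp in \<open>auto simp: \<eta>_def\<close>)
qed

text \<open>
  The base point \<open>-1\<close> of the primitive lies to the left of the support, so that the primitive vanishes
  there, and its vanishing total integral makes it vanish to the right.
\<close>

lemma compactly_supported_antiderivative: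
  assumes \<eta>: "continuous_on UNIV \<eta>" and supp: "\<And>t. \<eta> t \<noteq> 0 \<Longrightarrow> t \<in> {a..b}"
    and zero: "integral {0..T} \<eta> = 0" and ab: "0 < a" "b < T" "0 < T"
  obtains \<psi> where "\<And>t. (\<psi> has_real_derivative \<eta> t) (at t)" "\<And>t. \<psi> t \<noteq> 0 \<Longrightarrow> t \<in> {a..b}"
proof
  define \<psi> where "\<psi> t = integral {-1..t} \<eta>" for t
  have int: "\<eta> integrable_on {c..d}" for c d
    by (intro integrable_continuous_real continuous_on_subset[OF \<eta>]) auto
  have left: "\<psi> t = 0" if "t < a" for t
    unfolding \<psi>_def using that supp
    by (subst integral_cong[where g = "\<lambda>_. 0"]) force+
  have right: "\<psi> t = 0" if t: "b < t" for t
  proof -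
    have "\<psi> (max t T) = \<psi> 0 + integral {0..max t T} \<eta>"
      unfolding \<psi>_def using ab by (intro Henstock_Kurzweil_Integration.integral_combine[symmetric] int) auto
    also have "integral {0..max t T} \<eta> = integral {0..T} \<eta> + integral {T..max t T} \<eta>"
      using ab by (intro Henstock_Kurzweil_Integration.integral_combine[symmetric] int) auto
    also have "integral {T..max t T} \<eta> = 0"
      using supp ab by (subst integral_cong[where g = "\<lambda>_. 0"]) force+
    finally have 1: "\<psi> (max t T) = 0" using left[of 0] zero ab by simp
    show ?thesis
    proof (cases "t < -1")
      case True
      then show ?thesis by (simp add: \<psi>_def)
    next
      case False
      have "\<psi> (max t T) = \<psi> t + integral {t..max t T} \<eta>"
        unfolding \<psi>_def using False by (intro Henstock_Kurzweil_Integration.integral_combine[symmetric] int) auto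
      also have "integral {t..max t T} \<eta> = 0"
        using supp t by (subst integral_cong[where g = "\<lambda>_. 0"]) force+
      finally show ?thesis using 1 by simp
    qed
  qed
  show "t \<in> {a..b}" if "\<psi> t \<noteq> 0" for t using left[of t] right[of t] that by force
  show "(\<psi> has_real_derivative \<eta> t) (at t)" for t
  proof (cases "t < a")
    case True
    have "\<eta> t = 0" using supp True by force
    then have "((\<lambda>_. 0) has_real_derivative \<eta> t) (at t)" by simp
    then show ?thesis
      by (rule has_field_derivative_transform_within_open[of _ _ _ "{..<a}"]) (use True left in auto)
  next
    case False
    have "(\<psi> has_vector_derivative \<eta> t) (at t within {-1..t + 1})"
      unfolding \<psi>_def using False ab by (intro integral_has_vector_derivative continuous_on_subset[OF \<eta>]) auto
    then show ?thesis using False ab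
      by (simp add: at_within_Icc_at has_real_derivative_iff_has_vector_derivative)
  qed
qed

text \<open>
  The difference of two normalized bumps near \<open>t1\<close> and \<open>t2\<close> has total integral \<open>0\<close>, hence a compactly
  supported primitive; testing with it shows that \<open>g t1\<close> and \<open>g t2\<close> agree up to a small error.
\<close>

lemma du_Bois_Reymond:
  fixes g :: "real \<Rightarrow> complex"
  assumes g: "continuous_on {0..T} g" and T: "0 < T"
    and weak: "\<And>\<psi> \<eta> a b. flat_fun \<eta> \<Longrightarrow> (\<And>t. (\<psi> has_real_derivative \<eta> t) (at t)) \<Longrightarrow> 0 < a \<Longrightarrow> b < T \<Longrightarrow>
        (\<And>t. \<psi> t \<noteq> 0 \<Longrightarrow> t \<in> {a..b}) \<Longrightarrow> integral {0..T} (\<lambda>t. g t * of_real (\<eta> t)) = 0"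
    and t: "t \<in> {0..T}"
  shows "g t = g 0"
proof -
  have eq: "g t1 = g t2" if t1: "t1 \<in> {0<..<T}" and t2: "t2 \<in> {0<..<T}" for t1 t2
  proof -
    have "cmod (g t1 - g t2) \<le> e" if e: "0 < e" for e
    proof -
      obtain \<eta>1 a1 b1 where 1: "flat_fun \<eta>1" "0 < a1" "b1 < T" "\<And>t. \<eta>1 t \<noteq> 0 \<Longrightarrow> t \<in> {a1..b1}"
        "integral {0..T} \<eta>1 = 1" "cmod (integral {0..T} (\<lambda>t. g t * of_real (\<eta>1 t)) - g t1) \<le> e / 2"
        using bump_average[OF g t1, of "e / 2"] e by auto
      obtain \<eta>2 a2 b2 where 2: "flat_fun \<eta>2" "0 < a2" "b2 < T" "\<And>t. \<eta>2 t \<noteq> 0 \<Longrightarrow> t \<in> {a2..b2}"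
        "integral {0..T} \<eta>2 = 1" "cmod (integral {0..T} (\<lambda>t. g t * of_real (\<eta>2 t)) - g t2) \<le> e / 2"
        using bump_average[OF g t2, of "e / 2"] e by auto
      define \<eta> where "\<eta> t = \<eta>1 t + (-1) * \<eta>2 t" for t
      have \<eta>: "flat_fun \<eta>" unfolding \<eta>_def[abs_def] by (intro flat_fun.intros 1 2)
      note cont = flat_fun_continuous[OF 1(1)] flat_fun_continuous[OF 2(1)]
      have z: "integral {0..T} \<eta> = 0"
        unfolding \<eta>_def using 1(5) 2(5)
        by (subst Henstock_Kurzweil_Integration.integral_add) (auto intro!: integrable_continuous_real continuous_intros cont)
      have supp: "t \<in> {min a1 a2..max b1 b2}" if "\<eta> t \<noteq> 0" for t
      proof (cases "\<eta>1 t = 0")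
        case True
        then show ?thesis using 2(4)[of t] that by (auto simp: \<eta>_def)
      qed (use 1(4)[of t] in auto)
      obtain \<psi> where \<psi>: "\<And>t. (\<psi> has_real_derivative \<eta> t) (at t)" "\<And>t. \<psi> t \<noteq> 0 \<Longrightarrow> t \<in> {min a1 a2..max b1 b2}"
        using compactly_supported_antiderivative[OF flat_fun_continuous[OF \<eta>] supp z] 1(2,3) 2(2,3) T by auto
      have "integral {0..T} (\<lambda>t. g t * of_real (\<eta> t)) = 0"
        by (rule weak[OF \<eta> \<psi>(1) _ _ \<psi>(2)]) (use 1 2 in auto)
      moreover have "integral {0..T} (\<lambda>t. g t * of_real (\<eta> t))
        = integral {0..T} (\<lambda>t. g t * of_real (\<eta>1 t)) - integral {0..T} (\<lambda>t. g t * of_real (\<eta>2 t))"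
        unfolding \<eta>_def
        by (subst Henstock_Kurzweil_Integration.integral_diff[symmetric])
           (auto intro!: integrable_continuous_real continuous_intros cont g simp: algebra_simps)
      ultimately have "integral {0..T} (\<lambda>t. g t * of_real (\<eta>1 t)) = integral {0..T} (\<lambda>t. g t * of_real (\<eta>2 t))" by simp
      then have "g t1 - g t2 = (integral {0..T} (\<lambda>t. g t * of_real (\<eta>2 t)) - g t2) - (integral {0..T} (\<lambda>t. g t * of_real (\<eta>1 t)) - g t1)" by simp
      also have "cmod \<dots> \<le> cmod (integral {0..T} (\<lambda>t. g t * of_real (\<eta>2 t)) - g t2) + cmod (integral {0..T} (\<lambda>t. g t * of_real (\<eta>1 t)) - g t1)"
        by (rule norm_triangle_ineq4)
      also have "\<dots> \<le> e / 2 + e / 2" using 1(6) 2(6) by simp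
      finally show ?thesis by simp
    qed
    then have "cmod (g t1 - g t2) \<le> 0" by (meson dense_ge)
    then show ?thesis by simp
  qed
  have "g t = g (T / 2)" if t: "t \<in> {0..T}" for t
  proof -
    have "{0..T} = closure {0<..<T}" using T by simp
    moreover have "closed {t \<in> {0..T}. g t = g (T / 2)}"
      using continuous_closed_preimage_constant[OF g] by simp
    moreover have "{0<..<T} \<subseteq> {t \<in> {0..T}. g t = g (T / 2)}"
    proof
      fix x assume "x \<in> {0<..<T}"
      moreover from this have "g x = g (T / 2)" using T by (intro eq) auto
      ultimately show "x \<in> {t \<in> {0..T}. g t = g (T / 2)}" by simp
    qed
    ultimately have "{0..T} \<subseteq> {t \<in> {0..T}. g t = g (T / 2)}" using closure_minimal by metis
    then show ?thesis using t by blast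
  qed
  from this[OF t] this[of 0] show ?thesis using T by simp
qed

section \<open>Sobolev functions with positive spectrum\<close>

definition fourier_coeffs :: "(real \<Rightarrow> complex) \<Rightarrow> nat \<Rightarrow> complex" where
  "fourier_coeffs f k = fourier_coeff f (int k)"

lemma sobolev_norm_nonneg: "0 \<le> sobolev_norm s f"
  unfolding sobolev_norm_def by (intro real_sqrt_ge_zero infsum_nonneg) auto

text \<open>
  The Sobolev norm also counts the frequencies \<open>k \<le> 0\<close>.
\<close>

lemma sobolev_bounded_coeffs:
  assumes f: "f \<in> sobolev_torus s"
  shows "sobolev_bounded s (sobolev_norm s f) N (fourier_coeffs f)"
proof -
  define F where "F k = (1 + (real_of_int k)\<^sup>2) powr s * (cmod (fourier_coeff f k))\<^sup>2" for k
  have F: "F summable_on UNIV" "\<And>k. 0 \<le> F k" using f by (auto simp: sobolev_torus_def F_def[abs_def])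
  have "sobolev_energy s 1 N (fourier_coeffs f) = (\<Sum>k\<in>int ` {1..N}. F k)"
    by (subst sum.reindex) (auto simp: F_def sobolev_weight_def fourier_coeffs_def)
  also have "\<dots> \<le> infsum F UNIV" using F by (intro finite_sum_le_infsum) auto
  also have "\<dots> = (sobolev_norm s f)\<^sup>2"
    unfolding sobolev_norm_def F_def[symmetric] by (intro real_sqrt_pow2[symmetric] infsum_nonneg F)
  finally show ?thesis by (simp add: sobolev_bounded_def sobolev_norm_nonneg)
qed

lemma sobolev_bounded_summable_wiener:
  assumes s: "3 / 2 < s" and a: "\<And>N. sobolev_bounded s R N a"
  shows "summable (\<lambda>n. real n * cmod (a n))"
proof (rule summableI_nonneg_bounded)
  fix n
  have "(\<Sum>k<n. real k * cmod (a k)) \<le> (\<Sum>k\<in>insert 0 {1..n}. real k * cmod (a k))"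
    by (intro sum_mono2) auto
  also have "\<dots> = (\<Sum>k\<in>{1..n}. real k * cmod (a k))" by simp
  also have "\<dots> \<le> wiener_tail s 0 * R" by (rule wiener_bound[OF s a])
  finally show "(\<Sum>k<n. real k * cmod (a k)) \<le> wiener_tail s 0 * R" .
qed auto

lemma cubic_coeffs_partial_sums:
  assumes \<sigma>: "0 \<le> \<sigma>" "\<sigma> \<le> 1" and s: "3 / 2 < s" and a: "\<And>N. sobolev_bounded s R N a"
  shows "(\<Sum>k<n. cmod (cubic_coeffs \<sigma> a k)) \<le> truncation_error s R 0"
proof -
  have "(\<Sum>k<n. cmod (cubic_coeffs \<sigma> a k)) \<le> (\<Sum>k\<in>insert 0 {1..n}. cmod (cubic_coeffs \<sigma> a k))"
    by (intro sum_mono2) auto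
  also have "\<dots> = (\<Sum>k\<in>{1..n}. cmod (cubic_limit \<sigma> a k))"
    by (simp add: cubic_coeffs_def)
  also have "\<dots> \<le> truncation_error s R 0" by (rule cubic_limit_partial_sums[OF \<sigma> s a])
  finally show ?thesis .
qed

lemma summable_cubic_coeffs:
  assumes "0 \<le> \<sigma>" "\<sigma> \<le> 1" "3 / 2 < s" "\<And>N. sobolev_bounded s R N a"
  shows "summable (\<lambda>k. cmod (cubic_coeffs \<sigma> a k))"
  by (rule summableI_nonneg_bounded[OF _ cubic_coeffs_partial_sums[OF assms]]) auto

text \<open>
  The projection of \<open>f\<close> is computed by \<open>proj_pos_eq_fourier_series\<close>; since \<open>f\<close> agrees with it, the
  coefficients with \<open>k \<le> 0\<close> vanish and the remaining ones determine \<open>f\<close>.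
\<close>

lemma positive_spectrum_series:
  assumes s: "3 / 2 < s" and f: "f \<in> sobolev_torus s" and pos: "ae_eq (proj_pos f) f"
  shows "fourier_coeffs f 0 = 0" and "ae_eq f (fourier_series (fourier_coeffs f))"
proof -
  define c where "c k = (if k = 0 then 0 else fourier_coeffs f k)" for k
  have L2: "f \<in> L2_torus" using f by (simp add: sobolev_torus_def)
  have "summable (\<lambda>n. cmod (fourier_coeffs f n))"
    by (rule summable_of_wiener[OF sobolev_bounded_summable_wiener[OF s sobolev_bounded_coeffs[OF f]]])
  then have sm: "summable (\<lambda>n. cmod (c n))"
    by (rule summable_comparison_test') (auto simp: c_def)
  note p = proj_pos_eq_fourier_series[OF sm, of f]
  have p1: "proj_pos f \<in> L2_torus" "fourier_coeff (proj_pos f) k = (if 1 \<le> k then c (nat k) else 0)" for k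
    using p by (auto simp: c_def fourier_coeffs_def)
  have fc: "fourier_coeff f k = (if 1 \<le> k then c (nat k) else 0)" for k
    using fourier_coeff_ae_eq[OF pos] p1 L2 by (auto simp: L2_torus_def)
  show c0: "fourier_coeffs f 0 = 0" by (simp add: fourier_coeffs_def fc)
  then have c_eq: "fourier_coeffs f = c" by (intro ext) (simp add: c_def)
  show "ae_eq f (fourier_series (fourier_coeffs f))"
    unfolding c_eq
  proof (intro fourier_coeffs_unique L2 fourier_series_L2[OF sm])
    have "c 0 = 0" by (simp add: c_def)
    then show "fourier_coeff f k = fourier_coeff (fourier_series c) k" for k
      unfolding fc fourier_coeff_fourier_series[OF sm] by (cases "k = 0") auto
  qed
qed

lemma norm_diff_square_le: "(cmod (x - y))\<^sup>2 \<le> 2 * (cmod x)\<^sup>2 + 2 * (cmod y)\<^sup>2"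
proof -
  have "(cmod (x - y))\<^sup>2 \<le> (cmod x + cmod y)\<^sup>2" by (intro power_mono norm_triangle_ineq4) auto
  also have "\<dots> \<le> 2 * (cmod x)\<^sup>2 + 2 * (cmod y)\<^sup>2"
    using zero_le_power2[of "cmod x - cmod y"] by (simp add: power2_eq_square algebra_simps)
  finally show ?thesis .
qed

lemma L2_torus_diff:
  assumes f: "f \<in> L2_torus" and g: "g \<in> L2_torus"
  shows "(\<lambda>x. f x - g x) \<in> L2_torus"
proof -
  have [measurable]: "f \<in> borel_measurable borel" "g \<in> borel_measurable borel" using f g by (auto simp: L2_torus_def)
  have "set_integrable lborel {0..2 * pi} (\<lambda>x. (cmod (f x - g x))\<^sup>2)"
    unfolding set_integrable_def
  proof (rule Bochner_Integration.integrable_bound)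
    have "set_integrable lborel {0..2 * pi} (\<lambda>x. 2 * (cmod (f x))\<^sup>2 + 2 * (cmod (g x))\<^sup>2)"
      using f g by (intro set_integral_add) (auto simp: L2_torus_def)
    then show "integrable lborel (\<lambda>x. indicator {0..2 * pi} x *\<^sub>R (2 * (cmod (f x))\<^sup>2 + 2 * (cmod (g x))\<^sup>2))"
      by (simp add: set_integrable_def)
    show "AE x in lborel. norm (indicator {0..2 * pi} x *\<^sub>R (cmod (f x - g x))\<^sup>2)
      \<le> norm (indicator {0..2 * pi} x *\<^sub>R (2 * (cmod (f x))\<^sup>2 + 2 * (cmod (g x))\<^sup>2))"
      using norm_diff_square_le by (auto simp: indicator_def)
  qed measurable
  then show ?thesis using f g by (auto simp: L2_torus_def)
qed

lemma sobolev_torus_diff: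
  assumes f: "f \<in> sobolev_torus s" and g: "g \<in> sobolev_torus s"
  shows "(\<lambda>x. f x - g x) \<in> sobolev_torus s"
proof -
  have L2: "f \<in> L2_torus" "g \<in> L2_torus" using f g by (auto simp: sobolev_torus_def)
  have "(\<lambda>k::int. (1 + (real_of_int k)\<^sup>2) powr s * (cmod (fourier_coeff (\<lambda>x. f x - g x) k))\<^sup>2) summable_on UNIV"
  proof (rule summable_on_comparison_test)
    show "(\<lambda>k::int. 2 * ((1 + (real_of_int k)\<^sup>2) powr s * (cmod (fourier_coeff f k))\<^sup>2)
        + 2 * ((1 + (real_of_int k)\<^sup>2) powr s * (cmod (fourier_coeff g k))\<^sup>2)) summable_on UNIV"
      using f g by (intro summable_on_add summable_on_cmult_right) (auto simp: sobolev_torus_def)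
    fix k :: int
    have "(1 + (real_of_int k)\<^sup>2) powr s * (cmod (fourier_coeff f k - fourier_coeff g k))\<^sup>2
       \<le> (1 + (real_of_int k)\<^sup>2) powr s * (2 * (cmod (fourier_coeff f k))\<^sup>2 + 2 * (cmod (fourier_coeff g k))\<^sup>2)"
      by (intro mult_left_mono norm_diff_square_le) auto
    then show "(1 + (real_of_int k)\<^sup>2) powr s * (cmod (fourier_coeff (\<lambda>x. f x - g x) k))\<^sup>2
       \<le> 2 * ((1 + (real_of_int k)\<^sup>2) powr s * (cmod (fourier_coeff f k))\<^sup>2)
        + 2 * ((1 + (real_of_int k)\<^sup>2) powr s * (cmod (fourier_coeff g k))\<^sup>2)"
      by (simp add: fourier_coeff_diff[OF L2] distrib_left mult_ac)
  qed auto
  then show ?thesis using L2_torus_diff[OF L2] by (simp add: sobolev_torus_def)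
qed

lemma fourier_coeffs_diff:
  assumes "f \<in> sobolev_torus s" "g \<in> sobolev_torus s"
  shows "fourier_coeffs (\<lambda>x. f x - g x) k = fourier_coeffs f k - fourier_coeffs g k"
  using assms by (simp add: fourier_coeffs_def sobolev_torus_def fourier_coeff_diff)

lemma sobolev_series:
  assumes s: "3 / 2 < s" and c: "\<And>N. sobolev_bounded s R N c" and c0: "c 0 = 0"
  shows "fourier_series c \<in> sobolev_torus s" and "sobolev_norm s (fourier_series c) \<le> R"
proof -
  have sm: "summable (\<lambda>n. cmod (c n))" by (intro summable_of_wiener sobolev_bounded_summable_wiener[OF s c])
  have R: "0 \<le> R" using c[of 0] by (simp add: sobolev_bounded_def)
  define F where "F k = (1 + (real_of_int k)\<^sup>2) powr s * (cmod (fourier_coeff (fourier_series c) k))\<^sup>2" for k :: int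
  have bound: "sum F X \<le> R\<^sup>2" if X: "finite X" for X
  proof -
    define N where "N = nat (Max (insert 0 X))"
    have out: "F k = 0" if "k \<notin> int ` {1..N}" "k \<in> X" for k
    proof -
      have "k \<le> Max (insert 0 X)" using X that by (intro Max_ge) auto
      then have le: "nat k \<le> N" unfolding N_def by (rule nat_mono)
      have "k \<le> 0"
      proof (rule ccontr)
        assume "\<not> k \<le> 0"
        then have "nat k \<in> {1..N}" "k = int (nat k)" using le by auto
        then show False using \<open>k \<notin> int ` {1..N}\<close> by blast
      qed
      then show ?thesis using c0 by (cases "k = 0") (auto simp: F_def fourier_coeff_fourier_series[OF sm])
    qed
    have "sum F X = sum F (X \<inter> int ` {1..N})"
      using X out by (intro sum.mono_neutral_right) auto
    also have "\<dots> \<le> sum F (int ` {1..N})" by (intro sum_mono2) (auto simp: F_def)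
    also have "\<dots> = sobolev_energy s 1 N c"
      by (subst sum.reindex) (auto simp: F_def sobolev_weight_def fourier_coeff_fourier_series[OF sm])
    also have "\<dots> \<le> R\<^sup>2" using c[of N] by (simp add: sobolev_bounded_def)
    finally show ?thesis .
  qed
  have F: "F summable_on UNIV"
    by (rule nonneg_bdd_above_summable_on) (auto simp: F_def[symmetric] intro!: bdd_aboveI2[of _ _ "R\<^sup>2"] bound, simp add: F_def)
  then show "fourier_series c \<in> sobolev_torus s"
    using fourier_series_L2[OF sm] by (simp add: sobolev_torus_def F_def[abs_def])
  have "infsum F UNIV \<le> R\<^sup>2" by (rule infsum_le_finite_sums[OF F bound])
  then show "sobolev_norm s (fourier_series c) \<le> R"
    unfolding sobolev_norm_def F_def[symmetric] using R by (intro real_le_lsqrt) auto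
qed

section \<open>From distributional solutions to the coefficient system\<close>

lemma sobolev_bounded_triangle:
  assumes "sobolev_bounded s A N (\<lambda>k. x k - y k)" "sobolev_bounded s B N y"
  shows "sobolev_bounded s (sqrt (2 * A\<^sup>2 + 2 * B\<^sup>2)) N x"
proof -
  have "sobolev_energy s 1 N x
     \<le> (\<Sum>k\<in>{1..N}. sobolev_weight s k * (2 * (cmod (x k - y k))\<^sup>2 + 2 * (cmod (y k))\<^sup>2))"
  proof (intro sum_mono mult_left_mono)
    fix k show "(cmod (x k))\<^sup>2 \<le> 2 * (cmod (x k - y k))\<^sup>2 + 2 * (cmod (y k))\<^sup>2"
      using norm_diff_square_le[of "x k - y k" "- y k"] by simp
  qed (auto simp: sobolev_weight_def)
  also have "\<dots> = 2 * (\<Sum>k\<in>{1..N}. sobolev_weight s k * (cmod (x k - y k))\<^sup>2) + 2 * sobolev_energy s 1 N y"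
    by (simp add: sum_distrib_left sum.distrib[symmetric] algebra_simps)
  also have "\<dots> \<le> 2 * A\<^sup>2 + 2 * B\<^sup>2" using assms by (simp add: sobolev_bounded_def)
  finally show ?thesis by (simp add: sobolev_bounded_def)
qed

text \<open>
  Continuity bounds the norm near each time, and finitely many of these neighbourhoods cover the
  interval.
\<close>

lemma continuous_in_sobolev_bounded:
  assumes v: "continuous_in_sobolev s T v"
  obtains R where "\<And>t N. t \<in> {0..T} \<Longrightarrow> sobolev_bounded s R N (fourier_coeffs (v t))"
proof -
  have vs: "v t \<in> sobolev_torus s" if "t \<in> {0..T}" for t using v that by (simp add: continuous_in_sobolev_def)
  have "\<exists>\<delta>>0. \<forall>\<tau>\<in>{0..T}. \<tau> \<noteq> t \<longrightarrow> dist \<tau> t < \<delta> \<longrightarrow> sobolev_norm s (\<lambda>x. v \<tau> x - v t x) < 1" if "t \<in> {0..T}" for t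
  proof -
    have "\<forall>\<^sub>F \<tau> in at t within {0..T}. sobolev_norm s (\<lambda>x. v \<tau> x - v t x) < 1"
      using v that by (intro order_tendstoD(2)[where y = 0]) (auto simp: continuous_in_sobolev_def)
    then show ?thesis by (auto simp: eventually_at)
  qed
  then obtain \<delta> where \<delta>: "\<And>t. t \<in> {0..T} \<Longrightarrow> 0 < \<delta> t"
    "\<And>t \<tau>. t \<in> {0..T} \<Longrightarrow> \<tau> \<in> {0..T} \<Longrightarrow> \<tau> \<noteq> t \<Longrightarrow> dist \<tau> t < \<delta> t \<Longrightarrow> sobolev_norm s (\<lambda>x. v \<tau> x - v t x) < 1"
    by metis
  define B where "B t = sqrt (2 * 1\<^sup>2 + 2 * (sobolev_norm s (v t))\<^sup>2)" for t
  have B: "sobolev_bounded s (B t) N (fourier_coeffs (v \<tau>))" if t: "t \<in> {0..T}" and \<tau>: "\<tau> \<in> {0..T}" "dist \<tau> t < \<delta> t" for t \<tau> N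
  proof -
    have "sobolev_bounded s 1 N (\<lambda>k. fourier_coeffs (v \<tau>) k - fourier_coeffs (v t) k)"
    proof (cases "\<tau> = t")
      case True
      then show ?thesis by (simp add: sobolev_bounded_def)
    next
      case False
      have "sobolev_bounded s 1 N (fourier_coeffs (\<lambda>x. v \<tau> x - v t x))"
        by (rule sobolev_bounded_mono[OF sobolev_bounded_coeffs[OF sobolev_torus_diff[OF vs[OF \<tau>(1)] vs[OF t]]] order_refl])
           (use \<delta>(2)[OF t \<tau>(1) False \<tau>(2)] in simp)
      then show ?thesis by (simp add: fourier_coeffs_diff[OF vs[OF \<tau>(1)] vs[OF t]] sobolev_bounded_def)
    qed
    then show ?thesis unfolding B_def by (rule sobolev_bounded_triangle[OF _ sobolev_bounded_coeffs[OF vs[OF t]]])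
  qed
  obtain D where D: "D \<subseteq> {0..T}" "finite D" "{0..T} \<subseteq> (\<Union>t\<in>D. ball t (\<delta> t))"
  proof (rule compactE_image[of "{0..T}" "{0..T}" "\<lambda>t. ball t (\<delta> t)"])
    show "{0..T} \<subseteq> (\<Union>t\<in>{0..T}. ball t (\<delta> t))" using \<delta>(1) by force
  qed auto
  have Bnn: "0 \<le> B t" for t by (simp add: B_def)
  show ?thesis
  proof
    fix t N assume t: "t \<in> {0..T}"
    then obtain t' where t': "t' \<in> D" "dist t t' < \<delta> t'" using D by (force simp: dist_commute)
    show "sobolev_bounded s (\<Sum>t\<in>D. B t) N (fourier_coeffs (v t))"
      by (rule sobolev_bounded_mono[OF B[OF _ t t'(2)] order_refl])
         (use t' D Bnn in \<open>auto intro: member_le_sum\<close>)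
  qed
qed

lemma continuous_on_fourier_coeffs:
  assumes v: "continuous_in_sobolev s T v" and s: "0 \<le> s" and k: "1 \<le> k"
  shows "continuous_on {0..T} (\<lambda>t. fourier_coeffs (v t) k)"
  unfolding continuous_on_def
proof
  fix t assume t: "t \<in> {0..T}"
  have vs: "v t \<in> sobolev_torus s" if "t \<in> {0..T}" for t using v that by (simp add: continuous_in_sobolev_def)
  have "((\<lambda>\<tau>. fourier_coeffs (v \<tau>) k - fourier_coeffs (v t) k) \<longlongrightarrow> 0) (at t within {0..T})"
  proof (rule Lim_null_comparison)
    show "((\<lambda>\<tau>. sobolev_norm s (\<lambda>x. v \<tau> x - v t x)) \<longlongrightarrow> 0) (at t within {0..T})"
      using v t by (simp add: continuous_in_sobolev_def)
    have "cmod (fourier_coeffs (v \<tau>) k - fourier_coeffs (v t) k) \<le> sobolev_norm s (\<lambda>x. v \<tau> x - v t x)" if \<tau>: "\<tau> \<in> {0..T}" for \<tau>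
      using sobolev_bounded_coeff[OF s sobolev_bounded_coeffs[OF sobolev_torus_diff[OF vs[OF \<tau>] vs[OF t]]], of k k] k
      by (simp add: fourier_coeffs_diff[OF vs[OF \<tau>] vs[OF t]])
    then show "\<forall>\<^sub>F \<tau> in at t within {0..T}. norm (fourier_coeffs (v \<tau>) k - fourier_coeffs (v t) k) \<le> sobolev_norm s (\<lambda>x. v \<tau> x - v t x)"
      by (auto simp: eventually_at_filter)
  qed
  then show "((\<lambda>\<tau>. fourier_coeffs (v \<tau>) k) \<longlongrightarrow> fourier_coeffs (v t) k) (at t within {0..T})" by (simp add: LIM_zero_iff)
qed

lemma continuous_on_cubic_limit:
  assumes \<sigma>: "0 \<le> \<sigma>" "\<sigma> \<le> 1" and s: "3 / 2 < s" and k: "1 \<le> k"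
    and R: "\<And>t N. t \<in> S \<Longrightarrow> sobolev_bounded s R N (c t)"
    and cont: "\<And>j. 1 \<le> j \<Longrightarrow> continuous_on S (\<lambda>t. c t j)"
  shows "continuous_on S (\<lambda>t. cubic_limit \<sigma> (c t) k)"
proof (rule uniform_limit_theorem)
  show "\<forall>\<^sub>F n in sequentially. continuous_on S (\<lambda>t. cubic \<sigma> n (c t) k)"
  proof (intro always_eventually allI)
    fix n
    have "continuous_on S (\<lambda>t. of_real (coupling \<sigma> (fst x) (fst (snd x)) (snd (snd x)) k) * (c t (fst x) * cnj (c t (fst (snd x))) * c t (snd (snd x))))"
      if "x \<in> triads n k" for x
      using that by (intro continuous_intros cont) (auto simp: triads_def)
    then show "continuous_on S (\<lambda>t. cubic \<sigma> n (c t) k)"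
      unfolding trilinear_def case_prod_unfold by (intro continuous_on_sum)
  qed
  show "uniform_limit S (\<lambda>n t. cubic \<sigma> n (c t) k) (\<lambda>t. cubic_limit \<sigma> (c t) k) sequentially"
  proof (rule uniform_limitI)
    fix e :: real assume "0 < e"
    then have "\<forall>\<^sub>F n in sequentially. truncation_error s R n < e"
      by (rule order_tendstoD(2)[OF truncation_error_tendsto_0[OF s]])
    then show "\<forall>\<^sub>F n in sequentially. \<forall>t\<in>S. dist (cubic \<sigma> n (c t) k) (cubic_limit \<sigma> (c t) k) < e"
    proof eventually_elim
      case (elim n)
      show ?case
      proof
        fix t assume t: "t \<in> S"
        have "1 * cmod (cubic_limit \<sigma> (c t) k - cubic \<sigma> n (c t) k) \<le> real k * cmod (cubic_limit \<sigma> (c t) k - cubic \<sigma> n (c t) k)"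
          using k by (intro mult_right_mono) auto
        also have "\<dots> \<le> (\<Sum>k\<in>{1..k}. real k * cmod (cubic_limit \<sigma> (c t) k - cubic \<sigma> n (c t) k))"
          using k by (intro member_le_sum) auto
        also have "\<dots> \<le> truncation_error s R n" by (rule cubic_limit_truncation[OF \<sigma> s R[OF t]])
        finally show "dist (cubic \<sigma> n (c t) k) (cubic_limit \<sigma> (c t) k) < e"
          using elim by (simp add: dist_norm norm_minus_commute)
      qed
    qed
  qed
qed simp

lemma set_integral_eq_integral_continuous:
  fixes f :: "real \<Rightarrow> complex"
  assumes "continuous_on {a..b} f"
  shows "(LBINT t:{a..b}. f t) = integral {a..b} f"
  by (rule set_borel_integral_eq_integral(2)[OF borel_integrable_atLeastAtMost'[OF assms]])

text \<open>
  Testing with \<open>\<psi>(t) e\<^sup>-\<^sup>i\<^sup>k\<^sup>x\<close> shows that the \<open>k\<close>-th coefficient minus the primitive \<open>F\<close> of the right-hand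
  side has vanishing distributional derivative.
\<close>

lemma weak_solution_imp_ode:
  assumes \<sigma>: "0 \<le> \<sigma>" "\<sigma> \<le> 1" and s: "3 / 2 < s" and T: "0 < T"
    and v: "continuous_in_sobolev s T v" and pos: "\<And>t. t \<in> {0..T} \<Longrightarrow> ae_eq (proj_pos (v t)) (v t)"
    and weak: "solves_filamentation_eq \<sigma> T v" and k: "1 \<le> k" and t: "t \<in> {0..T}"
  shows "((\<lambda>t. fourier_coeffs (v t) k) has_vector_derivative \<i> * of_real (real k) * cubic_limit \<sigma> (fourier_coeffs (v t)) k) (at t within {0..T})"
proof -
  have vs: "v t \<in> sobolev_torus s" if "t \<in> {0..T}" for t using v that by (simp add: continuous_in_sobolev_def)
  obtain R where R: "\<And>t N. t \<in> {0..T} \<Longrightarrow> sobolev_bounded s R N (fourier_coeffs (v t))"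
    using continuous_in_sobolev_bounded[OF v] by blast
  define c where "c t = fourier_coeffs (v t) k" for t
  define C where "C t = cubic_limit \<sigma> (fourier_coeffs (v t)) k" for t
  have cont_c: "continuous_on {0..T} c" unfolding c_def[abs_def] using s k by (intro continuous_on_fourier_coeffs[OF v]) auto
  have cont_C: "continuous_on {0..T} C" unfolding C_def[abs_def]
    using s by (intro continuous_on_cubic_limit[OF \<sigma> s k R] continuous_on_fourier_coeffs[OF v]) auto
  define F where "F t = integral {0..t} (\<lambda>\<tau>. \<i> * of_real (real k) * C \<tau>)" for t
  have dF: "(F has_vector_derivative \<i> * of_real (real k) * C t) (at t within {0..T})" if "t \<in> {0..T}" for t
    unfolding F_def[abs_def] using that by (intro integral_has_vector_derivative continuous_intros cont_C)
  have cont_F: "continuous_on {0..T} F"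
    by (rule continuous_on_vector_derivative) (rule dF)
  have "c t - F t = c 0 - F 0" if "t \<in> {0..T}" for t
  proof (rule du_Bois_Reymond[OF _ T _ that])
    show "continuous_on {0..T} (\<lambda>t. c t - F t)" by (intro continuous_intros cont_c cont_F)
    fix \<psi> \<eta> a b assume \<eta>: "flat_fun \<eta>" and \<psi>: "\<And>t. (\<psi> has_real_derivative \<eta> t) (at t)"
      and ab: "0 < a" "b < T" "\<And>t. \<psi> t \<noteq> 0 \<Longrightarrow> t \<in> {a..b}"
    have cont_\<eta>: "continuous_on S \<eta>" for S by (rule flat_fun_continuous[OF \<eta>])
    have cont_\<psi>: "continuous_on S \<psi>" for S by (rule DERIV_continuous_on[OF has_field_derivative_at_within[OF \<psi>]])
    define \<phi> where "\<phi> t x = of_real (\<psi> t) * 1 * expi (- int k) x" for t x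
    have test: "test_function T \<phi>" unfolding \<phi>_def[abs_def] by (rule test_function_separated[OF \<eta> \<psi> ab])
    have pt: "partial_t \<phi> = (\<lambda>t x. of_real (\<eta> t) * 1 * expi (- int k) x)"
      and px: "partial_x \<phi> = (\<lambda>t x. of_real (\<psi> t) * (1 * \<i> * of_int (- int k)) * expi (- int k) x)"
      unfolding \<phi>_def[abs_def] separated_partials[OF \<psi>] by (rule refl)+
    have fc: "(LBINT x:{0..2 * pi}. f x * (z * expi (- int k) x)) = z * (2 * of_real pi * fourier_coeff f (int k))" for f z
    proof -
      have "(LBINT x:{0..2 * pi}. f x * (z * expi (- int k) x)) = z * (LBINT x:{0..2 * pi}. f x * expi (- int k) x)"
        by (subst set_integral_mult_right[symmetric]) (simp add: mult_ac)
      then show ?thesis by (simp add: fourier_coeff_expi)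
    qed
    have "(LBINT t:{0..T}. LBINT x:{0..2 * pi}. v t x * partial_t \<phi> t x)
      = (LBINT t:{0..T}. (2 * of_real pi) * (c t * of_real (\<eta> t)))"
      unfolding pt by (intro set_lebesgue_integral_cong) (auto simp: fc c_def fourier_coeffs_def)
    also have "\<dots> = 2 * of_real pi * integral {0..T} (\<lambda>t. c t * of_real (\<eta> t))"
      by (subst set_integral_mult_right, subst set_integral_eq_integral_continuous)
         (auto intro!: continuous_intros cont_c cont_\<eta>)
    finally have 1: "(LBINT t:{0..T}. LBINT x:{0..2 * pi}. v t x * partial_t \<phi> t x)
      = 2 * of_real pi * integral {0..T} (\<lambda>t. c t * of_real (\<eta> t))" .
    have cub: "fourier_coeff (cubic_term \<sigma> (v t)) (int k) = C t" if t: "t \<in> {0..T}" for t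
      unfolding C_def
    proof (rule cubic_term_series(3)[OF _ _ _ _ _ k])
      show "v t \<in> L2_torus" using vs[OF t] by (simp add: sobolev_torus_def)
    qed (use positive_spectrum_series[OF s vs[OF t] pos[OF t]] sobolev_bounded_summable_wiener[OF s R[OF t]]
          summable_cubic_coeffs[OF \<sigma> s R[OF t]] in auto)
    have inner: "(LBINT x:{0..2 * pi}. cubic_term \<sigma> (v t) x * partial_x \<phi> t x)
      = (2 * of_real pi) * (- (\<i> * of_real (real k) * C t * of_real (\<psi> t)))" if "t \<in> {0..T}" for t
      unfolding px fc cub[OF that] by (simp add: mult_ac)
    have "(LBINT t:{0..T}. LBINT x:{0..2 * pi}. cubic_term \<sigma> (v t) x * partial_x \<phi> t x)
      = (LBINT t:{0..T}. (2 * of_real pi) * (- (\<i> * of_real (real k) * C t * of_real (\<psi> t))))"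
      by (intro set_lebesgue_integral_cong) (auto simp: inner)
    also have "\<dots> = 2 * of_real pi * integral {0..T} (\<lambda>t. - (\<i> * of_real (real k) * C t * of_real (\<psi> t)))"
      by (subst set_integral_mult_right, subst set_integral_eq_integral_continuous)
         (auto intro!: continuous_intros cont_C cont_\<psi>)
    finally have 2: "(LBINT t:{0..T}. LBINT x:{0..2 * pi}. cubic_term \<sigma> (v t) x * partial_x \<phi> t x)
      = 2 * of_real pi * integral {0..T} (\<lambda>t. - (\<i> * of_real (real k) * C t * of_real (\<psi> t)))" .
    have eq: "integral {0..T} (\<lambda>t. c t * of_real (\<eta> t)) = integral {0..T} (\<lambda>t. - (\<i> * of_real (real k) * C t * of_real (\<psi> t)))"
    proof -
      have "(LBINT t:{0..T}. LBINT x:{0..2 * pi}. v t x * partial_t \<phi> t x)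
        = (LBINT t:{0..T}. LBINT x:{0..2 * pi}. cubic_term \<sigma> (v t) x * partial_x \<phi> t x)"
        using weak test unfolding solves_filamentation_eq_def by blast
      then show ?thesis unfolding 1 2 by (simp only: mult_cancel_left) simp
    qed
    have "((\<lambda>t. F t * of_real (\<eta> t) + \<i> * of_real (real k) * C t * of_real (\<psi> t)) has_integral
        (F T * of_real (\<psi> T) - F 0 * of_real (\<psi> 0))) {0..T}"
    proof (rule fundamental_theorem_of_calculus)
      fix t assume t: "t \<in> {0..T}"
      have "((\<lambda>t. complex_of_real (\<psi> t)) has_vector_derivative of_real (\<eta> t)) (at t within {0..T})"
        using \<psi>[of t] by (intro has_vector_derivative_of_real has_vector_derivative_at_within)
          (simp add: has_real_derivative_iff_has_vector_derivative)
      from has_vector_derivative_mult[OF dF[OF t] this]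
      show "((\<lambda>t. F t * of_real (\<psi> t)) has_vector_derivative F t * of_real (\<eta> t) + \<i> * of_real (real k) * C t * of_real (\<psi> t)) (at t within {0..T})" .
    qed (use T in auto)
    moreover have "\<psi> T = 0" "\<psi> 0 = 0" using ab(1,2) ab(3)[of T] ab(3)[of 0] by auto
    ultimately have "integral {0..T} (\<lambda>t. F t * of_real (\<eta> t) + \<i> * of_real (real k) * C t * of_real (\<psi> t)) = 0"
      by (simp add: integral_unique)
    moreover have "integral {0..T} (\<lambda>t. F t * of_real (\<eta> t) + \<i> * of_real (real k) * C t * of_real (\<psi> t))
      = integral {0..T} (\<lambda>t. F t * of_real (\<eta> t)) + integral {0..T} (\<lambda>t. \<i> * of_real (real k) * C t * of_real (\<psi> t))"
      by (intro Henstock_Kurzweil_Integration.integral_add integrable_continuous_real continuous_intros cont_F cont_\<eta> cont_C cont_\<psi>)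
    moreover have "integral {0..T} (\<lambda>t. - (\<i> * of_real (real k) * C t * of_real (\<psi> t))) = - integral {0..T} (\<lambda>t. \<i> * of_real (real k) * C t * of_real (\<psi> t))"
      by (rule Henstock_Kurzweil_Integration.integral_neg)
    moreover have "X = Y" if "S = 0" "S = Y + Z" "W = - Z" "X = W" for S W X Y Z :: complex
      using that by algebra
    ultimately have "integral {0..T} (\<lambda>t. c t * of_real (\<eta> t)) = integral {0..T} (\<lambda>t. F t * of_real (\<eta> t))"
      using eq by blast
    moreover have "integral {0..T} (\<lambda>t. (c t - F t) * of_real (\<eta> t))
      = integral {0..T} (\<lambda>t. c t * of_real (\<eta> t)) - integral {0..T} (\<lambda>t. F t * of_real (\<eta> t))"
      unfolding left_diff_distrib
      by (intro Henstock_Kurzweil_Integration.integral_diff integrable_continuous_real continuous_intros cont_F cont_\<eta> cont_c)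
    ultimately show "integral {0..T} (\<lambda>t. (c t - F t) * of_real (\<eta> t)) = 0" by simp
  qed
  then have eq: "c t = (c 0 - F 0) + F t" if "t \<in> {0..T}" for t using that by (simp add: algebra_simps)
  have der: "((\<lambda>t. (c 0 - F 0) + F t) has_vector_derivative 0 + \<i> * of_real (real k) * C t) (at t within {0..T})"
    by (intro has_vector_derivative_add has_vector_derivative_const dF t)
  have "(c has_vector_derivative 0 + \<i> * of_real (real k) * C t) (at t within {0..T})"
    by (rule has_vector_derivative_transform[OF t _ der]) (rule eq)
  then show ?thesis by (simp add: c_def[abs_def] C_def)
qed

section \<open>From the coefficient system to distributional solutions\<close>

text \<open>
  Partial sums that are bounded uniformly in time suffice for dominated convergence.
\<close>

lemma integral_sums:
  fixes f :: "nat \<Rightarrow> real \<Rightarrow> complex"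
  assumes cont: "\<And>n. continuous_on {0..T} (f n)" and sums: "\<And>t. t \<in> {0..T} \<Longrightarrow> (\<lambda>n. f n t) sums F t"
    and bound: "\<And>t N. t \<in> {0..T} \<Longrightarrow> cmod (\<Sum>n<N. f n t) \<le> B"
  shows "(\<lambda>n. integral {0..T} (f n)) sums (LBINT t:{0..T}. F t)"
proof -
  define S where "S N t = indicator {0..T} t *\<^sub>R (\<Sum>n<N. f n t)" for N t
  have contS: "continuous_on {0..T} (\<lambda>t. \<Sum>n<N. f n t)" for N by (intro continuous_intros cont)
  have int: "integrable lborel (S N)" for N
    using borel_integrable_atLeastAtMost'[OF contS] by (simp add: set_integrable_def S_def[abs_def])
  have lim: "(\<lambda>N. S N t) \<longlonglongrightarrow> indicator {0..T} t *\<^sub>R F t" for t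
    unfolding S_def using sums[of t] by (cases "t \<in> {0..T}") (auto simp: sums_def)
  have "(\<lambda>N. integral\<^sup>L lborel (S N)) \<longlonglongrightarrow> (\<integral>t. indicator {0..T} t *\<^sub>R F t \<partial>lborel)"
  proof (rule integral_dominated_convergence)
    show m: "S N \<in> borel_measurable lborel" for N using int by simp
    show "(\<lambda>t. indicator {0..T} t *\<^sub>R F t) \<in> borel_measurable lborel"
      by (rule borel_measurable_LIMSEQ_metric[OF m lim])
    show "integrable lborel (\<lambda>t. indicator {0..T} t *\<^sub>R B)"
      using borel_integrable_atLeastAtMost'[of 0 T "\<lambda>_. B"] by (simp add: set_integrable_def)
    show "AE t in lborel. (\<lambda>N. S N t) \<longlonglongrightarrow> indicator {0..T} t *\<^sub>R F t" by (intro AE_I2 lim)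
    show "AE t in lborel. norm (S N t) \<le> indicator {0..T} t *\<^sub>R B" for N
      by (intro AE_I2) (auto simp: S_def indicator_def bound)
  qed
  moreover have "integral\<^sup>L lborel (S N) = (\<Sum>n<N. integral {0..T} (f n))" for N
  proof -
    have "integral\<^sup>L lborel (S N) = integral {0..T} (\<lambda>t. \<Sum>n<N. f n t)"
      using set_integral_eq_integral_continuous[OF contS] by (simp add: set_lebesgue_integral_def S_def[abs_def])
    also have "\<dots> = (\<Sum>n<N. integral {0..T} (f n))"
      by (intro Henstock_Kurzweil_Integration.integral_sum integrable_continuous_real cont) auto
    finally show ?thesis .
  qed
  ultimately show ?thesis by (simp add: sums_def set_lebesgue_integral_def)
qed

lemma joint_continuous_slice:
  assumes "continuous_on UNIV (\<lambda>(t, x). \<phi> t x :: complex)"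
  shows "continuous_on S (\<phi> t)"
proof -
  have "continuous_on S (\<lambda>x. (\<lambda>(t, x). \<phi> t x) (t, x))"
    by (rule continuous_on_compose2[OF assms]) (auto intro!: continuous_intros)
  then show ?thesis by simp
qed

text \<open>
  Let \<open>\<Phi>\<^sub>n(t)\<close> be the integral of \<open>e\<^sup>i\<^sup>n\<^sup>x \<phi>(t, x)\<close>.  Both sides of the weak equation are series over \<open>n\<close>,
  and by the coefficient system and an integration by parts in \<open>x\<close> the difference of their \<open>n\<close>-th terms is
  the integral of \<open>(a\<^sub>n \<Phi>\<^sub>n)'\<close>, which vanishes because \<open>\<phi>\<close> is supported away from the end points.
\<close>

lemma ode_imp_weak_solution:
  assumes \<sigma>: "0 \<le> \<sigma>" "\<sigma> \<le> 1" and s: "3 / 2 < s" and T: "0 < T"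
    and R: "\<And>t N. t \<in> {0..T} \<Longrightarrow> sobolev_bounded s R N (a t)" and a0: "\<And>t. a t 0 = 0"
    and da: "\<And>t k. t \<in> {0..T} \<Longrightarrow> 1 \<le> k \<Longrightarrow>
       ((\<lambda>t. a t k) has_vector_derivative \<i> * of_real (real k) * cubic_limit \<sigma> (a t) k) (at t within {0..T})"
  shows "solves_filamentation_eq \<sigma> T (\<lambda>t. fourier_series (a t))"
  unfolding solves_filamentation_eq_def
proof (intro allI impI)
  fix \<phi> assume test: "test_function T \<phi>"
  define \<phi>t where "\<phi>t = partial_t \<phi>"
  define \<phi>x where "\<phi>x = partial_x \<phi>"
  define d where "d t = cubic_coeffs \<sigma> (a t)" for t
  have sm: "smooth \<phi>" and per: "\<And>t x. \<phi> t (x + 2 * pi) = \<phi> t x" using test by (auto simp: test_function_def)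
  obtain \<alpha> \<beta> where supp: "0 < \<alpha>" "\<beta> < T" "\<And>t x. \<phi> t x \<noteq> 0 \<Longrightarrow> t \<in> {\<alpha>..\<beta>}"
    using test unfolding test_function_def by blast
  have cont: "continuous_on UNIV (\<lambda>(t, x). \<phi> t x)"
    and diff_t: "\<And>t x. (\<lambda>\<tau>. \<phi> \<tau> x) differentiable (at t)"
    and diff_x: "\<And>t x. (\<lambda>y. \<phi> t y) differentiable (at x)"
    and sm_t: "smooth \<phi>t" and sm_x: "smooth \<phi>x"
    using sm unfolding \<phi>t_def \<phi>x_def by (auto elim: smooth.cases)
  have cont_t: "continuous_on UNIV (\<lambda>(t, x). \<phi>t t x)" using sm_t by (rule smooth.cases) simp
  have cont_x: "continuous_on UNIV (\<lambda>(t, x). \<phi>x t x)" using sm_x by (rule smooth.cases) simp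
  have d_t: "((\<lambda>\<tau>. \<phi> \<tau> x) has_vector_derivative \<phi>t t x) (at t within S)" for t x S
    unfolding \<phi>t_def partial_t_def
    by (rule has_vector_derivative_at_within[OF vector_derivative_works[THEN iffD1, OF diff_t]])
  have d_x: "((\<lambda>y. \<phi> t y) has_vector_derivative \<phi>x t x) (at x within S)" for t x S
    unfolding \<phi>x_def partial_x_def
    by (rule has_vector_derivative_at_within[OF vector_derivative_works[THEN iffD1, OF diff_x]])
  have bounded: "\<exists>M. 0 \<le> M \<and> (\<forall>t\<in>{0..T}. \<forall>x\<in>{0..2 * pi}. cmod (g t x) \<le> M)"
    if "continuous_on UNIV (\<lambda>(t, x). g t x)" for g :: "real \<Rightarrow> real \<Rightarrow> complex"
  proof -
    have "bounded ((\<lambda>(t, x). g t x) ` ({0..T} \<times> {0..2 * pi}))"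
      by (intro compact_imp_bounded compact_continuous_image continuous_on_subset[OF that] compact_Times) auto
    then obtain M where "\<forall>z\<in>(\<lambda>(t, x). g t x) ` ({0..T} \<times> {0..2 * pi}). norm z \<le> M" unfolding bounded_iff by blast
    then show ?thesis by (intro exI[of _ "max 0 M"]) (force simp: le_max_iff_disj)
  qed
  obtain Mt where Mt: "0 \<le> Mt" "\<And>t x. t \<in> {0..T} \<Longrightarrow> x \<in> {0..2 * pi} \<Longrightarrow> cmod (\<phi>t t x) \<le> Mt" using bounded[OF cont_t] by blast
  obtain Mx where Mx: "0 \<le> Mx" "\<And>t x. t \<in> {0..T} \<Longrightarrow> x \<in> {0..2 * pi} \<Longrightarrow> cmod (\<phi>x t x) \<le> Mx" using bounded[OF cont_x] by blast
  define \<Phi> where "\<Phi> g n t = integral {0..2 * pi} (\<lambda>x. expi (int n) x * g t x)" for g :: "real \<Rightarrow> real \<Rightarrow> complex" and n t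
  have slice: "continuous_on {0..2 * pi} (\<lambda>x. expi (int n) x * g t x)" if "continuous_on UNIV (\<lambda>(t, x). g t x)" for g n t
    by (intro continuous_intros joint_continuous_slice[OF that])
  have \<Phi>_LBINT: "(LBINT x:{0..2 * pi}. expi (int n) x * g t x) = \<Phi> g n t" if "continuous_on UNIV (\<lambda>(t, x). g t x)" for g n t
    unfolding \<Phi>_def by (rule set_integral_eq_integral_continuous[OF slice[OF that]])
  have joint: "continuous_on (S \<times> {0..2 * pi}) (\<lambda>(t, x). expi (int n) x * g t x)" if "continuous_on UNIV (\<lambda>(t, x). g t x)" for g n S
  proof -
    have "continuous_on (S \<times> {0..2 * pi}) (\<lambda>z. expi (int n) (snd z) * (\<lambda>(t, x). g t x) z)"
      by (intro continuous_intros continuous_on_subset[OF that]) auto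
    then show ?thesis by (simp add: case_prod_unfold)
  qed
  have \<Phi>_cont: "continuous_on {0..T} (\<Phi> g n)" if "continuous_on UNIV (\<lambda>(t, x). g t x)" for g n
    unfolding \<Phi>_def[abs_def]
    by (rule integral_continuous_on_param[of "{0..T}" 0 "2 * pi" "\<lambda>t x. expi (int n) x * g t x",
          unfolded cbox_interval, OF joint[OF that]])
  have \<Phi>_bound: "cmod (\<Phi> g n t) \<le> M * (2 * pi)" if "continuous_on UNIV (\<lambda>(t, x). g t x)" "0 \<le> M"
      "\<And>x. x \<in> {0..2 * pi} \<Longrightarrow> cmod (g t x) \<le> M" for g n t M
    unfolding \<Phi>_LBINT[OF that(1), symmetric]
    using norm_set_integral_le_const[of 0 "2 * pi" "\<lambda>x. expi (int n) x * g t x" M] that by (simp add: norm_mult)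
  have d\<Phi>: "((\<lambda>t. \<Phi> \<phi> n t) has_vector_derivative \<Phi> \<phi>t n t) (at t within {0..T})" if "t \<in> {0..T}" for n t
  proof -
    have "((\<lambda>t. integral (cbox 0 (2 * pi)) (\<lambda>x. expi (int n) x * \<phi> t x)) has_vector_derivative
        integral (cbox 0 (2 * pi)) (\<lambda>x. expi (int n) x * \<phi>t t x)) (at t within {0..T})"
    proof (rule leibniz_rule_vector_derivative)
      show "((\<lambda>t. expi (int n) x * \<phi> t x) has_vector_derivative expi (int n) x * \<phi>t t x) (at t within {0..T})" for t x
        by (rule has_vector_derivative_mult_right[OF d_t])
      show "(\<lambda>x. expi (int n) x * \<phi> t x) integrable_on cbox 0 (2 * pi)" for t
        using integrable_continuous_real[OF slice[OF cont]] by (simp add: cbox_interval)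
      show "continuous_on ({0..T} \<times> cbox 0 (2 * pi)) (\<lambda>(t, x). expi (int n) x * \<phi>t t x)"
        using joint[OF cont_t] by (simp add: cbox_interval)
    qed (use that in auto)
    then show ?thesis by (simp add: \<Phi>_def cbox_interval)
  qed
  have parts: "\<Phi> \<phi>x n t = - (\<i> * of_real (real n) * \<Phi> \<phi> n t)" for n t
  proof -
    have "((\<lambda>x. expi (int n) x * \<phi>x t x + \<i> * of_int (int n) * expi (int n) x * \<phi> t x) has_integral
        (expi (int n) (2 * pi) * \<phi> t (2 * pi) - expi (int n) 0 * \<phi> t 0)) {0..2 * pi}"
      by (intro fundamental_theorem_of_calculus has_vector_derivative_mult expi_has_derivative d_x) auto
    moreover have "expi (int n) (2 * pi) * \<phi> t (2 * pi) - expi (int n) 0 * \<phi> t 0 = 0"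
      using expi_periodic[of "int n" 0] per[of t 0] by simp
    ultimately have "integral {0..2 * pi} (\<lambda>x. expi (int n) x * \<phi>x t x + \<i> * of_int (int n) * expi (int n) x * \<phi> t x) = 0"
      by (simp add: integral_unique)
    also have "integral {0..2 * pi} (\<lambda>x. expi (int n) x * \<phi>x t x + \<i> * of_int (int n) * expi (int n) x * \<phi> t x)
      = \<Phi> \<phi>x n t + integral {0..2 * pi} (\<lambda>x. \<i> * of_int (int n) * (expi (int n) x * \<phi> t x))"
      unfolding \<Phi>_def mult.assoc
      by (intro Henstock_Kurzweil_Integration.integral_add integrable_continuous_real slice[OF cont_x] continuous_on_mult_left continuous_on_const
          continuous_on_mult slice[OF cont])
    also have "integral {0..2 * pi} (\<lambda>x. \<i> * of_int (int n) * (expi (int n) x * \<phi> t x)) = \<i> * of_int (int n) * \<Phi> \<phi> n t"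
      unfolding \<Phi>_def by (rule integral_mult_right)
    finally show ?thesis by (simp add: add_eq_0_iff2)
  qed
  have a_sm: "summable (\<lambda>n. real n * cmod (a t n))" if "t \<in> {0..T}" for t
    by (rule sobolev_bounded_summable_wiener[OF s R[OF that]])
  have cont_a: "continuous_on {0..T} (\<lambda>t. a t n)" for n
  proof (cases "n = 0")
    case False
    then show ?thesis by (intro continuous_on_vector_derivative[OF da]) auto
  qed (simp add: a0)
  have cont_d: "continuous_on {0..T} (\<lambda>t. d t n)" for n
    unfolding d_def cubic_coeffs_def using continuous_on_cubic_limit[OF \<sigma> s _ R cont_a, of n]
    by (cases "n = 0") auto
  define f where "f n t = a t n * \<Phi> \<phi>t n t" for n t
  define g where "g n t = d t n * \<Phi> \<phi>x n t" for n t
  have cf: "continuous_on {0..T} (f n)" for n unfolding f_def[abs_def] by (intro continuous_intros cont_a \<Phi>_cont cont_t)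
  have cg: "continuous_on {0..T} (g n)" for n unfolding g_def[abs_def] by (intro continuous_intros cont_d \<Phi>_cont cont_x)
  have sums_f: "(\<lambda>n. f n t) sums (LBINT x:{0..2 * pi}. fourier_series (a t) x * \<phi>t t x)" if t: "t \<in> {0..T}" for t
    using fourier_series_integral[OF summable_of_wiener[OF a_sm[OF t]] borel_measurable_continuous_onI[OF joint_continuous_slice[OF cont_t, of UNIV t]] Mt(2)[OF t]]
    by (simp add: \<Phi>_LBINT[OF cont_t] f_def)
  have sums_g: "(\<lambda>n. g n t) sums (LBINT x:{0..2 * pi}. cubic_term \<sigma> (fourier_series (a t)) x * \<phi>x t x)" if t: "t \<in> {0..T}" for t
  proof -
    have d_sm: "summable (\<lambda>k. cmod (cubic_coeffs \<sigma> (a t) k))" by (rule summable_cubic_coeffs[OF \<sigma> s R[OF t]])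
    have L2: "fourier_series (a t) \<in> L2_torus" by (rule fourier_series_L2[OF summable_of_wiener[OF a_sm[OF t]]])
    note ct = cubic_term_series[OF L2 _ a_sm[OF t] a0 d_sm]
    have "(LBINT x:{0..2 * pi}. cubic_term \<sigma> (fourier_series (a t)) x * \<phi>x t x)
      = (LBINT x:{0..2 * pi}. fourier_series (d t) x * \<phi>x t x)"
      unfolding d_def
    proof (rule set_integral_cong_ae_eq)
      show "ae_eq (cubic_term \<sigma> (fourier_series (a t))) (fourier_series (cubic_coeffs \<sigma> (a t)))"
        by (rule ct(2)) (simp add: ae_eq_def)
      show "cubic_term \<sigma> (fourier_series (a t)) \<in> borel_measurable borel"
        using ct(1) by (simp add: ae_eq_def L2_torus_def)
      show "fourier_series (cubic_coeffs \<sigma> (a t)) \<in> borel_measurable borel"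
        using fourier_series_L2[OF d_sm] by (simp add: L2_torus_def)
      show "\<phi>x t \<in> borel_measurable borel"
        by (rule borel_measurable_continuous_onI[OF joint_continuous_slice[OF cont_x]])
    qed
    then show ?thesis
      using fourier_series_integral[OF d_sm borel_measurable_continuous_onI[OF joint_continuous_slice[OF cont_x, of UNIV t]] Mx(2)[OF t]]
      by (simp add: \<Phi>_LBINT[OF cont_x] g_def d_def)
  qed
  have bound_f: "cmod (\<Sum>n<N. f n t) \<le> wiener_tail s 0 * R * (Mt * (2 * pi))" if t: "t \<in> {0..T}" for t N
  proof -
    have "cmod (\<Sum>n<N. f n t) \<le> (\<Sum>n<N. cmod (a t n) * (Mt * (2 * pi)))"
      by (rule sum_norm_le) (auto simp: f_def norm_mult intro!: mult_left_mono \<Phi>_bound[OF cont_t Mt(1) Mt(2)[OF t]])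
    also have "\<dots> = (\<Sum>n<N. cmod (a t n)) * (Mt * (2 * pi))" by (simp add: sum_distrib_right)
    also have "(\<Sum>n<N. cmod (a t n)) \<le> (\<Sum>n\<in>insert 0 {1..N}. real n * cmod (a t n))"
    proof -
      have "(\<Sum>n<N. cmod (a t n)) \<le> (\<Sum>n<N. real n * cmod (a t n))"
      proof (rule sum_mono)
        fix n show "cmod (a t n) \<le> real n * cmod (a t n)"
          using a0[of t] mult_right_mono[of 1 "real n" "cmod (a t n)"] by (cases "n = 0") auto
      qed
      also have "\<dots> \<le> (\<Sum>n\<in>insert 0 {1..N}. real n * cmod (a t n))" by (intro sum_mono2) auto
      finally show ?thesis .
    qed
    also have "\<dots> = (\<Sum>n\<in>{1..N}. real n * cmod (a t n))" by simp
    also have "\<dots> \<le> wiener_tail s 0 * R" by (rule wiener_bound[OF s R[OF t]])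
    finally show ?thesis using Mt(1) by (simp add: mult_right_mono)
  qed
  have bound_g: "cmod (\<Sum>n<N. g n t) \<le> truncation_error s R 0 * (Mx * (2 * pi))" if t: "t \<in> {0..T}" for t N
  proof -
    have "cmod (\<Sum>n<N. g n t) \<le> (\<Sum>n<N. cmod (d t n) * (Mx * (2 * pi)))"
      by (rule sum_norm_le) (auto simp: g_def norm_mult intro!: mult_left_mono \<Phi>_bound[OF cont_x Mx(1) Mx(2)[OF t]])
    also have "\<dots> = (\<Sum>n<N. cmod (d t n)) * (Mx * (2 * pi))" by (simp add: sum_distrib_right)
    also have "\<dots> \<le> truncation_error s R 0 * (Mx * (2 * pi))"
      unfolding d_def using Mx(1) by (intro mult_right_mono cubic_coeffs_partial_sums[OF \<sigma> s R[OF t]]) auto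
    finally show ?thesis .
  qed
  have fg: "integral {0..T} (f n) = integral {0..T} (g n)" for n
  proof (cases "n = 0")
    case True
    then show ?thesis by (simp add: f_def[abs_def] g_def[abs_def] a0 d_def cubic_coeffs_def)
  next
    case False
    have "((\<lambda>t. f n t - g n t) has_integral (a T n * \<Phi> \<phi> n T - a 0 n * \<Phi> \<phi> n 0)) {0..T}"
    proof (rule fundamental_theorem_of_calculus)
      fix t assume t: "t \<in> {0..T}"
      have "((\<lambda>t. a t n * \<Phi> \<phi> n t) has_vector_derivative
         a t n * \<Phi> \<phi>t n t + \<i> * of_real (real n) * cubic_limit \<sigma> (a t) n * \<Phi> \<phi> n t) (at t within {0..T})"
        using has_vector_derivative_mult[OF da[OF t] d\<Phi>[OF t]] False by simp
      then show "((\<lambda>t. a t n * \<Phi> \<phi> n t) has_vector_derivative f n t - g n t) (at t within {0..T})"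
        using False by (simp add: f_def g_def parts d_def cubic_coeffs_def mult_ac)
    qed (use T in auto)
    moreover have "\<phi> T x = 0" "\<phi> 0 x = 0" for x using supp(3)[of T x] supp(3)[of 0 x] supp(1,2) by auto
    then have "\<Phi> \<phi> n T = 0" "\<Phi> \<phi> n 0 = 0" by (simp_all add: \<Phi>_def)
    ultimately have "integral {0..T} (\<lambda>t. f n t - g n t) = 0" by (simp add: integral_unique)
    then show ?thesis
      by (simp add: Henstock_Kurzweil_Integration.integral_diff[OF integrable_continuous_real[OF cf] integrable_continuous_real[OF cg]])
  qed
  have "(\<lambda>n. integral {0..T} (f n)) sums (LBINT t:{0..T}. LBINT x:{0..2 * pi}. fourier_series (a t) x * \<phi>t t x)"
    by (rule integral_sums[OF cf sums_f bound_f])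
  moreover have "(\<lambda>n. integral {0..T} (f n)) sums (LBINT t:{0..T}. LBINT x:{0..2 * pi}. cubic_term \<sigma> (fourier_series (a t)) x * \<phi>x t x)"
    unfolding fg by (rule integral_sums[OF cg sums_g bound_g])
  ultimately show "(LBINT t:{0..T}. LBINT x:{0..2 * pi}. fourier_series (a t) x * partial_t \<phi> t x)
    = (LBINT t:{0..T}. LBINT x:{0..2 * pi}. cubic_term \<sigma> (fourier_series (a t)) x * partial_x \<phi> t x)"
    unfolding \<phi>t_def \<phi>x_def by (rule sums_unique2)
qed

text \<open>
  The tails are small uniformly in time, and finitely many coefficients depend continuously on it.
\<close>

lemma fourier_series_continuous_in_sobolev:
  assumes s: "3 / 2 < s" and R: "\<And>t N. t \<in> {0..T} \<Longrightarrow> sobolev_bounded s R N (a t)" and a0: "\<And>t. a t 0 = 0"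
    and cont: "\<And>k. continuous_on {0..T} (\<lambda>t. a t k)"
    and \<theta>: "\<theta> \<longlonglongrightarrow> (0::real)"
    and tail: "\<And>N n t. 1 \<le> n \<Longrightarrow> t \<in> {0..T} \<Longrightarrow> sobolev_energy s n N (a t) \<le> \<theta> n"
  shows "continuous_in_sobolev s T (\<lambda>t. fourier_series (a t))"
  unfolding continuous_in_sobolev_def
proof (intro ballI conjI)
  fix t assume t: "t \<in> {0..T}"
  show "fourier_series (a t) \<in> sobolev_torus s" by (rule sobolev_series(1)[OF s R[OF t] a0])
  have sm: "summable (\<lambda>n. cmod (a t n))" if "t \<in> {0..T}" for t
    by (rule summable_of_wiener[OF sobolev_bounded_summable_wiener[OF s R[OF that]]])
  have diff: "(\<lambda>x. fourier_series (a \<tau>) x - fourier_series (a t) x) = fourier_series (\<lambda>k. a \<tau> k - a t k)"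
    if \<tau>: "\<tau> \<in> {0..T}" for \<tau>
  proof
    fix x
    have "(\<lambda>n. (a \<tau> n - a t n) * expi (int n) x) sums (fourier_series (a \<tau>) x - fourier_series (a t) x)"
      unfolding left_diff_distrib by (intro sums_diff fourier_series_sums sm t \<tau>)
    then show "fourier_series (a \<tau>) x - fourier_series (a t) x = fourier_series (\<lambda>k. a \<tau> k - a t k) x"
      unfolding fourier_series_def[of "\<lambda>k. a \<tau> k - a t k"] by (rule sums_unique)
  qed
  show "((\<lambda>\<tau>. sobolev_norm s (\<lambda>x. fourier_series (a \<tau>) x - fourier_series (a t) x)) \<longlongrightarrow> 0) (at t within {0..T})"
  proof (rule tendstoI)
    fix e :: real assume e: "0 < e"
    define e' where "e' = e / 2"
    have e': "0 < e'" "e' < e" using e by (auto simp: e'_def)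
    have "\<forall>\<^sub>F n in sequentially. \<theta> n < e'\<^sup>2 / 8"
      using e' by (intro order_tendstoD(2)[OF \<theta>]) auto
    then obtain n where n: "1 \<le> n" "\<theta> n < e'\<^sup>2 / 8" by (metis eventually_sequentially linorder_le_cases)
    define h where "h \<tau> = (\<Sum>k\<in>{1..<n}. sobolev_weight s k * (cmod (a \<tau> k - a t k))\<^sup>2)" for \<tau>
    have "(h \<longlongrightarrow> (\<Sum>k\<in>{1..<n}. sobolev_weight s k * (cmod (a t k - a t k))\<^sup>2)) (at t within {0..T})"
      unfolding h_def using cont t by (intro tendsto_intros) (auto simp: continuous_on_def)
    then have "(h \<longlongrightarrow> 0) (at t within {0..T})" by simp
    then have "\<forall>\<^sub>F \<tau> in at t within {0..T}. h \<tau> < e'\<^sup>2 / 2"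
      using e' by (intro order_tendstoD(2)) auto
    moreover have "\<forall>\<^sub>F \<tau> in at t within {0..T}. \<tau> \<in> {0..T}" by (simp add: eventually_at_filter)
    ultimately show "\<forall>\<^sub>F \<tau> in at t within {0..T}. dist (sobolev_norm s (\<lambda>x. fourier_series (a \<tau>) x - fourier_series (a t) x)) 0 < e"
    proof eventually_elim
      case (elim \<tau>)
      have "sobolev_bounded s e' N (\<lambda>k. a \<tau> k - a t k)" for N
      proof -
        define G where "G k = sobolev_weight s k * (cmod (a \<tau> k - a t k))\<^sup>2" for k
        have G: "0 \<le> G k" for k using less_imp_le[OF sobolev_weight_pos[of s k]] by (simp add: G_def)
        have "sum G {n..N} \<le> (\<Sum>k\<in>{n..N}. 2 * (sobolev_weight s k * (cmod (a \<tau> k))\<^sup>2) + 2 * (sobolev_weight s k * (cmod (a t k))\<^sup>2))"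
        proof (rule sum_mono)
          fix k
          have "G k \<le> sobolev_weight s k * (2 * (cmod (a \<tau> k))\<^sup>2 + 2 * (cmod (a t k))\<^sup>2)"
            unfolding G_def using sobolev_weight_pos[of s k] by (intro mult_left_mono norm_diff_square_le) auto
          then show "G k \<le> 2 * (sobolev_weight s k * (cmod (a \<tau> k))\<^sup>2) + 2 * (sobolev_weight s k * (cmod (a t k))\<^sup>2)"
            by (simp add: algebra_simps)
        qed
        also have "\<dots> = 2 * sobolev_energy s n N (a \<tau>) + 2 * sobolev_energy s n N (a t)"
          by (simp add: sum.distrib sum_distrib_left)
        also have "\<dots> \<le> 2 * \<theta> n + 2 * \<theta> n"
          using tail[OF n(1) t] tail[OF n(1) elim(2)] by (intro add_mono mult_left_mono) auto
        finally have 1: "sum G {n..N} \<le> e'\<^sup>2 / 2" using n(2) by simp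
        have "sum G {1..N} \<le> sum G ({1..<n} \<union> {n..N})" using n G by (intro sum_mono2) auto
        also have "\<dots> = sum G {1..<n} + sum G {n..N}" by (rule sum.union_disjoint) auto
        also have "\<dots> \<le> e'\<^sup>2" using 1 elim(1) by (simp add: h_def G_def)
        finally show ?thesis using e' by (simp add: sobolev_bounded_def G_def)
      qed
      then have "sobolev_norm s (fourier_series (\<lambda>k. a \<tau> k - a t k)) \<le> e'"
        by (intro sobolev_series(2)[OF s]) (auto simp: a0)
      then show ?case using e' sobolev_norm_nonneg by (simp add: diff[OF elim(2)])
    qed
  qed
qed

lemma cubic_limit_cong:
  assumes "\<And>k. 1 \<le> k \<Longrightarrow> a k = b k"
  shows "cubic_limit \<sigma> a k = cubic_limit \<sigma> b k"
  unfolding cubic_limit_def by (intro arg_cong[where f = lim] ext trilinear_cong) (auto simp: assms)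

section \<open>Local well-posedness\<close>

theorem theorem3p1:
  fixes \<sigma> s :: real and u0 :: "real \<Rightarrow> complex"
  assumes "\<sigma> \<in> {0, 1}" and "s > 3 / 2"
    and "u0 \<in> sobolev_torus s" and "ae_eq (proj_pos u0) u0"
  shows "\<exists>T>0. \<exists>u. filamentation_solution \<sigma> s u0 T u \<and>
           (\<forall>v. filamentation_solution \<sigma> s u0 T v \<longrightarrow> (\<forall>t\<in>{0..T}. ae_eq (v t) (u t)))"
proof -
  have \<sigma>: "0 \<le> \<sigma>" "\<sigma> \<le> 1" and s: "3 / 2 < s" using assms(1,2) by auto
  define a0 where "a0 = fourier_coeffs u0"
  have u0: "a0 0 = 0" "ae_eq u0 (fourier_series a0)"
    unfolding a0_def using positive_spectrum_series[OF s assms(3,4)] by auto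
  have a0_sm: "summable (\<lambda>k. sobolev_weight s k * (cmod (a0 k))\<^sup>2)"
  proof (rule summableI_nonneg_bounded)
    fix n
    have "(\<Sum>k<n. sobolev_weight s k * (cmod (a0 k))\<^sup>2) \<le> (\<Sum>k\<in>insert 0 {1..n}. sobolev_weight s k * (cmod (a0 k))\<^sup>2)"
      by (intro sum_mono2) (auto simp: less_imp_le[OF sobolev_weight_pos])
    also have "\<dots> \<le> (sobolev_norm s u0)\<^sup>2"
      using sobolev_bounded_coeffs[OF assms(3), of n] by (simp add: u0 a0_def[symmetric] sobolev_bounded_def)
    finally show "(\<Sum>k<n. sobolev_weight s k * (cmod (a0 k))\<^sup>2) \<le> (sobolev_norm s u0)\<^sup>2" .
  qed (simp add: less_imp_le[OF sobolev_weight_pos])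
  show ?thesis
  proof (rule coefficient_wellposedness[OF \<sigma> s a0_sm])
    fix T \<theta> b
    assume T: "0 < T" and b: "coefficient_solution \<sigma> s a0 T b" and \<theta>: "\<theta> \<longlonglongrightarrow> (0::real)"
      and b\<theta>: "\<And>N n t. 1 \<le> n \<Longrightarrow> t \<in> {0..T} \<Longrightarrow> sobolev_energy s n N (b t) \<le> \<theta> n"
      and unique: "\<forall>v. coefficient_solution \<sigma> s a0 T v \<longrightarrow> (\<forall>t\<in>{0..T}. \<forall>k\<ge>1. v t k = b t k)"
    from b obtain R where b0: "\<And>k. 1 \<le> k \<Longrightarrow> b 0 k = a0 k"
      and db: "\<And>t k. t \<in> {0..T} \<Longrightarrow> 1 \<le> k \<Longrightarrow>
         ((\<lambda>t. b t k) has_vector_derivative \<i> * of_real (real k) * cubic_limit \<sigma> (b t) k) (at t within {0..T})"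
      and bR: "\<And>N t. t \<in> {0..T} \<Longrightarrow> sobolev_bounded s R N (b t)"
      unfolding coefficient_solution_def by blast
    \<comment> \<open>The coefficient system does not see the frequency \<open>0\<close>, where the solution must vanish.\<close>
    define a where "a t k = (if k = 0 then 0 else b t k)" for t k
    have a_0: "a t 0 = 0" for t by (simp add: a_def)
    have ab: "a t k = b t k" if "1 \<le> k" for t k using that by (simp add: a_def)
    have lim: "cubic_limit \<sigma> (a t) k = cubic_limit \<sigma> (b t) k" for t k by (rule cubic_limit_cong) (rule ab)
    have da: "((\<lambda>t. a t k) has_vector_derivative \<i> * of_real (real k) * cubic_limit \<sigma> (a t) k) (at t within {0..T})"
      if "t \<in> {0..T}" "1 \<le> k" for t k
      unfolding lim using db[OF that] that by (simp add: ab)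
    have sums: "sobolev_energy s n N (a t) = sobolev_energy s n N (b t)"
      if "1 \<le> n" for n N t using that by (intro sum.cong refl) (auto simp: ab)
    have aR: "sobolev_bounded s R N (a t)" if "t \<in> {0..T}" for N t
      using bR[OF that] unfolding sobolev_bounded_def by (simp only: sums order_refl)
    have a\<theta>: "sobolev_energy s n N (a t) \<le> \<theta> n" if "1 \<le> n" "t \<in> {0..T}" for N n t
      unfolding sums[OF that(1)] by (rule b\<theta>[OF that])
    have cont_a: "continuous_on {0..T} (\<lambda>t. a t n)" for n
    proof (cases "n = 0")
      case False
      then show ?thesis by (intro continuous_on_vector_derivative[OF da]) auto
    qed (simp add: a_0)
    define u where "u t = fourier_series (a t)" for t
    have a_sm: "summable (\<lambda>n. cmod (a t n))" if "t \<in> {0..T}" for t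
      by (rule summable_of_wiener[OF sobolev_bounded_summable_wiener[OF s aR[OF that]]])
    have "filamentation_solution \<sigma> s u0 T u"
      unfolding filamentation_solution_def
    proof (intro conjI ballI)
      show "continuous_in_sobolev s T u"
        unfolding u_def[abs_def] by (rule fourier_series_continuous_in_sobolev[OF s aR a_0 cont_a \<theta> a\<theta>])
      show "solves_filamentation_eq \<sigma> T u"
        unfolding u_def[abs_def] by (rule ode_imp_weak_solution[OF \<sigma> s T aR a_0 da])
      show "ae_eq (proj_pos (u t)) (u t)" if t: "t \<in> {0..T}" for t
        unfolding u_def
        by (rule proj_pos_eq_fourier_series(2)[OF a_sm[OF t] a_0]) (simp add: fourier_coeff_fourier_series[OF a_sm[OF t]])
      have "a 0 k = a0 k" for k using b0[of k] u0(1) by (cases "k = 0") (auto simp: a_def)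
      then have "a 0 = a0" by (rule ext)
      then show "ae_eq (u 0) u0" using u0(2) by (auto simp: u_def ae_eq_def)
    qed
    moreover have "ae_eq (v t) (u t)" if v: "filamentation_solution \<sigma> s u0 T v" and t: "t \<in> {0..T}" for v t
    proof -
      have cv: "continuous_in_sobolev s T v" and pv: "\<And>t. t \<in> {0..T} \<Longrightarrow> ae_eq (proj_pos (v t)) (v t)"
        and wv: "solves_filamentation_eq \<sigma> T v" and v0: "ae_eq (v 0) u0"
        using v by (auto simp: filamentation_solution_def)
      have vs: "v t \<in> sobolev_torus s" if "t \<in> {0..T}" for t using cv that by (simp add: continuous_in_sobolev_def)
      obtain R' where R': "\<And>t N. t \<in> {0..T} \<Longrightarrow> sobolev_bounded s R' N (fourier_coeffs (v t))"
        using continuous_in_sobolev_bounded[OF cv] by blast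
      have init: "fourier_coeffs (v 0) k = a0 k" for k
        unfolding fourier_coeffs_def a0_def
        using vs[of 0] T assms(3) by (intro fourier_coeff_ae_eq v0) (auto simp: sobolev_torus_def L2_torus_def)
      have "coefficient_solution \<sigma> s a0 T (\<lambda>t. fourier_coeffs (v t))"
        unfolding coefficient_solution_def using init weak_solution_imp_ode[OF \<sigma> s T cv pv wv] R' by blast
      with unique have v_eq: "fourier_coeffs (v t) k = b t k" if "1 \<le> k" for k using t that by blast
      have "fourier_coeffs (v t) k = a t k" for k
      proof (cases "k = 0")
        case True
        then show ?thesis using positive_spectrum_series(1)[OF s vs[OF t] pv[OF t]] by (simp add: a_0)
      next
        case False
        then have k: "1 \<le> k" by simp
        then show ?thesis using ab[OF k] v_eq[OF k] by simp
      qed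
      then have "fourier_coeffs (v t) = a t" by (rule ext)
      then show ?thesis using positive_spectrum_series(2)[OF s vs[OF t] pv[OF t]] by (simp add: u_def)
    qed
    ultimately show ?thesis using T by blast
  qed
qed

end
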